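(* Let $Y$ be a $C^\infty$ $n$-manifold with corners, let $\mathfrak{U}=\{U_j\}_{j\in J}$ be a regular finite open covering of $Y$ with an order $J=\{1<2<\cdots<|J|\}$, and let $\mathcal{P}_{\mathfrak U}=\{Y_i\}_{i\in I}$ be the regular partition of $Y$ associated to $\mathfrak U$. For each $j\in J$ let $H_j$ be a $C^\infty$ complex vector bundle on $\overline{U_j}$ (that is, the restriction of a $C^\infty$ complex vector bundle $H_j'$ on an open set $U_j'\supset\overline{U_j}$), and assume that $H_j$ has a $C^\infty$ section $s_j$ that is nowhere vanishing over $\overline{U_j}\cap\bigcup_{j'\neq j}\overline{U_{j'}}$. Define the following data. (i) (Blocks) For each block $Y_i$ let $J(i)=\{j_1<\cdots<j_l\}\subset J$ be the unique subset such that $Y_i$ is a connected component of $Y_{J(i)}$, and set $F_i:=H_{j_1}|_{Y_i}\otimes\cdots\otimes H_{j_l}|_{Y_i}$. (ii) (Clutching maps) For a common codimension-1 face $Z\subset Y_i\cap Y_{i'}$ there is a unique $j\in J$ with $Z\subset\partial\overline{U_j}$; relabel so that $\mathrm{Int}\,Y_{i'}\subset U_j$ and $Y_i\subset Y-U_j$, so that $J(i')=J(i)\cup\{j\}$, with $j$ inserted in $J(i)$ as $j_1<\cdots<j_{l''}<j<j_{l''+1}<\cdots<j_l$. Assign the direction $i\to i'$ and let $h_{Z,ii'}:F_i|_Z\to F_{i'}|_Z$ be the bundle map given by inserting $s_j|_Z$: $$H_{j_1}|_Z\otimes\cdots\otimes H_{j_l}|_Z\;\xrightarrow{\ \sim\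 }\;H_{j_1}|_Z\otimes\cdots\otimes H_{j_{l''}}|_Z\otimes s_j|_Z\otimes H_{j_{l''+1}}|_Z\otimes\cdots\otimes H_{j_l}|_Z\;\subset\; H_{j_1}|_Z\otimes\cdots\otimes H_{j_{l''}}|_Z\otimes H_j|_Z\otimes H_{j_{l''+1}}|_Z\otimes\cdots\otimes H_{j_l}|_Z=F_{i'}|_Z .$$ Then $(\{F_i\}_{i\in I},\{h_{Z,ii'}\})$ defines a $C^\infty$ complex-vector-bundle settlement over $Y$ with the regular partition $\mathcal P_{\mathfrak U}$ (the local tensorial system generated by $\{H_j\}_{j\in J}$).
   Context: Manifolds with corners: paracompact Hausdorff spaces locally diffeomorphic to open subsets of $[0,\infty)^k\times\mathbb R^{n-k}$; $\mathrm{Int}\,Y$ is the set of points with a neighborhood homeomorphic to an open subset of $\mathbb R^n$ and $\partial Y=Y-\mathrm{Int}\,Y$. Smooth maps or sections on arbitrary subsets are those that extend smoothly to an open neighborhood. Regular partition. A partition $\mathcal P$ of $Y$ is a decomposition $Y=\bigcup_{i\in I}Y_i$ into connected $C^\infty$ $n$-manifolds with corners embedded (as closed subsets) in $Y$, called blocks, with pairwise disjoint interiors. Let ${}_{\mathcal P}\mathbb R^k$ be $\mathbb R^k$ partitioned into its $2^k$ closed coordinate orthants. $\mathcal P$ is regular if (a) every interior point of $Y$ has a neighborhood which, with the induced partition, is diffeomorphic to a neighborhood of the origin in ${}_{\mathcal P}\mathbb R^k\times\mathbb R^{n-k}$ for some $0\le k\le n$; and (b) every $p\in\partial Y$ with a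 neighborhood modelled on $[0,\infty)^l\times\mathbb R^{n-l}$ at the origin has a smaller neighborhood which, with the induced partition, is diffeomorphic to a neighborhood of the origin in $[0,\infty)^l\times{}_{\mathcal P}\mathbb R^k\times\mathbb R^{n-l-k}$ for some $0\le k\le n-l$. The points with a given $k$ form the codimension-$k$ stratum. A codimension-$k$ facet of $\mathcal P$ is the closure of a connected component of the codimension-$k$ stratum; codimension-1 facets are called faces. Exactly $2^k$ blocks surround a codimension-$k$ facet. Regular covering. A finite open covering $\mathfrak U=\{U_j\}_{j\in J}$ of $Y$ is regular if: (1) each $\overline{U_j}$ is an embedded submanifold with corners of $Y$ (with $U_j$ the topological interior of $\overline{U_j}$ in $Y$) such that (1a) $\overline{U_j}\cap\mathrm{Int}\,Y$ is a smooth manifold with boundary, and (1b) each codimension-$k$ corner point of $\overline{U_j}$, $k\ge2$, is either a codimension-$k$ corner point of $Y$ or comes from the transverse intersection of $W_j:=\overline{\partial \overline{U_j}\cap\mathrm{Int}\,Y}$ with a codimension-$(k-1)$ facet in $\partial Y$; and (2) the $(n-1)$-dimensional strata of all the $W_j$, $j\in J$, and of $\partial Y$ intersect transversely wherever they meet. In claim (ii), "$Z\subset\partial\overline{U_j}$" refers to $Z\subset W_j$. Associated partition. For $p\in Y$ let $\chi(p)=\{j\in J: p\in U_j\}$; for $J'\subset J$ with $\chi^{-1}(J')\ne\emptyset$ let $Y_{J'}=\overline{\chi^{-1}(J')}$. Then $\mathcal P_{\mathfrak U}$ is the collection of connected components of all the $Y_{J'}$; it is a regular partition of $Y$. Bundle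 settlement. A $C^\infty$ complex-vector-bundle settlement over $Y$ with regular partition $\mathcal P=\{Y_i\}_{i\in I}$ consists of: (1) A $C^\infty$ complex vector bundle $F_i$ on each block $Y_i$, meaning that $F_i=F_i'|_{Y_i}$ for a fixed $C^\infty$ complex vector bundle $F_i'$ (extended block) on an open set $U_i'\supset Y_i$ of $Y$. (2.1) Gluing data, given inductively on codimension. For a face $Z$ in the intersection of distinct blocks $Y_i,Y_j$ with $\mathrm{rank}\,F_i<\mathrm{rank}\,F_j$: a bundle embedding $h_{Z,ij}:F_i|_Z\to F_j|_Z$ which is smooth around $Z$, i.e. extends to a $C^\infty$ bundle embedding $F_i'|_U\to F_j'|_U$ on some open neighborhood $U\subset U_i'\cap U_j'$ of $Z$. If the ranks are equal, one fixes one direction $i\to j$ and requires $h_{Z,ij}$ to be a bundle isomorphism that is smooth around $Z$. These maps are called clutching maps and are recorded as arrows $i\to j$ of a quiver $Q_Z$ whose vertices are the blocks around $Z$. For a facet $Z$ of codimension $k\ge2$, the clutching maps over the codimension-$(k-1)$ facets containing $Z$ restrict to $Z$ and give a preliminary quiver $Q_Z'$ on the $2^k$ blocks around $Z$. $Q_Z'$ is saturated if there is a vertex $v_*$ such that every vertex is the initial vertex of a directed edge path ending at $v_*$. If $Q_Z'$ is saturated, $Q_Z:=Q_Z'$ and the gluing data over $Z$ are these restrictions; otherwise further clutching maps over $Z$, smooth around $Z$, are added until the resulting quiver $Q_Z$ is saturated. (2.2) Consistency. For each facet $Z$ of codimension $k\ge 2$, inductively, the new consistency conditions (those not from restriction of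 clutching maps over facets of codimension $\le k-1$ containing $Z$) are: for distinct simple edge paths $\mathrm{Path}_1,\mathrm{Path}_2$ in $Q_Z$ with the same initial and the same final vertex, such that $\mathrm{Path}_1$ contains an arrow in $Q_Z-Q_Z'$, the corresponding compositions of clutching maps agree, where $\mathrm{Path}_2$ is taken to be the identity map if $\mathrm{Path}_1$ is a loop. *)

theory Defs
  imports "HOL-Analysis.Analysis" "HOL-Library.Function_Algebras"
begin

section \<open>Smooth maps between subsets of Euclidean spaces\<close>

primrec cont_diff ::
  "nat \<Rightarrow> 'x::real_normed_vector set \<Rightarrow> ('x \<Rightarrow> 'y::real_normed_vector) \<Rightarrow> bool" where
  "cont_diff 0 S f \<longleftrightarrow> continuous_on S f"
| "cont_diff (Suc k) S f \<longleftrightarrow>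
     (\<forall>x\<in>S. f differentiable at x) \<and>
     (\<forall>v. cont_diff k S (\<lambda>x. frechet_derivative f (at x) v))"

text \<open>Meaningful for open \<open>S\<close>; on arbitrary sets use \<open>smooth_ext\<close>.\<close>

definition smooth_on :: "'x::real_normed_vector set \<Rightarrow> ('x \<Rightarrow> 'y::real_normed_vector) \<Rightarrow> bool" where
  "smooth_on S f \<longleftrightarrow> (\<forall>k. cont_diff k S f)"

definition smooth_ext :: "'x::real_normed_vector set \<Rightarrow> ('x \<Rightarrow> 'y::real_normed_vector) \<Rightarrow> bool" where
  "smooth_ext S f \<longleftrightarrow>
     (\<forall>x\<in>S. \<exists>W g. open W \<and> x \<in> W \<and> smooth_on W g \<and> (\<forall>y\<in>W \<inter> S. g y = f y))"


section \<open>Manifolds with corners\<close>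

text \<open>The dimension is \<open>n = CARD('n) \<ge> 1\<close>. The model is \<open>[0,\<infinity>)\<^sup>k \<times> \<real>\<^sup>n\<^sup>-\<^sup>k\<close>, where \<open>K\<close> is the set of the \<open>k\<close> nonnegative coordinates.\<close>

definition orthant :: "'n set \<Rightarrow> (real ^ 'n::finite) set" where
  "orthant K = {x. \<forall>i\<in>K. 0 \<le> x $ i}"

record ('a, 'n::finite) mcorner =
  mtop :: "'a topology"
  charts :: "('a set \<times> ('a \<Rightarrow> real ^ 'n)) set"

definition smooth_fun ::
  "('a, 'n::finite) mcorner \<Rightarrow> 'a set \<Rightarrow> ('a \<Rightarrow> 'y::real_normed_vector) \<Rightarrow> bool" where
  "smooth_fun M S f \<longleftrightarrow>
     (\<forall>(W, \<psi>) \<in> charts M. smooth_ext (\<psi> ` (S \<inter> W)) (\<lambda>x. f (inv_into W \<psi> x)))"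

text \<open>\<open>(V, \<phi>)\<close> is a corner chart of the \<open>n\<close>-dimensional subset \<open>S\<close> of \<open>M\<close>: a diffeomorphism, for the
  smooth structure that \<open>S\<close> inherits from \<open>M\<close>, from the relatively open set \<open>V \<subseteq> S\<close> onto a
  relatively open subset of the model \<open>orthant K\<close>.\<close>

definition chart_on ::
  "('a, 'n::finite) mcorner \<Rightarrow> 'a set \<Rightarrow> 'a set \<Rightarrow> ('a \<Rightarrow> real ^ 'n) \<Rightarrow> 'n set \<Rightarrow> bool" where
  "chart_on M S V \<phi> K \<longleftrightarrow>
     openin (subtopology (mtop M) S) V \<and>
     openin (top_of_set (orthant K)) (\<phi> ` V) \<and>
     homeomorphic_map (subtopology (mtop M) V) (top_of_set (\<phi> ` V)) \<phi> \<and>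
     smooth_fun M V \<phi> \<and>
     (\<forall>(W, \<psi>) \<in> charts M. smooth_ext (\<phi> ` (V \<inter> W)) (\<lambda>x. \<psi> (inv_into V \<phi> x)))"

definition paracompact_space :: "'a topology \<Rightarrow> bool" where
  "paracompact_space X \<longleftrightarrow>
     (\<forall>\<U>. (\<forall>u\<in>\<U>. openin X u) \<and> \<Union>\<U> = topspace X \<longrightarrow>
        (\<exists>\<V>. (\<forall>v\<in>\<V>. openin X v \<and> (\<exists>u\<in>\<U>. v \<subseteq> u)) \<and> \<Union>\<V> = topspace X \<and> locally_finite_in X \<V>))"

definition manifold_with_corners :: "('a, 'n::finite) mcorner \<Rightarrow> bool" where
  "manifold_with_corners M \<longleftrightarrow>
     Hausdorff_space (mtop M) \<and> paracompact_space (mtop M) \<and>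
     \<Union>(fst ` charts M) = topspace (mtop M) \<and>
     (\<forall>(W, \<psi>) \<in> charts M. \<exists>K. chart_on M (topspace (mtop M)) W \<psi> K)"

definition embedded_with_corners :: "('a, 'n::finite) mcorner \<Rightarrow> 'a set \<Rightarrow> bool" where
  "embedded_with_corners M S \<longleftrightarrow>
     S \<subseteq> topspace (mtop M) \<and> (\<forall>p\<in>S. \<exists>V \<phi> K. chart_on M S V \<phi> K \<and> p \<in> V)"

definition embedded_with_boundary :: "('a, 'n::finite) mcorner \<Rightarrow> 'a set \<Rightarrow> bool" where
  "embedded_with_boundary M S \<longleftrightarrow>
     S \<subseteq> topspace (mtop M) \<and>
     (\<forall>p\<in>S. \<exists>V \<phi> K. chart_on M S V \<phi> K \<and> p \<in> V \<and> card K \<le> 1)"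

definition corner_point :: "('a, 'n::finite) mcorner \<Rightarrow> 'a set \<Rightarrow> nat \<Rightarrow> 'a \<Rightarrow> bool" where
  "corner_point M S k p \<longleftrightarrow>
     (\<exists>V \<phi> K. chart_on M S V \<phi> K \<and> p \<in> V \<and> card {i\<in>K. \<phi> p $ i = 0} = k)"

definition mf_interior :: "('a, 'n::finite) mcorner \<Rightarrow> 'a set \<Rightarrow> 'a set" where
  "mf_interior M S =
     {p. \<exists>V (W :: (real ^ 'n) set). openin (subtopology (mtop M) S) V \<and> p \<in> V \<and> open W \<and>
           subtopology (mtop M) V homeomorphic_space top_of_set W}"

definition mf_boundary :: "('a, 'n::finite) mcorner \<Rightarrow> 'a set \<Rightarrow> 'a set" where
  "mf_boundary M S = (topspace (mtop M) \<inter> S) - mf_interior M S"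

abbreviation Int_mf :: "('a, 'n::finite) mcorner \<Rightarrow> 'a set" where
  "Int_mf M \<equiv> mf_interior M (topspace (mtop M))"

abbreviation Bd_mf :: "('a, 'n::finite) mcorner \<Rightarrow> 'a set" where
  "Bd_mf M \<equiv> mf_boundary M (topspace (mtop M))"


section \<open>Regular partitions\<close>

definition mf_partition :: "('a, 'n::finite) mcorner \<Rightarrow> 'a set set \<Rightarrow> bool" where
  "mf_partition M P \<longleftrightarrow>
     \<Union>P = topspace (mtop M) \<and>
     (\<forall>B\<in>P. B \<noteq> {} \<and> closedin (mtop M) B \<and> connectedin (mtop M) B \<and> embedded_with_corners M B) \<and>
     (\<forall>B\<in>P. \<forall>B'\<in>P. B \<noteq> B' \<longrightarrow> mf_interior M B \<inter> mf_interior M B' = {})"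

text \<open>The \<open>2\<^sup>k\<close> closed coordinate orthants of \<open>\<real>\<^sup>k \<times> \<real>\<^sup>n\<^sup>-\<^sup>k\<close>, where \<open>K\<close> is the set of coordinates
  in the first factor and \<open>S \<subseteq> K\<close> is the set of those required to be nonnegative.\<close>

definition sign_orthant :: "'n set \<Rightarrow> 'n set \<Rightarrow> (real ^ 'n::finite) set" where
  "sign_orthant K S = {x. (\<forall>i\<in>S. 0 \<le> x $ i) \<and> (\<forall>i\<in>K - S. x $ i \<le> 0)}"

text \<open>\<open>U\<close> with the partition induced by \<open>P\<close> is diffeomorphic to a neighborhood of the origin in
  \<open>[0,\<infinity>)\<^sup>L \<times> \<^sub>P\<real>\<^sup>K \<times> \<real>\<^sup>n\<^sup>-\<^sup>|\<^sup>L\<^sup>|\<^sup>-\<^sup>|\<^sup>K\<^sup>|\<close>, with \<open>p\<close> at the origin.\<close>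

definition local_model ::
  "('a, 'n::finite) mcorner \<Rightarrow> 'a set set \<Rightarrow> 'a \<Rightarrow> 'a set \<Rightarrow> 'n set \<Rightarrow> 'n set \<Rightarrow> bool" where
  "local_model M P p U L K \<longleftrightarrow>
     L \<inter> K = {} \<and>
     (\<exists>\<phi>. chart_on M (topspace (mtop M)) U \<phi> L \<and> p \<in> U \<and> \<phi> p = 0 \<and>
        {\<phi> ` (B \<inter> U) |B. B \<in> P \<and> B \<inter> U \<noteq> {}} = {\<phi> ` U \<inter> sign_orthant K S |S. S \<subseteq> K})"

definition regular_partition :: "('a, 'n::finite) mcorner \<Rightarrow> 'a set set \<Rightarrow> bool" where
  "regular_partition M P \<longleftrightarrow>
     mf_partition M P \<and>
     (\<forall>p \<in> Int_mf M. \<exists>U K. local_model M P p U {} K) \<and>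
     (\<forall>p \<in> Bd_mf M. \<forall>N \<phi> L.
        chart_on M (topspace (mtop M)) N \<phi> L \<and> p \<in> N \<and> \<phi> p = 0 \<longrightarrow>
          (\<exists>U\<subseteq>N. \<exists>K. local_model M P p U L K))"

definition stratum :: "('a, 'n::finite) mcorner \<Rightarrow> 'a set set \<Rightarrow> nat \<Rightarrow> 'a set" where
  "stratum M P k = {p. \<exists>U L K. local_model M P p U L K \<and> card K = k}"

definition facets :: "('a, 'n::finite) mcorner \<Rightarrow> 'a set set \<Rightarrow> nat \<Rightarrow> 'a set set" where
  "facets M P k =
     (\<lambda>C. mtop M closure_of C) ` connected_components_of (subtopology (mtop M) (stratum M P k))"

text \<open>In the local model at a point of the codimension-\<open>k\<close> stratum with closure \<open>Z\<close>, the \<open>2\<^sup>k\<close> blocks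
  meeting at the point are exactly those that contain \<open>Z\<close>.\<close>

definition blocks_around :: "'a set set \<Rightarrow> 'a set \<Rightarrow> 'a set set" where
  "blocks_around P Z = {B\<in>P. Z \<subseteq> B}"


section \<open>Regular coverings\<close>

definition wall :: "('a, 'n::finite) mcorner \<Rightarrow> (nat \<Rightarrow> 'a set) \<Rightarrow> nat \<Rightarrow> 'a set" where
  "wall M U j = mtop M closure_of (mf_boundary M (mtop M closure_of U j) \<inter> Int_mf M)"

text \<open>In a corner chart \<open>(V, \<psi>, K)\<close> around \<open>p\<close> of the closure of \<open>U j\<close>, the closed \<open>(n-1)\<close>-dimensional
  strata of \<open>wall M U j\<close> that pass through \<open>p\<close> are the closures of \<open>{\<psi> $ i = 0} \<inter> Int M\<close> for the
  following \<open>i\<close>. (The remaining coordinate hyperplanes lie in the boundary of \<open>M\<close> near \<open>p\<close>.)\<close>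

definition wall_sheets ::
  "('a, 'n::finite) mcorner \<Rightarrow> 'a \<Rightarrow> 'a set \<Rightarrow> ('a \<Rightarrow> real ^ 'n) \<Rightarrow> 'n set \<Rightarrow> 'n set" where
  "wall_sheets M p V \<psi> K = {i\<in>K. p \<in> mtop M closure_of ({q\<in>V. \<psi> q $ i = 0} \<inter> Int_mf M)}"

text \<open>All closed \<open>(n-1)\<close>-dimensional strata through \<open>p\<close> of the walls with index in \<open>J\<close> and of the
  boundary of \<open>M\<close> meet transversely at \<open>p\<close>: the covectors cutting out their tangent hyperplanes are
  linearly independent. They are expressed in one chart \<open>(V, \<phi>)\<close> of \<open>M\<close>; \<open>D j i\<close> is the differential
  of the \<open>i\<close>-th coordinate of a corner chart \<open>\<psi> j\<close> of the closure of \<open>U j\<close>. Strata are closed here: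
  open strata of a wall and of the boundary of \<open>M\<close> would never meet.\<close>

definition transverse_at ::
  "('a, 'n::finite) mcorner \<Rightarrow> nat set \<Rightarrow> (nat \<Rightarrow> 'a set) \<Rightarrow> 'a \<Rightarrow> bool" where
  "transverse_at M J U p \<longleftrightarrow>
     (\<exists>V \<phi> L V' \<psi> K D.
        chart_on M (topspace (mtop M)) V \<phi> L \<and> p \<in> V \<and>
        (\<forall>j\<in>J. p \<in> mtop M closure_of U j \<longrightarrow>
           chart_on M (mtop M closure_of U j) (V' j) (\<psi> j) (K j) \<and> p \<in> V' j \<and>
           (\<forall>i\<in>K j. ((\<lambda>x. \<psi> j (inv_into V \<phi> x) $ i) has_derivative D j i)
                      (at (\<phi> p) within \<phi> ` (V \<inter> V' j)))) \<and>
        (let L0 = {i\<in>L. \<phi> p $ i = 0};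
             R = {(j, i). j \<in> J \<and> p \<in> mtop M closure_of U j \<and> i \<in> wall_sheets M p (V' j) (\<psi> j) (K j)}
         in \<forall>(a :: 'n \<Rightarrow> real) (b :: nat \<times> 'n \<Rightarrow> real).
              (\<forall>v. (\<Sum>i\<in>L0. a i * v $ i) + (\<Sum>(j, i)\<in>R. b (j, i) * D j i v) = 0) \<longrightarrow>
              (\<forall>i\<in>L0. a i = 0) \<and> (\<forall>r\<in>R. b r = 0)))"

definition regular_covering ::
  "('a, 'n::finite) mcorner \<Rightarrow> nat set \<Rightarrow> (nat \<Rightarrow> 'a set) \<Rightarrow> bool" where
  "regular_covering M J U \<longleftrightarrow>
     finite J \<and> (\<forall>j\<in>J. openin (mtop M) (U j)) \<and> (\<Union>j\<in>J. U j) = topspace (mtop M) \<and>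
     (\<forall>j\<in>J.
        embedded_with_corners M (mtop M closure_of U j) \<and>
        U j = mtop M interior_of (mtop M closure_of U j) \<and>
        embedded_with_boundary M (mtop M closure_of U j \<inter> Int_mf M) \<and>
        (\<forall>k\<ge>2. \<forall>p. corner_point M (mtop M closure_of U j) k p \<longrightarrow>
           corner_point M (topspace (mtop M)) k p \<or>
           corner_point M (topspace (mtop M)) (k - 1) p \<and> p \<in> wall M U j \<and> transverse_at M {j} U p)) \<and>
     (\<forall>p\<in>topspace (mtop M). transverse_at M J U p)"

definition chi :: "nat set \<Rightarrow> (nat \<Rightarrow> 'a set) \<Rightarrow> 'a \<Rightarrow> nat set" where
  "chi J U p = {j\<in>J. p \<in> U j}"

definition chi_fibre :: "('a, 'n::finite) mcorner \<Rightarrow> nat set \<Rightarrow> (nat \<Rightarrow> 'a set) \<Rightarrow> nat set \<Rightarrow> 'a set" where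
  "chi_fibre M J U A = {p\<in>topspace (mtop M). chi J U p = A}"

definition is_component_over ::
  "('a, 'n::finite) mcorner \<Rightarrow> nat set \<Rightarrow> (nat \<Rightarrow> 'a set) \<Rightarrow> nat set \<Rightarrow> 'a set \<Rightarrow> bool" where
  "is_component_over M J U A B \<longleftrightarrow>
     A \<subseteq> J \<and> chi_fibre M J U A \<noteq> {} \<and>
     B \<in> connected_components_of (subtopology (mtop M) (mtop M closure_of chi_fibre M J U A))"

definition covering_partition ::
  "('a, 'n::finite) mcorner \<Rightarrow> nat set \<Rightarrow> (nat \<Rightarrow> 'a set) \<Rightarrow> 'a set set" where
  "covering_partition M J U = {B. \<exists>A. is_component_over M J U A B}"

definition block_index ::
  "('a, 'n::finite) mcorner \<Rightarrow> nat set \<Rightarrow> (nat \<Rightarrow> 'a set) \<Rightarrow> 'a set \<Rightarrow> nat set" where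
  "block_index M J U B = (THE A. is_component_over M J U A B)"


section \<open>Complex vector bundles\<close>

text \<open>Fibres are finite-dimensional complex subspaces of a function space \<open>'b \<Rightarrow> complex\<close>. As \<open>'b\<close> is
  arbitrary this is no restriction: any family of complex vector spaces embeds into their direct
  sum, and that into the functions on a basis of it.\<close>

global_interpretation cfun: vector_space "\<lambda>(c :: complex) (f :: 'b \<Rightarrow> complex) x. c * f x"
  by unfold_locales (auto simp: fun_eq_iff algebra_simps)

text \<open>A smooth bundle over an open set \<open>base E\<close> is given by an atlas of local frames
  \<open>(V, I, (e i)\<^bsub>i \<in> I\<^esub>)\<close> with smooth transition functions; its rank is locally constant. A smooth
  bundle on an arbitrary \<open>S \<subseteq> base E\<close> is by definition a restriction of such an \<open>E\<close>.\<close>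

record ('a, 'b, 'k) vbundle =
  base :: "'a set"
  fibre :: "'a \<Rightarrow> ('b \<Rightarrow> complex) set"
  frames :: "('a set \<times> 'k set \<times> ('k \<Rightarrow> 'a \<Rightarrow> 'b \<Rightarrow> complex)) set"

definition smooth_comb ::
  "('a, 'n::finite) mcorner \<Rightarrow> 'a set \<Rightarrow> 'k set \<Rightarrow> ('k \<Rightarrow> 'a \<Rightarrow> 'b \<Rightarrow> complex) \<Rightarrow>
   ('a \<Rightarrow> 'b \<Rightarrow> complex) \<Rightarrow> bool" where
  "smooth_comb M V I e s \<longleftrightarrow>
     (\<exists>c :: 'k \<Rightarrow> 'a \<Rightarrow> complex. (\<forall>i\<in>I. smooth_fun M V (c i)) \<and>
        (\<forall>p\<in>V. s p = (\<lambda>x. \<Sum>i\<in>I. c i p * e i p x)))"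

definition vector_bundle :: "('a, 'n::finite) mcorner \<Rightarrow> ('a, 'b, 'k) vbundle \<Rightarrow> bool" where
  "vector_bundle M E \<longleftrightarrow>
     openin (mtop M) (base E) \<and> \<Union>(fst ` frames E) = base E \<and>
     (\<forall>(V, I, e) \<in> frames E.
        openin (mtop M) V \<and> finite I \<and>
        (\<forall>p\<in>V. inj_on (\<lambda>i. e i p) I \<and> cfun.independent ((\<lambda>i. e i p) ` I) \<and>
               cfun.span ((\<lambda>i. e i p) ` I) = fibre E p) \<and>
        (\<forall>(V', I', e') \<in> frames E. \<forall>i\<in>I'. smooth_comb M (V \<inter> V') I e (e' i)))"

definition smooth_section ::
  "('a, 'n::finite) mcorner \<Rightarrow> ('a, 'b, 'k) vbundle \<Rightarrow> 'a set \<Rightarrow> ('a \<Rightarrow> 'b \<Rightarrow> complex) \<Rightarrow> bool" where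
  "smooth_section M E W s \<longleftrightarrow>
     openin (mtop M) W \<and> W \<subseteq> base E \<and>
     (\<forall>(V, I, e) \<in> frames E. smooth_comb M (V \<inter> W) I e s)"

definition smooth_section_on ::
  "('a, 'n::finite) mcorner \<Rightarrow> ('a, 'b, 'k) vbundle \<Rightarrow> 'a set \<Rightarrow> ('a \<Rightarrow> 'b \<Rightarrow> complex) \<Rightarrow> bool" where
  "smooth_section_on M E S s \<longleftrightarrow>
     (\<exists>W s'. S \<subseteq> W \<and> smooth_section M E W s' \<and> (\<forall>p\<in>S. s' p = s p))"

definition bundle_embedding ::
  "('a, 'n::finite) mcorner \<Rightarrow> ('a, 'b, 'k) vbundle \<Rightarrow> ('a, 'b, 'k) vbundle \<Rightarrow> 'a set \<Rightarrow>
   ('a \<Rightarrow> ('b \<Rightarrow> complex) \<Rightarrow> ('b \<Rightarrow> complex)) \<Rightarrow> bool" where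
  "bundle_embedding M E E' W h \<longleftrightarrow>
     openin (mtop M) W \<and> W \<subseteq> base E \<inter> base E' \<and>
     (\<forall>p\<in>W. h p ` fibre E p \<subseteq> fibre E' p \<and> inj_on (h p) (fibre E p) \<and>
        (\<forall>x\<in>fibre E p. \<forall>y\<in>fibre E p. h p (x + y) = h p x + h p y) \<and>
        (\<forall>x\<in>fibre E p. \<forall>c. h p (\<lambda>b. c * x b) = (\<lambda>b. c * h p x b))) \<and>
     (\<forall>(V, I, e) \<in> frames E. \<forall>i\<in>I. smooth_section M E' (V \<inter> W) (\<lambda>p. h p (e i p)))"

definition bundle_rank :: "('a, 'b, 'k) vbundle \<Rightarrow> 'a set \<Rightarrow> nat" where
  "bundle_rank E S = (THE r. \<forall>p\<in>S. cfun.dim (fibre E p) = r)"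


section \<open>Tensor products of bundles\<close>

text \<open>For subspaces \<open>E j\<close> of \<open>'b \<Rightarrow> complex\<close>, the tensor product over \<open>j \<in> A\<close> is realized inside the
  functions of a variable \<open>x = (x j)\<^sub>j\<close> by \<open>(\<Otimes>v)(x) = (\<Prod>j\<in>A. v j (x j))\<close>; see
  \<open>tensor_space_universal\<close> below. The slot of the factor \<open>j\<close> is the variable \<open>x j\<close>, so the factors
  stand in the order of their indices, and inserting a vector \<open>w\<close> between the factors with index
  below \<open>j\<close> and those with index above \<open>j\<close> is multiplication by \<open>w (x j)\<close>.\<close>

definition tensor_vec :: "nat set \<Rightarrow> (nat \<Rightarrow> 'b \<Rightarrow> complex) \<Rightarrow> ((nat \<Rightarrow> 'b) \<Rightarrow> complex)" where
  "tensor_vec A v = (\<lambda>x. \<Prod>j\<in>A. v j (x j))"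

definition tensor_space :: "nat set \<Rightarrow> (nat \<Rightarrow> ('b \<Rightarrow> complex) set) \<Rightarrow> ((nat \<Rightarrow> 'b) \<Rightarrow> complex) set" where
  "tensor_space A E = cfun.span {tensor_vec A v |v. \<forall>j\<in>A. v j \<in> E j}"

lemma tensor_vec_indep:
  fixes B :: "nat \<Rightarrow> ('b \<Rightarrow> complex) set"
  assumes "finite A" "\<And>j. j \<in> A \<Longrightarrow> cfun.independent (B j)"
    and "finite T" "\<And>f j. f \<in> T \<Longrightarrow> j \<in> A \<Longrightarrow> f j \<in> B j"
    and "\<And>f g. f \<in> T \<Longrightarrow> g \<in> T \<Longrightarrow> \<forall>j\<in>A. f j = g j \<Longrightarrow> f = g"
    and "\<And>x. (\<Sum>f\<in>T. c f * tensor_vec A f x) = 0"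
    and "f0 \<in> T"
  shows "c f0 = 0"
  using assms
proof (induction A arbitrary: T rule: finite_induct)
  case empty
  then have "T = {f0}" by blast
  then show ?case using empty(5)[of undefined] by (simp add: tensor_vec_def)
next
  case (insert a A)
  define d where "d x b = (\<Sum>f | f \<in> T \<and> f a = b. c f * tensor_vec A f x)" for x b
  have fin: "finite T" by fact
  have ins: "tensor_vec (insert a A) f (x(a := t)) = f a t * tensor_vec A f x" for f t and x :: "nat \<Rightarrow> 'b"
  proof -
    have "(\<Prod>j\<in>A. f j ((x(a := t)) j)) = (\<Prod>j\<in>A. f j (x j))"
      by (rule prod.cong) (use insert.hyps in auto)
    then show ?thesis using insert.hyps by (simp add: tensor_vec_def)
  qed
  have zero: "d x (f0 a) = 0" for x
  proof -
    have "(\<Sum>b\<in>(\<lambda>f. f a) ` T. (\<lambda>t. d x b * b t)) = 0"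
    proof
      fix t
      have "(\<Sum>b\<in>(\<lambda>f. f a) ` T. (\<lambda>t. d x b * b t)) t = (\<Sum>b\<in>(\<lambda>f. f a) ` T. d x b * b t)"
        by (induction rule: infinite_finite_induct) auto
      also have "\<dots> = (\<Sum>b\<in>(\<lambda>f. f a) ` T. \<Sum>f | f \<in> T \<and> f a = b. c f * tensor_vec (insert a A) f (x(a := t)))"
        unfolding d_def sum_distrib_right by (intro sum.cong refl) (auto simp: ins)
      also have "\<dots> = (\<Sum>f\<in>T. c f * tensor_vec (insert a A) f (x(a := t)))"
        by (rule sum.image_gen[OF fin, symmetric])
      finally show "(\<Sum>b\<in>(\<lambda>f. f a) ` T. (\<lambda>t. d x b * b t)) t = 0 t"
        using insert.prems(5) by simp
    qed
    moreover have "cfun.independent ((\<lambda>f. f a) ` T)"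
      by (rule cfun.independent_mono[OF insert.prems(1)[of a]]) (use insert.prems(3) in auto)
    ultimately show ?thesis
      using cfun.independentD[of "(\<lambda>f. f a) ` T" "(\<lambda>f. f a) ` T" "d x" "f0 a"] fin insert.prems(6)
      by auto
  qed
  show ?case
  proof (rule insert.IH[of "{f\<in>T. f a = f0 a}"])
    show "(\<Sum>f\<in>{f\<in>T. f a = f0 a}. c f * tensor_vec A f x) = 0" for x
      using zero[of x] by (simp add: d_def)
    show "\<And>f g. f \<in> {f \<in> T. f a = f0 a} \<Longrightarrow> g \<in> {f \<in> T. f a = f0 a} \<Longrightarrow> \<forall>j\<in>A. f j = g j \<Longrightarrow> f = g"
      using insert.prems(4) by auto
  qed (use insert.prems in auto)
qed

text \<open>Every multilinear map on \<open>\<Prod>j\<in>A. E j\<close> factors through \<open>tensor_vec A\<close> by a linear map, which is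
  unique on \<open>tensor_space A E\<close>, the span of the image.\<close>

lemma tensor_space_universal:
  fixes E :: "nat \<Rightarrow> ('b \<Rightarrow> complex) set"
    and m :: "(nat \<Rightarrow> 'b \<Rightarrow> complex) \<Rightarrow> ('c \<Rightarrow> complex)"
  assumes A: "finite A" and sub: "\<And>j. j \<in> A \<Longrightarrow> cfun.subspace (E j)"
    and cong: "\<And>v w. \<forall>j\<in>A. v j = w j \<Longrightarrow> m v = m w"
    and add: "\<And>v j x y. \<forall>i\<in>A. v i \<in> E i \<Longrightarrow> j \<in> A \<Longrightarrow> x \<in> E j \<Longrightarrow> y \<in> E j \<Longrightarrow>
                m (v(j := x + y)) = m (v(j := x)) + m (v(j := y))"
    and scale: "\<And>v j x c. \<forall>i\<in>A. v i \<in> E i \<Longrightarrow> j \<in> A \<Longrightarrow> x \<in> E j \<Longrightarrow>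
                m (v(j := (\<lambda>b. c * x b))) = (\<lambda>b. c * m (v(j := x)) b)"
  shows "\<exists>L. Vector_Spaces.linear (\<lambda>c x b. c * x b) (\<lambda>c x b. c * x b) L \<and>
             (\<forall>v. (\<forall>j\<in>A. v j \<in> E j) \<longrightarrow> L (tensor_vec A v) = m v)"
proof -
  interpret p: vector_space_pair "\<lambda>(c :: complex) (x :: (nat \<Rightarrow> 'b) \<Rightarrow> complex) b. c * x b"
      "\<lambda>(c :: complex) (x :: 'c \<Rightarrow> complex) b. c * x b" ..
  have "\<exists>B. \<forall>j\<in>A. cfun.independent (B j) \<and> B j \<subseteq> E j \<and> cfun.span (B j) = E j"
  proof (rule bchoice, rule ballI)
    fix j assume j: "j \<in> A"
    obtain B where "B \<subseteq> E j" "cfun.independent B" "E j \<subseteq> cfun.span B"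
      using cfun.maximal_independent_subset by blast
    then show "\<exists>B. cfun.independent B \<and> B \<subseteq> E j \<and> cfun.span B = E j"
      using cfun.span_minimal[OF _ sub[OF j]] by blast
  qed
  then obtain B where B: "\<And>j. j \<in> A \<Longrightarrow> cfun.independent (B j)" "\<And>j. j \<in> A \<Longrightarrow> B j \<subseteq> E j"
      "\<And>j. j \<in> A \<Longrightarrow> cfun.span (B j) = E j"
    by blast
  define S where "S = Pi\<^sub>E A B"
  have indep: "c f0 = 0"
    if "finite T" "T \<subseteq> S" "\<And>x. (\<Sum>f\<in>T. c f * tensor_vec A f x) = 0" "f0 \<in> T" for T c f0
  proof (rule tensor_vec_indep[OF A B(1) that(1) _ _ that(3,4)])
    show "\<And>f g. f \<in> T \<Longrightarrow> g \<in> T \<Longrightarrow> \<forall>j\<in>A. f j = g j \<Longrightarrow> f = g"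
      using that(2) unfolding S_def by (meson PiE_ext subsetD)
  qed (use that(2) in \<open>auto simp: S_def\<close>)
  have inj: "inj_on (tensor_vec A) S"
  proof (rule inj_onI, rule ccontr)
    fix f g assume *: "f \<in> S" "g \<in> S" "tensor_vec A f = tensor_vec A g" "f \<noteq> g"
    have "(\<lambda>h. if h = f then 1 else - 1 :: complex) f = 0"
      by (rule indep[of "{f, g}"]) (use * in auto)
    then show False by simp
  qed
  have ind: "cfun.independent (tensor_vec A ` S)"
  proof
    assume "cfun.dependent (tensor_vec A ` S)"
    then obtain R u w where R: "finite R" "R \<subseteq> tensor_vec A ` S" "w \<in> R" "u w \<noteq> 0"
        "(\<Sum>v\<in>R. (\<lambda>x. u v * v x)) = 0"
      unfolding cfun.dependent_explicit by blast
    obtain T where T: "T \<subseteq> S" "finite T" "R = tensor_vec A ` T"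
      using finite_subset_image[OF R(1,2)] by blast
    obtain f0 where f0: "f0 \<in> T" "w = tensor_vec A f0" using R(3) T(3) by blast
    have "(\<lambda>f. u (tensor_vec A f)) f0 = 0"
    proof (rule indep[OF T(2,1) _ f0(1)])
      fix x
      have "(\<Sum>f\<in>T. u (tensor_vec A f) * tensor_vec A f x) = (\<Sum>v\<in>R. u v * v x)"
        unfolding T(3) by (subst sum.reindex[OF inj_on_subset[OF inj T(1)]]) simp
      also have "\<dots> = (\<Sum>v\<in>R. (\<lambda>x. u v * v x)) x"
        by (induction R rule: infinite_finite_induct) auto
      finally show "(\<Sum>f\<in>T. u (tensor_vec A f) * tensor_vec A f x) = 0"
        using R(5) by simp
    qed
    then show False using R(4) f0(2) by simp
  qed
  define L where "L = p.construct (tensor_vec A ` S) (\<lambda>t. m (inv_into S (tensor_vec A) t))"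
  have lin: "Vector_Spaces.linear (\<lambda>c x b. c * x b) (\<lambda>c x b. c * x b) L"
    unfolding L_def by (rule p.linear_construct[OF ind])
  interpret L: Vector_Spaces.linear "\<lambda>(c :: complex) (x :: (nat \<Rightarrow> 'b) \<Rightarrow> complex) b. c * x b"
      "\<lambda>(c :: complex) (x :: 'c \<Rightarrow> complex) b. c * x b" L by (fact lin)
  have LS: "L (tensor_vec A f) = m f" if "f \<in> S" for f
    using that inj by (simp add: L_def p.construct_basis[OF ind])
  have tv_add: "tensor_vec A (v(j := x + y)) = tensor_vec A (v(j := x)) + tensor_vec A (v(j := y))"
    and tv_scale: "tensor_vec A (v(j := (\<lambda>b. c * x b))) = (\<lambda>b. c * tensor_vec A (v(j := x)) b)"
    if "j \<in> A" for v :: "nat \<Rightarrow> 'b \<Rightarrow> complex" and j x y c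
  proof -
    have *: "tensor_vec A (v(j := z)) b = z (b j) * (\<Prod>i\<in>A - {j}. v i (b i))" for z b
    proof -
      have "(\<Prod>i\<in>A - {j}. (v(j := z)) i (b i)) = (\<Prod>i\<in>A - {j}. v i (b i))"
        by (rule prod.cong) auto
      then show ?thesis using A that by (simp add: tensor_vec_def prod.remove)
    qed
    show "tensor_vec A (v(j := x + y)) = tensor_vec A (v(j := x)) + tensor_vec A (v(j := y))"
      and "tensor_vec A (v(j := (\<lambda>b. c * x b))) = (\<lambda>b. c * tensor_vec A (v(j := x)) b)"
      by (auto simp: fun_eq_iff * algebra_simps)
  qed
  have tv_cong: "tensor_vec A v = tensor_vec A w" if "\<forall>j\<in>A. v j = w j" for v w :: "nat \<Rightarrow> 'b \<Rightarrow> complex"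
    using that by (auto simp: tensor_vec_def fun_eq_iff intro: prod.cong)
  have "\<forall>v. (\<forall>j\<in>A. v j \<in> E j) \<and> (\<forall>j\<in>A - C. v j \<in> B j) \<longrightarrow> L (tensor_vec A v) = m v"
    if "C \<subseteq> A" for C
    using finite_subset[OF that A] that
  proof (induction C rule: finite_induct)
    case empty
    show ?case
    proof (intro allI impI)
      fix v assume v: "(\<forall>j\<in>A. v j \<in> E j) \<and> (\<forall>j\<in>A - {}. v j \<in> B j)"
      then have "L (tensor_vec A (restrict v A)) = m (restrict v A)"
        by (intro LS) (auto simp: S_def)
      moreover have "m (restrict v A) = m v" "tensor_vec A (restrict v A) = tensor_vec A v"
        by (auto intro!: cong tv_cong)
      ultimately show "L (tensor_vec A v) = m v" by simp
    qed
  next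
    case (insert a C)
    then have a: "a \<in> A" by simp
    show ?case
    proof (intro allI impI)
      fix v assume v: "(\<forall>j\<in>A. v j \<in> E j) \<and> (\<forall>j\<in>A - insert a C. v j \<in> B j)"
      define Q where "Q z \<longleftrightarrow> z \<in> E a \<and> L (tensor_vec A (v(a := z))) = m (v(a := z))" for z
      have "Q z" if "z \<in> cfun.span (B a)" for z
      proof (rule cfun.span_induct_alt[where h = Q, OF that])
        have 0: "0 \<in> E a" using cfun.subspace_0[OF sub[OF a]] .
        have z: "(\<lambda>b. 0 * 0 b) = (0 :: 'b \<Rightarrow> complex)" by (simp add: fun_eq_iff)
        have "tensor_vec A (v(a := 0)) = 0"
          using tv_scale[OF a, of v 0 0] unfolding z by (simp add: fun_eq_iff)
        moreover have "m (v(a := 0)) = 0"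
          using scale[of v a 0 0] v a 0 unfolding z by (simp add: fun_eq_iff)
        ultimately show "Q 0" using 0 L.zero by (simp add: Q_def)
      next
        fix c x y assume "x \<in> B a" "Q y"
        then have y: "y \<in> E a" "L (tensor_vec A (v(a := y))) = m (v(a := y))"
          and x: "x \<in> E a" using B(2)[OF a] by (auto simp: Q_def)
        have cx: "(\<lambda>b. c * x b) \<in> E a" using cfun.subspace_scale[OF sub[OF a] x] .
        have "(\<forall>j\<in>A. (v(a := x)) j \<in> E j) \<and> (\<forall>j\<in>A - C. (v(a := x)) j \<in> B j)"
          using v x \<open>x \<in> B a\<close> by auto
        then have Lx: "L (tensor_vec A (v(a := x))) = m (v(a := x))"
          using insert.IH insert.prems by blast
        have "L (tensor_vec A (v(a := (\<lambda>b. c * x b) + y))) = m (v(a := (\<lambda>b. c * x b) + y))"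
          unfolding tv_add[OF a] tv_scale[OF a] L.add L.scale Lx y(2)
          using add[OF conjunct1[OF v] a cx y(1)] scale[OF conjunct1[OF v] a x, of c] by simp
        then show "Q ((\<lambda>b. c * x b) + y)"
          using cfun.subspace_add[OF sub[OF a] cx y(1)] by (simp only: Q_def)
      qed
      then have "L (tensor_vec A (v(a := v a))) = m (v(a := v a))"
        using v a B(3)[OF a] unfolding Q_def by blast
      then show "L (tensor_vec A v) = m v" by simp
    qed
  qed
  from this[of A] have "\<forall>v. (\<forall>j\<in>A. v j \<in> E j) \<longrightarrow> L (tensor_vec A v) = m v" by simp
  with lin show ?thesis by blast
qed

definition insert_vec ::
  "nat \<Rightarrow> ('b \<Rightarrow> complex) \<Rightarrow> ((nat \<Rightarrow> 'b) \<Rightarrow> complex) \<Rightarrow> ((nat \<Rightarrow> 'b) \<Rightarrow> complex)" where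
  "insert_vec j w T = (\<lambda>x. w (x j) * T x)"

lemma insert_vec_tensor_vec:
  assumes "finite A" "j \<notin> A"
  shows "insert_vec j w (tensor_vec A v) = tensor_vec (insert j A) (v(j := w))"
proof -
  have "(\<Prod>i\<in>A. (v(j := w)) i (x i)) = (\<Prod>i\<in>A. v i (x i))" for x
    by (rule prod.cong) (use assms in auto)
  then show ?thesis
    using assms by (simp add: insert_vec_def tensor_vec_def fun_eq_iff)
qed

definition tensor_bundle ::
  "nat set \<Rightarrow> (nat \<Rightarrow> ('a, 'b, 'k) vbundle) \<Rightarrow> ('a, nat \<Rightarrow> 'b, nat \<Rightarrow> 'k) vbundle" where
  "tensor_bundle A H =
     \<lparr> base = (\<Inter>j\<in>A. base (H j)),
       fibre = (\<lambda>p. tensor_space A (\<lambda>j. fibre (H j) p)),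
       frames = {(\<Inter>j\<in>A. V j, Pi\<^sub>E A I, \<lambda>f p. tensor_vec A (\<lambda>j. e j (f j) p)) |V I e.
                   \<forall>j\<in>A. (V j, I j, e j) \<in> frames (H j)} \<rparr>"


section \<open>Bundle settlements\<close>

text \<open>An arrow \<open>(B, B', h)\<close> is a map from the bundle on the block \<open>B\<close> to that on \<open>B'\<close>. Over a facet
  \<open>Z\<close>, \<open>h\<close> is kept \<open>undefined\<close> off \<open>Z\<close>, so that restrictions can be compared.\<close>

type_synonym ('a, 'b) arrow =
  "'a set \<times> 'a set \<times> ('a \<Rightarrow> ('b \<Rightarrow> complex) \<Rightarrow> ('b \<Rightarrow> complex))"

definition clutching_map ::
  "('a, 'n::finite) mcorner \<Rightarrow> 'a set set \<Rightarrow> ('a set \<Rightarrow> ('a, 'b, 'k) vbundle) \<Rightarrow> 'a set \<Rightarrow>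
   ('a, 'b) arrow \<Rightarrow> bool" where
  "clutching_map M P F Z = (\<lambda>(B, B', h).
     B \<in> blocks_around P Z \<and> B' \<in> blocks_around P Z \<and> B \<noteq> B' \<and> h \<in> extensional Z \<and>
     (bundle_rank (F B) B < bundle_rank (F B') B' \<or>
      bundle_rank (F B) B = bundle_rank (F B') B' \<and>
        (\<forall>p\<in>Z. bij_betw (h p) (fibre (F B) p) (fibre (F B') p))) \<and>
     (\<exists>W h'. Z \<subseteq> W \<and> bundle_embedding M (F B) (F B') W h' \<and>
        (\<forall>p\<in>Z. \<forall>x\<in>fibre (F B) p. h' p x = h p x)))"

definition saturated :: "'a set set \<Rightarrow> ('a, 'b) arrow set \<Rightarrow> bool" where
  "saturated V Q \<longleftrightarrow> (\<exists>v\<in>V. \<forall>u\<in>V. (u, v) \<in> {(x, y). \<exists>h. (x, y, h) \<in> Q}\<^sup>*)"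

fun directed_path :: "('a, 'b) arrow set \<Rightarrow> 'a set \<Rightarrow> ('a, 'b) arrow list \<Rightarrow> 'a set \<Rightarrow> bool" where
  "directed_path Q u [] v \<longleftrightarrow> u = v"
| "directed_path Q u ((x, y, h) # as) v \<longleftrightarrow> x = u \<and> (x, y, h) \<in> Q \<and> directed_path Q y as v"

text \<open>Nonempty, and no vertex is visited twice, except that the path may close up to a loop.\<close>

definition simple_path :: "('a, 'b) arrow set \<Rightarrow> 'a set \<Rightarrow> ('a, 'b) arrow list \<Rightarrow> 'a set \<Rightarrow> bool" where
  "simple_path Q u as v \<longleftrightarrow>
     as \<noteq> [] \<and> directed_path Q u as v \<and> distinct (map fst as) \<and> distinct (map (fst \<circ> snd) as)"

fun path_map :: "('a, 'b) arrow list \<Rightarrow> 'a \<Rightarrow> ('b \<Rightarrow> complex) \<Rightarrow> ('b \<Rightarrow> complex)" where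
  "path_map [] p x = x"
| "path_map ((_, _, h) # as) p x = path_map as p (h p x)"

text \<open>\<open>G k Z\<close> is the quiver with its clutching maps over the codimension-\<open>k\<close> facet \<open>Z\<close>.\<close>

definition preliminary_quiver ::
  "('a, 'n::finite) mcorner \<Rightarrow> 'a set set \<Rightarrow> ('a set \<Rightarrow> ('a, 'b) arrow set) \<Rightarrow> nat \<Rightarrow> 'a set \<Rightarrow>
   ('a, 'b) arrow set" where
  "preliminary_quiver M P G' k Z =
     {(B, B', restrict h Z) |B B' h. \<exists>Z' \<in> facets M P (k - 1). Z \<subseteq> Z' \<and> (B, B', h) \<in> G' Z'}"

definition settlement ::
  "('a, 'n::finite) mcorner \<Rightarrow> 'a set set \<Rightarrow> ('a set \<Rightarrow> ('a, 'b, 'k) vbundle) \<Rightarrow>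
   (nat \<Rightarrow> 'a set \<Rightarrow> ('a, 'b) arrow set) \<Rightarrow> bool" where
  "settlement M P F G \<longleftrightarrow>
     regular_partition M P \<and>
     (\<forall>B\<in>P. vector_bundle M (F B) \<and> B \<subseteq> base (F B)) \<and>
     (\<forall>Z \<in> facets M P 1. \<exists>a. G 1 Z = {a} \<and> clutching_map M P F Z a) \<and>
     (\<forall>k\<ge>2. \<forall>Z \<in> facets M P k.
        let Q' = preliminary_quiver M P (G (k - 1)) k Z;
            Q = G k Z
        in (if saturated (blocks_around P Z) Q' then Q = Q'
            else Q' \<subseteq> Q \<and> (\<forall>a \<in> Q - Q'. clutching_map M P F Z a) \<and> saturated (blocks_around P Z) Q) \<and>
           (\<forall>as u v. simple_path Q u as v \<and> set as \<inter> (Q - Q') \<noteq> {} \<longrightarrow>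
              (if u = v then \<forall>p\<in>Z. \<forall>x \<in> fibre (F u) p. path_map as p x = x
               else \<forall>as'. simple_path Q u as' v \<and> as' \<noteq> as \<longrightarrow>
                      (\<forall>p\<in>Z. \<forall>x \<in> fibre (F u) p. path_map as p x = path_map as' p x))))"

text \<open>The gluing data determined by clutching maps \<open>C Z\<close> over the faces \<open>Z\<close> when no further
  clutching maps are added over the facets of higher codimension.\<close>

primrec restricted_gluing ::
  "('a, 'n::finite) mcorner \<Rightarrow> 'a set set \<Rightarrow> ('a set \<Rightarrow> ('a, 'b) arrow set) \<Rightarrow> nat \<Rightarrow> 'a set \<Rightarrow>
   ('a, 'b) arrow set" where
  "restricted_gluing M P C 0 = (\<lambda>Z. {})"
| "restricted_gluing M P C (Suc k) =
     (if k = 0 then C else preliminary_quiver M P (restricted_gluing M P C k) (Suc k))"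


section \<open>The local tensorial system\<close>

definition tensorial_block ::
  "('a, 'n::finite) mcorner \<Rightarrow> nat set \<Rightarrow> (nat \<Rightarrow> 'a set) \<Rightarrow> (nat \<Rightarrow> ('a, 'b, 'k) vbundle) \<Rightarrow> 'a set \<Rightarrow>
   ('a, nat \<Rightarrow> 'b, nat \<Rightarrow> 'k) vbundle" where
  "tensorial_block M J U H B = tensor_bundle (block_index M J U B) H"

definition face_label ::
  "('a, 'n::finite) mcorner \<Rightarrow> (nat \<Rightarrow> 'a set) \<Rightarrow> nat \<Rightarrow> 'a set \<Rightarrow> 'a set \<Rightarrow> bool" where
  "face_label M U j B B' \<longleftrightarrow> mf_interior M B' \<subseteq> U j \<and> B \<subseteq> topspace (mtop M) - U j"

definition tensorial_clutching ::
  "('a, 'n::finite) mcorner \<Rightarrow> nat set \<Rightarrow> (nat \<Rightarrow> 'a set) \<Rightarrow> (nat \<Rightarrow> 'a \<Rightarrow> 'b \<Rightarrow> complex) \<Rightarrow> 'a set \<Rightarrow>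
   ('a, nat \<Rightarrow> 'b) arrow set" where
  "tensorial_clutching M J U s Z =
     {(B, B', restrict (\<lambda>p. insert_vec j (s j p)) Z) |B B' j.
        B \<in> covering_partition M J U \<and> B' \<in> covering_partition M J U \<and> B \<noteq> B' \<and> Z \<subseteq> B \<inter> B' \<and>
        j \<in> J \<and> Z \<subseteq> wall M U j \<and> face_label M U j B B'}"

end

(* At a point p the transversality of the walls, together with the fact that the derivative of a
   coordinate change respects the cones of the corner charts, leaves at most one wall sheet for each
   j, and the defining functions of the walls through p and of the boundary faces at p are
   independent. By the inverse function theorem they can be taken as coordinates of a chart of M
   around p, in which the closure of each U j with p on its wall is a half space: where these
   coordinates are nonzero the closure is open and closed, and it has a boundary point and interior
   points near p. In such a chart the 2^k sign patterns of the k wall coordinates are exactly the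
   pieces of the partition at p, which gives regularity, and crossing a wall changes the index set
   of the block by exactly one element.

   Inserting a nonvanishing section into a tensor product is fibrewise injective and smooth, and an
   isomorphism if the ranks agree. Around a codimension k facet the arrows form the edges of a cube
   directed towards the block with the largest index set, so the preliminary quiver is saturated
   already, no arrows are added, and the consistency conditions are vacuous. *)
theory Submission
  imports Defs
begin

section \<open>Calculus of smooth maps\<close>

text \<open>The hypotheses are intrinsic to each closed set \<open>S j\<close>: its corner charts
  are smooth on \<open>S j\<close> only, and \<open>transverse_at\<close> uses one unspecified chart
  of \<open>M\<close>, while regularity asks for a model inside every given boundary chart.
  Derivatives within such sets are compared along one-sided rays into the cone of a corner; these
  directions contain a basis, which is enough. The bound on wall sheets is a count. The cone of
  \<open>S j\<close> at a point lies in the ambient cone, and each of its facets is a wall sheet or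
  lies in an ambient facet. By independence the codimension in \<open>S j\<close> is that in
  \<open>M\<close> plus the number of wall sheets, and the condition on corner points allows an
  excess of at most one. Strata are defined through the existence of some model, so k is made
  intrinsic by counting the blocks through a point. Walls and index set are constant on a connected
  component of a stratum, hence questions about facets are settled at one point of it. An arrow over
  a deep facet must be restricted from a larger facet inside both blocks; leaving a wall with both
  blocks on the same side produces one.\<close>

lemma cont_diff_subset: "cont_diff k S f \<Longrightarrow> T \<subseteq> S \<Longrightarrow> cont_diff k T f"
  by (induction k arbitrary: f) (auto intro: continuous_on_subset)

text \<open>On an open set equality of functions passes to their derivatives, so the induction
  replaces both functions at once; openness is what makes the pointwise
  \<open>frechet_derivative\<close> agree.\<close>

lemma cont_diff_cong:
  assumes "open S" "\<And>x. x \<in> S \<Longrightarrow> f x = g x" "cont_diff k S g"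
  shows "cont_diff k S f"
  using assms(2,3)
proof (induction k arbitrary: f g)
  case 0
  then show ?case using continuous_on_cong by (metis cont_diff.simps(1))
next
  case (Suc k)
  have der: "(f has_derivative frechet_derivative g (at x)) (at x)" if "x \<in> S" for x
  proof (rule has_derivative_transform_within_open[OF _ assms(1) that])
    show "(g has_derivative frechet_derivative g (at x)) (at x)"
      using Suc.prems(2) that frechet_derivative_works by auto
  qed (use Suc.prems(1) in auto)
  then have eq: "frechet_derivative f (at x) v = frechet_derivative g (at x) v" if "x \<in> S" for x v
    using frechet_derivative_at that by metis
  show ?case
  proof (simp, intro conjI allI ballI)
    show "f differentiable at x" if "x \<in> S" for x using der that differentiable_def by blast
    show "cont_diff k S (\<lambda>x. frechet_derivative f (at x) v)" for v
      by (rule Suc.IH[where g = "\<lambda>x. frechet_derivative g (at x) v"]) (use eq Suc.prems(2) in auto)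
  qed
qed

text \<open>\<open>cont_diff\<close> is phrased with the choice \<open>frechet_derivative\<close>;
  this rule admits any explicit formula for the derivative, and most closure properties below are
  proved through it.\<close>

lemma cont_diff_SucI:
  assumes "open S" "\<And>x. x \<in> S \<Longrightarrow> (f has_derivative f' x) (at x)"
    and "\<And>v. cont_diff k S (\<lambda>x. f' x v)"
  shows "cont_diff (Suc k) S f"
proof (simp, intro conjI allI ballI)
  show "f differentiable at x" if "x \<in> S" for x using assms(2) that differentiable_def by blast
  show "cont_diff k S (\<lambda>x. frechet_derivative f (at x) v)" for v
    by (rule cont_diff_cong[OF assms(1) _ assms(3)[of v]]) (use assms(2) frechet_derivative_at in metis)
qed

lemma cont_diff_SucD:
  assumes "cont_diff (Suc k) S f" "x \<in> S"
  shows "(f has_derivative frechet_derivative f (at x)) (at x)"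
  using assms frechet_derivative_works by auto

lemma cont_diff_Suc_imp: "cont_diff (Suc k) S f \<Longrightarrow> cont_diff k S f"
proof (induction k arbitrary: f)
  case 0
  then show ?case
    by (auto intro!: continuous_at_imp_continuous_on differentiable_imp_continuous_within)
next
  case (Suc k)
  then show ?case by (metis cont_diff.simps(2))
qed

lemma cont_diff_imp_continuous_on: "cont_diff k S f \<Longrightarrow> continuous_on S f"
proof (induction k)
  case (Suc k)
  then show ?case using cont_diff_Suc_imp by blast
qed simp

lemma cont_diff_const: "cont_diff k S (\<lambda>x. c)"
proof (induction k arbitrary: c)
  case (Suc k)
  have "frechet_derivative (\<lambda>x. c) (at x) = (\<lambda>v. 0)" for x :: 'a
    by (metis frechet_derivative_at has_derivative_const)
  then show ?case using Suc by simp
qed simp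

lemma cont_diff_bounded_linear: "bounded_linear f \<Longrightarrow> cont_diff k S f"
proof (cases k)
  case 0
  assume "bounded_linear f"
  then show ?thesis using 0 by (simp add: linear_continuous_on)
next
  case (Suc m)
  assume f: "bounded_linear f"
  have "frechet_derivative f (at x) = f" for x
    by (metis f frechet_derivative_at bounded_linear_imp_has_derivative)
  then show ?thesis
    using Suc f by (auto simp: cont_diff_const intro: bounded_linear_imp_differentiable)
qed

lemma cont_diff_add:
  assumes "open S"
  shows "cont_diff k S f \<Longrightarrow> cont_diff k S g \<Longrightarrow> cont_diff k S (\<lambda>x. f x + g x)"
proof (induction k arbitrary: f g)
  case 0
  then show ?case by (simp add: continuous_on_add)
next
  case (Suc k)
  show ?case
  proof (rule cont_diff_SucI[OF assms has_derivative_add])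
    show "(f has_derivative frechet_derivative f (at x)) (at x)" if "x \<in> S" for x
      using cont_diff_SucD Suc.prems(1) that by blast
    show "(g has_derivative frechet_derivative g (at x)) (at x)" if "x \<in> S" for x
      using cont_diff_SucD Suc.prems(2) that by blast
  qed (use Suc in simp)
qed

lemma (in bounded_bilinear) cont_diff_prod:
  assumes "open S"
  shows "cont_diff k S f \<Longrightarrow> cont_diff k S g \<Longrightarrow> cont_diff k S (\<lambda>x. prod (f x) (g x))"
proof (induction k arbitrary: f g)
  case 0
  then show ?case by (simp add: continuous_on)
next
  case (Suc k)
  show ?case
  proof (rule cont_diff_SucI[OF assms FDERIV])
    show "(f has_derivative frechet_derivative f (at x)) (at x)" if "x \<in> S" for x
      using cont_diff_SucD Suc.prems(1) that by blast
    show "(g has_derivative frechet_derivative g (at x)) (at x)" if "x \<in> S" for x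
      using cont_diff_SucD Suc.prems(2) that by blast
    show "cont_diff k S (\<lambda>x. prod (f x) (frechet_derivative g (at x) v) + prod (frechet_derivative f (at x) v) (g x))" for v
    proof (rule cont_diff_add[OF assms Suc.IH Suc.IH])
      show "cont_diff k S f" "cont_diff k S g" using Suc.prems cont_diff_Suc_imp by blast+
    qed (use Suc.prems in auto)
  qed
qed

lemmas cont_diff_scaleR = bounded_bilinear.cont_diff_prod[OF bounded_bilinear_scaleR]
lemmas cont_diff_mult = bounded_bilinear.cont_diff_prod[OF bounded_bilinear_mult]

lemma cont_diff_sum:
  assumes "open S" "\<And>i. i \<in> I \<Longrightarrow> cont_diff k S (f i)"
  shows "cont_diff k S (\<lambda>x. \<Sum>i\<in>I. f i x)"
  using assms(2)
  by (induction I rule: infinite_finite_induct) (auto intro: cont_diff_const cont_diff_add[OF assms(1)])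

lemma cont_diff_prod:
  fixes f :: "'i \<Rightarrow> 'x::real_normed_vector \<Rightarrow> 'y::{real_normed_algebra_1, comm_ring_1}"
  assumes "open S" "\<And>i. i \<in> I \<Longrightarrow> cont_diff k S (f i)"
  shows "cont_diff k S (\<lambda>x. \<Prod>i\<in>I. f i x)"
  using assms(2)
  by (induction I rule: infinite_finite_induct) (auto intro: cont_diff_const cont_diff_mult[OF assms(1)])

lemma cont_diff_bounded_linear_compose:
  assumes "open S" "bounded_linear L"
  shows "cont_diff k S f \<Longrightarrow> cont_diff k S (\<lambda>x. L (f x))"
proof (induction k arbitrary: f)
  case 0
  then show ?case by (simp add: bounded_linear.continuous_on[OF assms(2)])
next
  case (Suc k)
  show ?case
  proof (rule cont_diff_SucI[OF assms(1) bounded_linear.has_derivative[OF assms(2)]])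
    show "(f has_derivative frechet_derivative f (at x)) (at x)" if "x \<in> S" for x
      using cont_diff_SucD Suc.prems that by blast
  qed (use Suc in auto)
qed

text \<open>The derivative of \<open>f\<close> at a moving point, applied to a moving vector, is
  expanded over \<open>Basis\<close>. This turns the chain rule into a finite sum of scalar
  functions times directional derivatives of \<open>f\<close> along fixed vectors, composed with
  \<open>g\<close>, to which the induction hypothesis applies; hence the Euclidean middle
  space.\<close>

lemma cont_diff_compose:
  fixes g :: "'x::real_normed_vector \<Rightarrow> 'z::euclidean_space" and f :: "'z \<Rightarrow> 'y::real_normed_vector"
  assumes "open S" "g ` S \<subseteq> T"
  shows "cont_diff k T f \<Longrightarrow> cont_diff k S g \<Longrightarrow> cont_diff k S (\<lambda>x. f (g x))"
proof (induction k arbitrary: f)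
  case 0
  then show ?case using continuous_on_compose2[of T f S g] assms(2) by simp
next
  case (Suc k)
  have gk: "cont_diff k S g" using Suc.prems(2) cont_diff_Suc_imp by blast
  show ?case
  proof (rule cont_diff_SucI[OF assms(1)])
    fix x assume x: "x \<in> S"
    let ?f' = "frechet_derivative f (at (g x))" and ?g' = "frechet_derivative g (at x)"
    have f': "(f has_derivative ?f') (at (g x))"
      using cont_diff_SucD[OF Suc.prems(1)] x assms(2) by blast
    then have lin: "linear ?f'" using has_derivative_linear by blast
    have "((\<lambda>x. f (g x)) has_derivative (\<lambda>v. ?f' (?g' v))) (at x)"
      using has_derivative_compose[OF cont_diff_SucD[OF Suc.prems(2) x] f'] .
    moreover have "?f' (?g' v) = (\<Sum>b\<in>Basis. (?g' v \<bullet> b) *\<^sub>R ?f' b)" for v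
    proof -
      have "?f' (?g' v) = ?f' (\<Sum>b\<in>Basis. (?g' v \<bullet> b) *\<^sub>R b)" by (simp add: euclidean_representation)
      then show ?thesis by (simp add: linear_sum[OF lin] linear_cmul[OF lin])
    qed
    ultimately show "((\<lambda>x. f (g x)) has_derivative (\<lambda>v. \<Sum>b\<in>Basis. (?g' v \<bullet> b) *\<^sub>R ?f' b)) (at x)"
      by simp
  next
    show "cont_diff k S (\<lambda>x. \<Sum>b\<in>Basis. (frechet_derivative g (at x) v \<bullet> b) *\<^sub>R frechet_derivative f (at (g x)) b)" for v
      by (intro cont_diff_sum cont_diff_scaleR Suc.IH gk assms(1)
          cont_diff_bounded_linear_compose[OF assms(1) bounded_linear_inner_left])
        (use Suc.prems in auto)
  qed
qed

text \<open>The derivative of \<open>inverse (f x)\<close> contains \<open>inverse (f x)\<close>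
  again, so class k bootstraps to class k + 1.\<close>

lemma cont_diff_inverse:
  fixes f :: "'x::real_normed_vector \<Rightarrow> real"
  assumes "open S" "\<And>x. x \<in> S \<Longrightarrow> f x \<noteq> 0"
  shows "cont_diff k S f \<Longrightarrow> cont_diff k S (\<lambda>x. inverse (f x))"
proof (induction k)
  case 0
  then show ?case using assms(2) by (auto intro: continuous_on_inverse)
next
  case (Suc k)
  have fk: "cont_diff k S (\<lambda>x. inverse (f x))" using Suc cont_diff_Suc_imp by blast
  show ?case
  proof (rule cont_diff_SucI[OF assms(1)])
    show "((\<lambda>x. inverse (f x)) has_derivative
        (\<lambda>v. - 1 * (inverse (f x) * frechet_derivative f (at x) v * inverse (f x)))) (at x)" if "x \<in> S" for x
      using Deriv.has_derivative_inverse[OF assms(2)[OF that] cont_diff_SucD[OF Suc.prems that]] by simp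
    show "cont_diff k S (\<lambda>x. - 1 * (inverse (f x) * frechet_derivative f (at x) v * inverse (f x)))" for v
      by (intro cont_diff_mult assms(1) cont_diff_const fk) (use Suc.prems in auto)
  qed
qed

lemma cont_diff_vec:
  assumes "open S" "\<And>i. cont_diff k S (\<lambda>x. f x $ i)"
  shows "cont_diff k S (f :: 'x::real_normed_vector \<Rightarrow> real ^ 'n::finite)"
proof -
  have "f x = (\<Sum>i\<in>UNIV. f x $ i *\<^sub>R axis i 1)" for x
    by (simp add: vec_eq_iff axis_def if_distrib cong: if_cong)
  moreover have "cont_diff k S (\<lambda>x. \<Sum>i\<in>UNIV. f x $ i *\<^sub>R (axis i 1 :: real ^ 'n))"
    by (intro cont_diff_sum cont_diff_scaleR assms cont_diff_const)
  ultimately show ?thesis by presburger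
qed

lemma cont_diff_det:
  fixes A :: "'x::real_normed_vector \<Rightarrow> real ^ 'n ^ 'n::finite"
  assumes "open S" "\<And>i j. cont_diff k S (\<lambda>x. A x $ i $ j)"
  shows "cont_diff k S (\<lambda>x. det (A x))"
  unfolding det_def by (intro cont_diff_sum cont_diff_mult cont_diff_prod assms cont_diff_const)

text \<open>By Cramer's rule the inverse of an invertible linear map depends smoothly on its matrix.\<close>

lemma cont_diff_inverse_map:
  fixes f g :: "real ^ 'n::finite \<Rightarrow> real ^ 'n"
  assumes "open V" "open U" "g ` V \<subseteq> U" and f: "\<And>k. cont_diff k U f"
    and der: "\<And>y. y \<in> V \<Longrightarrow> (g has_derivative inv (frechet_derivative f (at (g y)))) (at y)"
    and bij: "\<And>y. y \<in> V \<Longrightarrow> bij (frechet_derivative f (at (g y)))"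
  shows "cont_diff k V g"
proof (induction k)
  case 0
  then show ?case using der by (auto intro!: continuous_at_imp_continuous_on has_derivative_continuous)
next
  case (Suc k)
  define A where "A x = matrix (frechet_derivative f (at x))" for x
  \<comment> \<open>The matrix of Cramer's rule: column \<open>m\<close> of the Jacobian is replaced
    by \<open>v\<close>.\<close>
  define B where "B v m y = (\<chi> i j. if j = m then v $ i else A (g y) $ i $ j)"
    for v :: "real ^ 'n" and m :: 'n and y
  have lin: "linear (frechet_derivative f (at x))" if "x \<in> U" for x
    using cont_diff_SucD[OF f that] has_derivative_linear by blast
  have Ag: "frechet_derivative f (at (g y)) = (*v) (A (g y))" if "y \<in> V" for y
  proof -
    have "g y \<in> U" using that assms(3) by blast
    then show ?thesis unfolding A_def using lin by (simp add: fun_eq_iff matrix_works)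
  qed
  have det: "det (A (g y)) \<noteq> 0" if "y \<in> V" for y
  proof -
    have "inj ((*v) (A (g y)))" using bij[OF that] Ag[OF that] by (simp add: bij_def)
    then show ?thesis
      by (metis invertible_det_nz invertible_left_inverse matrix_left_invertible_injective)
  qed
  have eq: "inv (frechet_derivative f (at (g y))) v = (\<chi> m. det (B v m y) * inverse (det (A (g y))))"
    if "y \<in> V" for y v
  proof -
    have "A (g y) *v inv (frechet_derivative f (at (g y))) v = v"
      using bij[OF that] Ag[OF that] by (metis bij_inv_eq_iff)
    then show ?thesis
      unfolding cramer[OF det[OF that]] B_def by (simp add: divide_inverse)
  qed
  \<comment> \<open>The class of \<open>g\<close> already reached is used here: the Jacobian along
    \<open>g\<close> is as smooth as \<open>g\<close>, and its inverse is the derivative of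
    \<open>g\<close>.\<close>
  have Acd: "cont_diff k V (\<lambda>y. A (g y) $ i $ j)" for i j
  proof (rule cont_diff_compose[OF assms(1,3) _ Suc.IH, of "\<lambda>x. A x $ i $ j"])
    have "cont_diff k U (\<lambda>x. frechet_derivative f (at x) (axis j 1) $ i)"
      by (rule cont_diff_bounded_linear_compose[OF assms(2) bounded_linear_vec_nth])
        (use f[of "Suc k"] in simp)
    then show "cont_diff k U (\<lambda>x. A x $ i $ j)" by (simp add: A_def matrix_def)
  qed
  show ?case
  proof (rule cont_diff_SucI[OF assms(1) der])
    fix v
    have "cont_diff k V (\<lambda>y. \<chi> m. det (B v m y) * inverse (det (A (g y))))"
    proof (intro cont_diff_vec assms(1))
      fix m
      have "cont_diff k V (\<lambda>y. det (B v m y) * inverse (det (A (g y))))"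
      proof (intro cont_diff_mult cont_diff_inverse cont_diff_det assms(1) Acd)
        show "cont_diff k V (\<lambda>y. B v m y $ i $ j)" for i j
          by (cases "j = m") (auto simp: B_def Acd cont_diff_const)
      qed (use det in auto)
      then show "cont_diff k V (\<lambda>y. (\<chi> m. det (B v m y) * inverse (det (A (g y)))) $ m)" by simp
    qed
    then show "cont_diff k V (\<lambda>y. inv (frechet_derivative f (at (g y))) v)"
      by (rule cont_diff_cong[OF assms(1), rotated]) (use eq in auto)
  qed
qed

lemma smooth_on_subset: "smooth_on S f \<Longrightarrow> T \<subseteq> S \<Longrightarrow> smooth_on T f"
  unfolding smooth_on_def using cont_diff_subset by blast

lemma smooth_on_has_derivative:
  "smooth_on S f \<Longrightarrow> x \<in> S \<Longrightarrow> (f has_derivative frechet_derivative f (at x)) (at x)"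
  unfolding smooth_on_def using cont_diff_SucD by blast

lemma smooth_on_continuous_on: "smooth_on S f \<Longrightarrow> continuous_on S f"
  unfolding smooth_on_def using cont_diff_imp_continuous_on by blast

lemma smooth_on_bounded_linear: "bounded_linear f \<Longrightarrow> smooth_on S f"
  unfolding smooth_on_def using cont_diff_bounded_linear by blast

lemma smooth_on_vec:
  "open S \<Longrightarrow> (\<And>i. smooth_on S (\<lambda>x. f x $ i)) \<Longrightarrow> smooth_on S (f :: _ \<Rightarrow> real ^ 'n::finite)"
  unfolding smooth_on_def using cont_diff_vec by blast

lemma smooth_on_vec_nth:
  "open S \<Longrightarrow> smooth_on S f \<Longrightarrow> smooth_on S (\<lambda>x. f x $ i :: real)"
  unfolding smooth_on_def using cont_diff_bounded_linear_compose[OF _ bounded_linear_vec_nth] by blast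

definition smooth_diffeo ::
  "(real ^ 'n::finite) set \<Rightarrow> (real ^ 'n) set \<Rightarrow> (real ^ 'n \<Rightarrow> real ^ 'n) \<Rightarrow> (real ^ 'n \<Rightarrow> real ^ 'n) \<Rightarrow> bool" where
  "smooth_diffeo X Y f g \<longleftrightarrow> open X \<and> open Y \<and> smooth_on X f \<and> smooth_on Y g \<and> homeomorphism X Y f g"

text \<open>The classical theorem gives an inverse with a pointwise derivative;
  \<open>cont_diff_inverse_map\<close> upgrades it to a smooth one.\<close>

lemma smooth_inverse_function_theorem:
  fixes f :: "real ^ 'n::finite \<Rightarrow> real ^ 'n"
  assumes f: "open U" "smooth_on U f" "x0 \<in> U" and inj: "inj (frechet_derivative f (at x0))"
  obtains X Y g where "X \<subseteq> U" "x0 \<in> X" "smooth_diffeo X Y f g"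
proof -
  have der: "(f has_derivative frechet_derivative f (at x)) (at x)" if "x \<in> U" for x
    using smooth_on_has_derivative f that by blast
  then have bl: "bounded_linear (frechet_derivative f (at x))" if "x \<in> U" for x
    using that has_derivative_bounded_linear by blast
  \<comment> \<open>\<open>inverse_function_theorem\<close> wants the derivative as a continuous map
    into bounded linear functions; in finite dimension continuity can be tested on fixed
    vectors.\<close>
  define f' where "f' x = Blinfun (frechet_derivative f (at x))" for x
  have f': "blinfun_apply (f' x) = frechet_derivative f (at x)" if "x \<in> U" for x
    using bl[OF that] by (simp add: f'_def bounded_linear_Blinfun_apply)
  have cont: "continuous_on U f'"
  proof (rule continuous_on_blinfun_componentwise)
    fix i :: "real ^ 'n"
    have "continuous_on U (\<lambda>x. frechet_derivative f (at x) i)"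
      using f(2) unfolding smooth_on_def by (metis cont_diff.simps)
    then show "continuous_on U (\<lambda>x. blinfun_apply (f' x) i)"
      by (rule continuous_on_eq) (simp add: f')
  qed
  obtain h where h: "linear h" "h \<circ> frechet_derivative f (at x0) = id"
    using linear_injective_left_inverse[OF bounded_linear.linear[OF bl[OF f(3)]] inj] by blast
  have "Blinfun h o\<^sub>L f' x0 = id_blinfun"
    using h f(3) by (intro blinfun_eqI)
      (simp add: f' bounded_linear_Blinfun_apply linear_conv_bounded_linear fun_eq_iff)
  from inverse_function_theorem[OF f(1) _ cont f(3) this]
  obtain X Y g g' where *: "open X" "X \<subseteq> U" "x0 \<in> X" "open Y" "homeomorphism X Y f g"
    "\<And>y. y \<in> Y \<Longrightarrow> (g has_derivative (g' y)) (at y)"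
    "\<And>y. y \<in> Y \<Longrightarrow> g' y = inv (blinfun_apply (f' (g y)))"
    "\<And>y. y \<in> Y \<Longrightarrow> bij (blinfun_apply (f' (g y)))"
    using der f' by metis
  have gU: "g y \<in> U" "g y \<in> X" if "y \<in> Y" for y
    using *(2,5) that unfolding homeomorphism_def by blast+
  have "smooth_on Y g"
    unfolding smooth_on_def
  proof
    fix k show "cont_diff k Y g"
    proof (rule cont_diff_inverse_map[OF *(4) f(1)])
      show "(g has_derivative inv (frechet_derivative f (at (g y)))) (at y)" if "y \<in> Y" for y
        using *(6,7)[OF that] f'[OF gU(1)[OF that]] by simp
      show "bij (frechet_derivative f (at (g y)))" if "y \<in> Y" for y
        using *(8)[OF that] f'[OF gU(1)[OF that]] by simp
    qed (use gU f(2) in \<open>auto simp: smooth_on_def\<close>)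
  qed
  then show ?thesis
    using that * f(2) smooth_on_subset unfolding smooth_diffeo_def by metis
qed


section \<open>Functions that extend smoothly near each point\<close>

lemma smooth_ext_subset: "smooth_ext S f \<Longrightarrow> T \<subseteq> S \<Longrightarrow> smooth_ext T f"
  unfolding smooth_ext_def by (meson Int_mono order_refl subset_eq)

lemma smooth_ext_cong: "(\<And>x. x \<in> S \<Longrightarrow> f x = g x) \<Longrightarrow> smooth_ext S g \<Longrightarrow> smooth_ext S f"
  unfolding smooth_ext_def by (metis IntD2)

lemma smooth_on_imp_smooth_ext: "open W \<Longrightarrow> S \<subseteq> W \<Longrightarrow> smooth_on W f \<Longrightarrow> smooth_ext S f"
  unfolding smooth_ext_def by blast

lemma smooth_ext_continuous_on:
  assumes "smooth_ext S f" shows "continuous_on S f"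
  unfolding continuous_on_eq_continuous_within
proof
  fix x assume x: "x \<in> S"
  obtain W g where W: "open W" "x \<in> W" "smooth_on W g" "\<And>y. y \<in> W \<inter> S \<Longrightarrow> g y = f y"
    using assms x unfolding smooth_ext_def by metis
  have "continuous_on W g" by (rule smooth_on_continuous_on[OF W(3)])
  then have g: "continuous (at x within S) g"
    using W(1,2) continuous_on_eq_continuous_at continuous_at_imp_continuous_at_within by blast
  obtain d where d: "d > 0" "ball x d \<subseteq> W" using W(1,2) openE by blast
  show "continuous (at x within S) f"
  proof (rule continuous_transform_within[OF g d(1) x])
    show "g x' = f x'" if "x' \<in> S" "dist x' x < d" for x'
      using W(4)[of x'] that d(2) by (auto simp: dist_commute subset_eq)
  qed
qed

lemma smooth_ext_local:
  assumes "\<And>x. x \<in> S \<Longrightarrow> \<exists>O'. open O' \<and> x \<in> O' \<and> smooth_ext (S \<inter> O') f"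
  shows "smooth_ext S f"
  unfolding smooth_ext_def
proof
  fix x assume x: "x \<in> S"
  then obtain O' where O: "open O'" "x \<in> O'" "smooth_ext (S \<inter> O') f" using assms by blast
  then obtain W g where W: "open W" "x \<in> W" "smooth_on W g" "\<forall>y\<in>W \<inter> (S \<inter> O'). g y = f y"
    using x unfolding smooth_ext_def by (metis IntI)
  show "\<exists>W g. open W \<and> x \<in> W \<and> smooth_on W g \<and> (\<forall>y\<in>W \<inter> S. g y = f y)"
    by (rule exI[of _ "W \<inter> O'"], rule exI[of _ g])
      (use O W in \<open>auto intro: smooth_on_subset\<close>)
qed

lemma smooth_ext_compose:
  fixes g :: "'x::real_normed_vector \<Rightarrow> 'z::euclidean_space" and f :: "'z \<Rightarrow> 'y::real_normed_vector"
  assumes "smooth_ext S g" "smooth_ext T f" "g ` S \<subseteq> T"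
  shows "smooth_ext S (\<lambda>x. f (g x))"
  unfolding smooth_ext_def
proof
  fix x assume x: "x \<in> S"
  obtain W g' where W: "open W" "x \<in> W" "smooth_on W g'" "\<And>y. y \<in> W \<inter> S \<Longrightarrow> g' y = g y"
    using assms(1) x unfolding smooth_ext_def by metis
  obtain W' f' where W': "open W'" "g x \<in> W'" "smooth_on W' f'" "\<And>y. y \<in> W' \<inter> T \<Longrightarrow> f' y = f y"
    using assms(2,3) x unfolding smooth_ext_def by (metis imageI subsetD)
  let ?W = "W \<inter> g' -` W'"
  have o: "open ?W"
    using W(1) W'(1) smooth_on_continuous_on[OF W(3)] by (simp add: continuous_on_open_vimage Int_commute)
  have "smooth_on ?W (\<lambda>x. f' (g' x))"
    unfolding smooth_on_def
  proof
    fix k show "cont_diff k ?W (\<lambda>x. f' (g' x))"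
      by (rule cont_diff_compose[OF o, of g' W'])
        (use W(3) W'(3) in \<open>auto simp: smooth_on_def intro: cont_diff_subset\<close>)
  qed
  moreover have "x \<in> ?W" using W(2,4) W'(2) x by simp
  moreover have "\<forall>y\<in>?W \<inter> S. f' (g' y) = f (g y)" using W(4) W'(4) assms(3) by auto
  ultimately show "\<exists>W h. open W \<and> x \<in> W \<and> smooth_on W h \<and> (\<forall>y\<in>W \<inter> S. h y = f (g y))"
    using o by (intro exI[of _ ?W] exI[of _ "\<lambda>x. f' (g' x)"]) simp
qed

lemma smooth_ext_const: "smooth_ext S (\<lambda>x. c)"
  by (rule smooth_on_imp_smooth_ext[of UNIV]) (auto simp: smooth_on_def cont_diff_const)

lemma smooth_ext_binop:
  fixes S :: "'x::real_normed_vector set" and h :: "'y::real_normed_vector \<Rightarrow> 'z::real_normed_vector \<Rightarrow> 'w::real_normed_vector"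
  assumes op: "\<And>k (W :: 'x set) f g. open W \<Longrightarrow> cont_diff k W f \<Longrightarrow> cont_diff k W g \<Longrightarrow> cont_diff k W (\<lambda>x. h (f x) (g x))"
    and "smooth_ext S f" "smooth_ext S g"
  shows "smooth_ext S (\<lambda>x. h (f x) (g x))"
  unfolding smooth_ext_def
proof
  fix x assume x: "x \<in> S"
  obtain W f' where W: "open W" "x \<in> W" "smooth_on W f'" "\<And>y. y \<in> W \<inter> S \<Longrightarrow> f' y = f y"
    using assms(2) x unfolding smooth_ext_def by metis
  obtain W' g' where W': "open W'" "x \<in> W'" "smooth_on W' g'" "\<And>y. y \<in> W' \<inter> S \<Longrightarrow> g' y = g y"
    using assms(3) x unfolding smooth_ext_def by metis
  have "smooth_on (W \<inter> W') (\<lambda>x. h (f' x) (g' x))"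
    unfolding smooth_on_def
  proof
    fix k show "cont_diff k (W \<inter> W') (\<lambda>x. h (f' x) (g' x))"
      by (rule op) (use W(1,3) W'(1,3) in \<open>auto simp: smooth_on_def intro: cont_diff_subset\<close>)
  qed
  then show "\<exists>W k. open W \<and> x \<in> W \<and> smooth_on W k \<and> (\<forall>y\<in>W \<inter> S. k y = h (f y) (g y))"
    using W W' by (intro exI[of _ "W \<inter> W'"] exI[of _ "\<lambda>x. h (f' x) (g' x)"]) auto
qed

section \<open>Smooth functions on manifolds\<close>

lemma smooth_fun_subset: "smooth_fun M S f \<Longrightarrow> T \<subseteq> S \<Longrightarrow> smooth_fun M T f"
  unfolding smooth_fun_def
proof clarify
  fix W \<psi> assume "\<forall>(W, \<psi>)\<in>charts M. smooth_ext (\<psi> ` (S \<inter> W)) (\<lambda>x. f (inv_into W \<psi> x))"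
    and T: "T \<subseteq> S" and "(W, \<psi>) \<in> charts M"
  then have "smooth_ext (\<psi> ` (S \<inter> W)) (\<lambda>x. f (inv_into W \<psi> x))" by blast
  then show "smooth_ext (\<psi> ` (T \<inter> W)) (\<lambda>x. f (inv_into W \<psi> x))"
    by (rule smooth_ext_subset) (use T in auto)
qed

lemma smooth_fun_const: "smooth_fun M S (\<lambda>p. c)"
  unfolding smooth_fun_def by (auto simp: smooth_ext_const)

lemma smooth_fun_mult:
  fixes f g :: "'a \<Rightarrow> 'y::real_normed_algebra"
  shows "smooth_fun M S f \<Longrightarrow> smooth_fun M S g \<Longrightarrow> smooth_fun M S (\<lambda>p. f p * g p)"
  unfolding smooth_fun_def by clarify (rule smooth_ext_binop[OF cont_diff_mult], blast+)

lemma smooth_fun_prod: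
  fixes f :: "'i \<Rightarrow> 'a \<Rightarrow> 'y::{real_normed_algebra_1, comm_ring_1}"
  assumes "\<And>i. i \<in> I \<Longrightarrow> smooth_fun M S (f i)"
  shows "smooth_fun M S (\<lambda>p. \<Prod>i\<in>I. f i p)"
  using assms
  by (induction I rule: infinite_finite_induct) (auto intro: smooth_fun_const smooth_fun_mult)

section \<open>Elementary facts on corner charts\<close>

lemma chart_on_openin: "chart_on M S V \<phi> K \<Longrightarrow> openin (subtopology (mtop M) S) V"
  and chart_on_homeo: "chart_on M S V \<phi> K \<Longrightarrow> homeomorphic_map (subtopology (mtop M) V) (top_of_set (\<phi> ` V)) \<phi>"
  and chart_on_smooth: "chart_on M S V \<phi> K \<Longrightarrow> smooth_fun M V \<phi>"
  and chart_on_openin_image: "chart_on M S V \<phi> K \<Longrightarrow> openin (top_of_set (orthant K)) (\<phi> ` V)"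
  and chart_on_smooth_inv: "chart_on M S V \<phi> K \<Longrightarrow> (W, \<psi>) \<in> charts M \<Longrightarrow>
    smooth_ext (\<phi> ` (V \<inter> W)) (\<lambda>x. \<psi> (inv_into V \<phi> x))"
  by (auto simp: chart_on_def)

lemma chart_on_subset: "chart_on M S V \<phi> K \<Longrightarrow> V \<subseteq> S"
  and chart_on_subset_topspace: "chart_on M S V \<phi> K \<Longrightarrow> V \<subseteq> topspace (mtop M)"
  using openin_subset[OF chart_on_openin, of M S V \<phi> K] by auto

lemma chart_on_inj: "chart_on M S V \<phi> K \<Longrightarrow> inj_on \<phi> V"
  using homeomorphic_imp_injective_map[OF chart_on_homeo, of M S V \<phi> K] chart_on_subset_topspace[of M S V \<phi> K]
  by (simp add: inf.absorb2)

lemma chart_on_image: "chart_on M S V \<phi> K \<Longrightarrow> p \<in> V \<Longrightarrow> i \<in> K \<Longrightarrow> 0 \<le> \<phi> p $ i"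
  using openin_subset[OF chart_on_openin_image] by (force simp: orthant_def)

lemma chart_on_continuous:
  "chart_on M S V \<phi> K \<Longrightarrow> continuous_map (subtopology (mtop M) V) euclidean \<phi>"
  using chart_on_homeo homeomorphic_imp_continuous_map continuous_map_in_subtopology by blast

lemma chart_on_openness:
  assumes "chart_on M S V \<phi> K" "A \<subseteq> V"
  shows "openin (top_of_set (\<phi> ` V)) (\<phi> ` A) \<longleftrightarrow> openin (subtopology (mtop M) V) A"
  by (rule homeomorphic_map_openness[OF chart_on_homeo[OF assms(1)]])
    (use assms(2) chart_on_subset_topspace[OF assms(1)] in auto)

lemma chart_on_openin_preimage:
  assumes "chart_on M S V \<phi> K" "open X"
  shows "openin (subtopology (mtop M) S) {q \<in> V. \<phi> q \<in> X}"
proof -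
  have "openin (subtopology (mtop M) V) {q \<in> topspace (subtopology (mtop M) V). \<phi> q \<in> X}"
    using openin_continuous_map_preimage[OF chart_on_continuous[OF assms(1)]] assms(2) by simp
  moreover have "topspace (subtopology (mtop M) V) = V"
    using chart_on_subset_topspace[OF assms(1)] by auto
  moreover have "subtopology (mtop M) V = subtopology (subtopology (mtop M) S) V"
    using chart_on_subset[OF assms(1)] by (simp add: subtopology_subtopology inf.absorb2)
  ultimately show ?thesis
    using openin_trans_full chart_on_openin[OF assms(1)] by metis
qed

lemma manifold_chart:
  assumes "manifold_with_corners M" "p \<in> topspace (mtop M)"
  obtains W \<eta> K where "(W, \<eta>) \<in> charts M" "p \<in> W" "chart_on M (topspace (mtop M)) W \<eta> K" "openin (mtop M) W"
proof -
  have "p \<in> \<Union>(fst ` charts M)" using assms unfolding manifold_with_corners_def by simp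
  then obtain W \<eta> where W: "(W, \<eta>) \<in> charts M" "p \<in> W" by auto
  then obtain K where "chart_on M (topspace (mtop M)) W \<eta> K"
    using assms(1) unfolding manifold_with_corners_def by blast
  then show ?thesis using that[OF W] chart_on_openin by fastforce
qed

text \<open>A chart in the sense of \<open>chart_on\<close> need not belong to the atlas, while
  \<open>smooth_fun\<close> tests only atlas charts. Near each point the coordinate expression
  factors through an atlas chart, and \<open>smooth_ext\<close> is a local property.\<close>

lemma smooth_fun_in_chart:
  assumes M: "manifold_with_corners M" and f: "smooth_fun M A f" and \<phi>: "chart_on M S V \<phi> K"
  shows "smooth_ext (\<phi> ` (A \<inter> V)) (\<lambda>x. f (inv_into V \<phi> x))"
proof (rule smooth_ext_local)
  fix x assume "x \<in> \<phi> ` (A \<inter> V)"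
  then obtain p where p: "p \<in> A" "p \<in> V" "x = \<phi> p" by blast
  have inj: "inj_on \<phi> V" by (rule chart_on_inj[OF \<phi>])
  obtain W \<eta> K' where W: "(W, \<eta>) \<in> charts M" "p \<in> W" "chart_on M (topspace (mtop M)) W \<eta> K'" "openin (mtop M) W"
    using manifold_chart[OF M] p(2) chart_on_subset_topspace[OF \<phi>] by blast
  have injW: "inj_on \<eta> W" by (rule chart_on_inj[OF W(3)])
  have "openin (subtopology (mtop M) V) (V \<inter> W)"
    using W(4) openin_subtopology_Int2 by blast
  then obtain X where X: "open X" "\<phi> ` (V \<inter> W) = \<phi> ` V \<inter> X"
    using chart_on_openness[OF \<phi>, of "V \<inter> W"] by (auto simp: openin_open)
  have "smooth_ext (\<phi> ` (A \<inter> V \<inter> W)) (\<lambda>y. (\<lambda>z. f (inv_into W \<eta> z)) (\<eta> (inv_into V \<phi> y)))"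
  proof (rule smooth_ext_compose)
    show "smooth_ext (\<phi> ` (A \<inter> V \<inter> W)) (\<lambda>y. \<eta> (inv_into V \<phi> y))"
      by (rule smooth_ext_subset[OF chart_on_smooth_inv[OF \<phi> W(1)]]) auto
    show "smooth_ext (\<eta> ` (A \<inter> W)) (\<lambda>z. f (inv_into W \<eta> z))"
      using f W(1) unfolding smooth_fun_def by blast
    show "(\<lambda>y. \<eta> (inv_into V \<phi> y)) ` \<phi> ` (A \<inter> V \<inter> W) \<subseteq> \<eta> ` (A \<inter> W)"
      using inj by auto
  qed
  moreover have "\<phi> ` (A \<inter> V) \<inter> X \<subseteq> \<phi> ` (A \<inter> V \<inter> W)"
  proof
    fix y assume y: "y \<in> \<phi> ` (A \<inter> V) \<inter> X"
    then obtain q where q: "q \<in> A" "q \<in> V" "y = \<phi> q" by blast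
    have "y \<in> \<phi> ` (V \<inter> W)" using X(2) y q by blast
    then obtain r where "r \<in> V \<inter> W" "\<phi> r = y" by blast
    then show "y \<in> \<phi> ` (A \<inter> V \<inter> W)" using q inj by (metis IntD1 IntD2 IntI image_eqI inj_onD)
  qed
  ultimately have "smooth_ext (\<phi> ` (A \<inter> V) \<inter> X) (\<lambda>y. (\<lambda>z. f (inv_into W \<eta> z)) (\<eta> (inv_into V \<phi> y)))"
    and sub: "\<phi> ` (A \<inter> V) \<inter> X \<subseteq> \<phi> ` (A \<inter> V \<inter> W)"
    using smooth_ext_subset by blast+
  then have "smooth_ext (\<phi> ` (A \<inter> V) \<inter> X) (\<lambda>y. f (inv_into V \<phi> y))"
  proof (elim smooth_ext_cong[rotated])
    fix y assume "y \<in> \<phi> ` (A \<inter> V) \<inter> X"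
    then obtain q where "q \<in> A \<inter> V \<inter> W" "y = \<phi> q" using sub by blast
    then show "f (inv_into V \<phi> y) = f (inv_into W \<eta> (\<eta> (inv_into V \<phi> y)))"
      using inj injW by auto
  qed
  then show "\<exists>X. open X \<and> x \<in> X \<and> smooth_ext (\<phi> ` (A \<inter> V) \<inter> X) (\<lambda>y. f (inv_into V \<phi> y))"
    using X p W(2) by (metis IntD2 IntI imageI)
qed

text \<open>The coordinate expressions are continuous on each atlas domain, and these open sets
  cover, so the pasting lemma applies with \<open>f\<close> itself as every piece.\<close>

lemma smooth_fun_continuous_map:
  assumes M: "manifold_with_corners M" and f: "smooth_fun M A f" and A: "A \<subseteq> topspace (mtop M)"
  shows "continuous_map (subtopology (mtop M) A) euclidean f"
proof (rule pasting_lemma[where I = "charts M" and T = "\<lambda>(W, \<eta>). A \<inter> W" and f = "\<lambda>_. f"])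
  fix c assume c: "c \<in> charts M"
  obtain W \<eta> where W: "c = (W, \<eta>)" "(W, \<eta>) \<in> charts M" using c by (cases c) auto
  obtain K where \<eta>: "chart_on M (topspace (mtop M)) W \<eta> K"
    using M W(2) unfolding manifold_with_corners_def by blast
  then have o: "openin (mtop M) W" using chart_on_openin by fastforce
  then show "openin (subtopology (mtop M) A) ((\<lambda>(W, \<eta>). A \<inter> W) c)"
    using W openin_subtopology_Int2 by auto
  have "continuous_on (\<eta> ` (A \<inter> W)) (\<lambda>x. f (inv_into W \<eta> x))"
    using f W(2) smooth_ext_continuous_on unfolding smooth_fun_def by blast
  moreover have "continuous_map (subtopology (mtop M) (A \<inter> W)) (top_of_set (\<eta> ` (A \<inter> W))) \<eta>"
    using continuous_map_from_subtopology[OF chart_on_continuous[OF \<eta>], of A]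
    by (auto simp: continuous_map_in_subtopology subtopology_subtopology Int_commute)
  ultimately have "continuous_map (subtopology (mtop M) (A \<inter> W)) euclidean ((\<lambda>x. f (inv_into W \<eta> x)) \<circ> \<eta>)"
    by (elim continuous_map_compose) simp
  then have "continuous_map (subtopology (mtop M) (A \<inter> W)) euclidean f"
    by (rule continuous_map_eq) (use chart_on_inj[OF \<eta>] in auto)
  then show "continuous_map (subtopology (subtopology (mtop M) A) ((\<lambda>(W, \<eta>). A \<inter> W) c)) euclidean f"
    using W by (simp add: subtopology_subtopology inf.absorb2)
next
  show "\<exists>j. j \<in> charts M \<and> x \<in> (\<lambda>(W, \<eta>). A \<inter> W) j \<and> f x = f x" if "x \<in> topspace (subtopology (mtop M) A)" for x
  proof -
    have "x \<in> topspace (mtop M)" "x \<in> A" using that by auto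
    then obtain W \<eta> where "(W, \<eta>) \<in> charts M" "x \<in> W" using manifold_chart[OF M] by metis
    then show ?thesis using \<open>x \<in> A\<close> by (intro exI[of _ "(W, \<eta>)"]) simp
  qed
qed auto

lemma homeomorphism_imp_homeomorphic_map:
  "homeomorphism X Y f g \<Longrightarrow> homeomorphic_map (top_of_set X) (top_of_set Y) f"
  unfolding homeomorphic_map_maps homeomorphic_maps_def homeomorphism_def
  by (rule exI[of _ g]) auto

text \<open>New charts below all come from here: translations, sign changes and the coordinates from
  the inverse function theorem. The set \<open>S'\<close> may differ from \<open>S\<close>, because
  the smooth structure is inherited from \<open>M\<close>; only the two openness conditions depend
  on \<open>S'\<close> and \<open>L\<close>.\<close>

lemma chart_on_transform:
  assumes M: "manifold_with_corners M" and \<phi>: "chart_on M S N \<phi> K"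
    and V: "V \<subseteq> N" "openin (subtopology (mtop M) S') V"
    and \<theta>: "smooth_diffeo X Y \<theta> \<theta>'" "\<phi> ` V \<subseteq> X"
    and L: "openin (top_of_set (orthant L)) (\<theta> ` \<phi> ` V)"
  shows "chart_on M S' V (\<theta> \<circ> \<phi>) L"
  unfolding chart_on_def
proof (intro conjI)
  have XY: "open X" "open Y" "smooth_on X \<theta>" "smooth_on Y \<theta>'" "homeomorphism X Y \<theta> \<theta>'"
    using \<theta>(1) unfolding smooth_diffeo_def by auto
  have inv: "\<theta>' (\<theta> x) = x" if "x \<in> X" for x using XY(5) that unfolding homeomorphism_def by blast
  have injN: "inj_on \<phi> N" by (rule chart_on_inj[OF \<phi>])
  have inj\<theta>: "inj_on \<theta> X" using inv by (rule inj_on_inverseI)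
  have inj: "inj_on (\<theta> \<circ> \<phi>) V"
    by (rule comp_inj_on) (use injN inj\<theta> V(1) \<theta>(2) in \<open>auto intro: inj_on_subset\<close>)
  have VT: "V \<subseteq> topspace (mtop M)" using V(1) chart_on_subset_topspace[OF \<phi>] by blast
  show "openin (subtopology (mtop M) S') V" by fact
  show "openin (top_of_set (orthant L)) ((\<theta> \<circ> \<phi>) ` V)" using L by (simp add: image_comp)
  have "homeomorphic_map (subtopology (subtopology (mtop M) N) V) (subtopology (top_of_set (\<phi> ` N)) (\<phi> ` V)) \<phi>"
    by (rule homeomorphic_map_subtopologies[OF chart_on_homeo[OF \<phi>]]) (use V(1) VT in auto)
  then have "homeomorphic_map (subtopology (mtop M) V) (top_of_set (\<phi> ` V)) \<phi>"
    using V(1) by (simp add: subtopology_subtopology inf.absorb2 image_mono)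
  moreover have "homeomorphism (\<phi> ` V) (\<theta> ` \<phi> ` V) \<theta> \<theta>'"
    by (rule homeomorphism_of_subsets[OF XY(5)])
      (use \<theta>(2) XY(5) inv in \<open>auto simp: homeomorphism_def\<close>)
  ultimately show "homeomorphic_map (subtopology (mtop M) V) (top_of_set ((\<theta> \<circ> \<phi>) ` V)) (\<theta> \<circ> \<phi>)"
    using homeomorphic_map_compose homeomorphism_imp_homeomorphic_map by (metis image_comp)
  show "smooth_fun M V (\<theta> \<circ> \<phi>)"
    unfolding smooth_fun_def
  proof clarify
    fix W \<eta> assume W: "(W, \<eta>) \<in> charts M"
    then obtain K' where \<eta>: "chart_on M (topspace (mtop M)) W \<eta> K'"
      using M unfolding manifold_with_corners_def by blast
    have "smooth_ext (\<eta> ` (V \<inter> W)) (\<lambda>x. \<theta> (\<phi> (inv_into W \<eta> x)))"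
    proof (rule smooth_ext_compose[where T = X and f = \<theta>])
      show "smooth_ext (\<eta> ` (V \<inter> W)) (\<lambda>x. \<phi> (inv_into W \<eta> x))"
        using smooth_fun_subset[OF chart_on_smooth[OF \<phi>] V(1)] W unfolding smooth_fun_def by blast
      show "smooth_ext X \<theta>" using XY smooth_on_imp_smooth_ext by blast
      show "(\<lambda>x. \<phi> (inv_into W \<eta> x)) ` \<eta> ` (V \<inter> W) \<subseteq> X"
        using chart_on_inj[OF \<eta>] \<theta>(2) by auto
    qed
    then show "smooth_ext (\<eta> ` (V \<inter> W)) (\<lambda>x. (\<theta> \<circ> \<phi>) (inv_into W \<eta> x))" by simp
  qed
  show "\<forall>(W, \<psi>)\<in>charts M. smooth_ext ((\<theta> \<circ> \<phi>) ` (V \<inter> W)) (\<lambda>x. \<psi> (inv_into V (\<theta> \<circ> \<phi>) x))"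
  proof clarify
    fix W \<eta> assume W: "(W, \<eta>) \<in> charts M"
    have "smooth_ext ((\<theta> \<circ> \<phi>) ` (V \<inter> W)) (\<lambda>x. \<eta> (inv_into N \<phi> (\<theta>' x)))"
    proof (rule smooth_ext_compose[where T = "\<phi> ` (N \<inter> W)" and f = "\<lambda>x. \<eta> (inv_into N \<phi> x)"])
      show "smooth_ext ((\<theta> \<circ> \<phi>) ` (V \<inter> W)) \<theta>'"
        by (rule smooth_on_imp_smooth_ext[OF XY(2) _ XY(4)])
          (use \<theta>(2) XY(5) in \<open>auto simp: homeomorphism_def\<close>)
      show "smooth_ext (\<phi> ` (N \<inter> W)) (\<lambda>x. \<eta> (inv_into N \<phi> x))"
        by (rule chart_on_smooth_inv[OF \<phi> W])
      show "\<theta>' ` (\<theta> \<circ> \<phi>) ` (V \<inter> W) \<subseteq> \<phi> ` (N \<inter> W)"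
        using inv \<theta>(2) V(1) by force
    qed
    then show "smooth_ext ((\<theta> \<circ> \<phi>) ` (V \<inter> W)) (\<lambda>x. \<eta> (inv_into V (\<theta> \<circ> \<phi>) x))"
    proof (rule smooth_ext_cong[rotated])
      fix x assume "x \<in> (\<theta> \<circ> \<phi>) ` (V \<inter> W)"
      then obtain q where q: "q \<in> V" "x = (\<theta> \<circ> \<phi>) q" by blast
      have "inv_into V (\<theta> \<circ> \<phi>) x = q" using inv_into_f_f[OF inj q(1)] q(2) by simp
      moreover have "inv_into N \<phi> (\<theta>' x) = q"
        using q inv \<theta>(2) V(1) injN by (metis comp_apply image_subset_iff inv_into_f_f subsetD)
      ultimately show "\<eta> (inv_into V (\<theta> \<circ> \<phi>) x) = \<eta> (inv_into N \<phi> (\<theta>' x))" by simp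
    qed
  qed
qed

section \<open>Interior points\<close>

text \<open>Invariance of domain, read through the homeomorphism \<open>h\<close>: composing
  \<open>g\<close> with the inverse of \<open>h\<close> gives an injective continuous map on an open
  subset of a Euclidean space of the same dimension.\<close>

lemma open_image_of_euclidean:
  fixes g :: "'a \<Rightarrow> real ^ 'n::finite" and h :: "'a \<Rightarrow> real ^ 'n"
  assumes h: "homeomorphic_map (subtopology X V) (top_of_set W) h" "open W" "V \<subseteq> topspace X"
    and g: "continuous_map (subtopology X A) euclidean g" "inj_on g A"
    and A: "openin (subtopology X V) A"
  shows "open (g ` A)"
proof -
  obtain k where k: "homeomorphic_maps (subtopology X V) (top_of_set W) h k"
    using h(1) homeomorphic_map_maps by blast
  have AV: "A \<subseteq> V" "A \<subseteq> topspace X" using A openin_subset by fastforce+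
  have "openin (top_of_set W) (h ` A)"
    using homeomorphic_map_openness[OF h(1), of A] A AV h(3) by (simp add: inf.absorb2)
  then have o: "open (h ` A)" using h(2) openin_open_trans by blast
  have kh: "k (h q) = q" if "q \<in> A" for q
    using k AV that unfolding homeomorphic_maps_def by auto
  have hW: "h ` A \<subseteq> W" using \<open>openin (top_of_set W) (h ` A)\<close> openin_imp_subset by blast
  have "continuous_map (top_of_set (h ` A)) (subtopology X V) k"
    using k hW unfolding homeomorphic_maps_def
    by (metis continuous_map_from_subtopology_mono)
  then have "continuous_map (top_of_set (h ` A)) X k"
    using continuous_map_in_subtopology by blast
  then have "continuous_map (top_of_set (h ` A)) (subtopology X A) k"
    using kh by (auto simp: continuous_map_in_subtopology)
  then have "continuous_map (top_of_set (h ` A)) euclidean (g \<circ> k)"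
    using g(1) continuous_map_compose by blast
  then have "continuous_on (h ` A) (g \<circ> k)" by simp
  moreover have "inj_on (g \<circ> k) (h ` A)"
    using g(2) kh by (auto simp: inj_on_def)
  ultimately have "open ((g \<circ> k) ` h ` A)" using invariance_of_domain o by blast
  moreover have "(g \<circ> k) ` h ` A = g ` A" using kh by (force simp: image_comp)
  ultimately show ?thesis by simp
qed

text \<open>\<open>mf_interior\<close> is purely topological, so one direction needs invariance of
  domain: a Euclidean neighbourhood has open image under \<open>\<phi>\<close>, which cannot stay in
  the orthant at a point with a vanishing coordinate in \<open>K\<close>. Where these coordinates
  are positive the chart itself is a Euclidean one.\<close>

lemma mf_interior_chart:
  assumes \<phi>: "chart_on M S V \<phi> K" "p \<in> V"
  shows "p \<in> mf_interior M S \<longleftrightarrow> (\<forall>i\<in>K. \<phi> p $ i \<noteq> 0)"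
proof
  assume nz: "\<forall>i\<in>K. \<phi> p $ i \<noteq> 0"
  define X where "X = {x :: real ^ 'b. \<forall>i\<in>K. 0 < x $ i}"
  have oX: "open X"
  proof -
    have "X = (\<Inter>i\<in>K. {x. 0 < x $ i})" by (auto simp: X_def)
    then show ?thesis by (auto intro!: open_INT open_Collect_less continuous_intros)
  qed
  let ?V = "{q \<in> V. \<phi> q \<in> X}"
  have pX: "\<phi> p \<in> X"
    using nz chart_on_image[OF \<phi>] by (auto simp: X_def less_le)
  obtain O' where O: "open O'" "\<phi> ` V = orthant K \<inter> O'"
    using chart_on_openin_image[OF \<phi>(1)] by (auto simp: openin_open)
  have im: "\<phi> ` ?V = X \<inter> O'"
  proof -
    have "\<phi> ` ?V = \<phi> ` V \<inter> X" by auto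
    also have "\<dots> = X \<inter> O'" unfolding O(2) by (auto simp: orthant_def X_def less_imp_le)
    finally show ?thesis .
  qed
  have oV: "openin (subtopology (mtop M) S) ?V" by (rule chart_on_openin_preimage[OF \<phi>(1) oX])
  have "homeomorphic_map (subtopology (subtopology (mtop M) V) ?V) (subtopology (top_of_set (\<phi> ` V)) (\<phi> ` ?V)) \<phi>"
    by (rule homeomorphic_map_subtopologies[OF chart_on_homeo[OF \<phi>(1)]])
      (use chart_on_subset_topspace[OF \<phi>(1)] in auto)
  then have "homeomorphic_map (subtopology (mtop M) ?V) (top_of_set (X \<inter> O')) \<phi>"
    unfolding im[symmetric] subtopology_subtopology by (simp add: inf.absorb2 image_mono)
  then have "subtopology (mtop M) ?V homeomorphic_space top_of_set (X \<inter> O')"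
    using homeomorphic_map_imp_homeomorphic_space by blast
  moreover have "open (X \<inter> O')" using O oX by blast
  ultimately show "p \<in> mf_interior M S"
    unfolding mf_interior_def using oV pX \<phi>(2) by blast
next
  assume "p \<in> mf_interior M S"
  then obtain V1 and W :: "(real ^ 'b) set" where V1: "openin (subtopology (mtop M) S) V1" "p \<in> V1" "open W"
    "subtopology (mtop M) V1 homeomorphic_space top_of_set W" unfolding mf_interior_def by blast
  then obtain h where h: "homeomorphic_map (subtopology (mtop M) V1) (top_of_set W) h"
    using homeomorphic_space by blast
  have sub: "V1 \<subseteq> S" "V1 \<subseteq> topspace (mtop M)" using openin_subset[OF V1(1)] by auto
  have "open (\<phi> ` (V1 \<inter> V))"
  proof (rule open_image_of_euclidean[OF h V1(3) sub(2)])
    show "continuous_map (subtopology (mtop M) (V1 \<inter> V)) euclidean \<phi>"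
      using chart_on_continuous[OF \<phi>(1)] by (meson Int_lower2 continuous_map_from_subtopology_mono)
    show "inj_on \<phi> (V1 \<inter> V)" using chart_on_inj[OF \<phi>(1)] inj_on_subset by blast
    have "openin (subtopology (subtopology (mtop M) S) V1) (V1 \<inter> V)"
      by (rule openin_subtopology_Int2[OF chart_on_openin[OF \<phi>(1)]])
    then show "openin (subtopology (mtop M) V1) (V1 \<inter> V)"
      using sub by (simp add: subtopology_subtopology inf.absorb2)
  qed
  then obtain e where e: "e > 0" "cball (\<phi> p) e \<subseteq> \<phi> ` (V1 \<inter> V)"
    using V1(2) \<phi>(2) open_contains_cball by (metis IntI imageI)
  show "\<forall>i\<in>K. \<phi> p $ i \<noteq> 0"
  proof (intro ballI notI)
    fix i assume i: "i \<in> K" "\<phi> p $ i = 0"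
    have "\<phi> p - e *\<^sub>R axis i 1 \<in> cball (\<phi> p) e" using e by (simp add: dist_norm)
    then have "\<phi> p - e *\<^sub>R axis i 1 \<in> \<phi> ` V" using e by blast
    then have "0 \<le> (\<phi> p - e *\<^sub>R axis i 1) $ i" using chart_on_image[OF \<phi>(1) _ i(1)] by force
    then show False using i e by simp
  qed
qed

lemma mf_interior_subset: "mf_interior M S \<subseteq> topspace (mtop M) \<inter> S"
  unfolding mf_interior_def by (auto dest!: openin_subset)

text \<open>Invariance of domain again, now in a chart of \<open>M\<close>: a Euclidean piece of
  \<open>S\<close> is carried to an open set, so near \<open>p\<close> it is open in
  \<open>M\<close> and consists of interior points of \<open>M\<close>.\<close>

lemma mf_interior_open:
  assumes M: "manifold_with_corners M" and p: "p \<in> mf_interior M S"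
  shows "p \<in> mtop M interior_of S" "p \<in> Int_mf M"
proof -
  let ?T = "topspace (mtop M)"
  obtain V1 and W :: "(real ^ 'b) set" where V1: "openin (subtopology (mtop M) S) V1" "p \<in> V1" "open W"
    "subtopology (mtop M) V1 homeomorphic_space top_of_set W" using p unfolding mf_interior_def by blast
  then obtain h where h: "homeomorphic_map (subtopology (mtop M) V1) (top_of_set W) h"
    using homeomorphic_space by blast
  have sub: "V1 \<subseteq> S" "V1 \<subseteq> ?T" using openin_subset[OF V1(1)] by auto
  obtain N \<phi> K where \<phi>: "chart_on M ?T N \<phi> K" "p \<in> N" "openin (mtop M) N"
    using manifold_chart[OF M] V1(2) sub by (metis subsetD)
  have "open (\<phi> ` (V1 \<inter> N))"
  proof (rule open_image_of_euclidean[OF h V1(3) sub(2)])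
    show "continuous_map (subtopology (mtop M) (V1 \<inter> N)) euclidean \<phi>"
      using chart_on_continuous[OF \<phi>(1)] by (meson Int_lower2 continuous_map_from_subtopology_mono)
    show "inj_on \<phi> (V1 \<inter> N)" using chart_on_inj[OF \<phi>(1)] inj_on_subset by blast
    show "openin (subtopology (mtop M) V1) (V1 \<inter> N)"
      by (rule openin_subtopology_Int2[OF \<phi>(3)])
  qed
  then have "openin (top_of_set (\<phi> ` N)) (\<phi> ` (V1 \<inter> N))"
    by (simp add: image_mono open_openin_trans open_subset)
  then have "openin (subtopology (mtop M) N) (V1 \<inter> N)"
    using chart_on_openness[OF \<phi>(1), of "V1 \<inter> N"] by simp
  then have o: "openin (mtop M) (V1 \<inter> N)" using openin_trans_full \<phi>(3) by blast
  then show "p \<in> mtop M interior_of S"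
    using V1(2) \<phi>(2) sub(1) unfolding interior_of_def by blast
  have "homeomorphic_map (subtopology (subtopology (mtop M) V1) (V1 \<inter> N)) (subtopology (top_of_set W) (h ` (V1 \<inter> N))) h"
    by (rule homeomorphic_map_subtopologies[OF h])
      (use sub homeomorphic_imp_surjective_map[OF h] in auto)
  then have hom: "homeomorphic_map (subtopology (mtop M) (V1 \<inter> N)) (subtopology (top_of_set W) (h ` (V1 \<inter> N))) h"
    by (simp add: subtopology_subtopology)
  have "openin (top_of_set W) (h ` (V1 \<inter> N))"
    using homeomorphic_map_openness[OF h, of "V1 \<inter> N"] openin_subtopology_Int2[OF \<phi>(3), of V1] sub by auto
  then have "open (h ` (V1 \<inter> N))" "h ` (V1 \<inter> N) \<subseteq> W"
    using V1(3) openin_open_trans openin_imp_subset by blast+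
  then have "subtopology (mtop M) (V1 \<inter> N) homeomorphic_space top_of_set (h ` (V1 \<inter> N))"
    using homeomorphic_map_imp_homeomorphic_space[OF hom] by (simp add: subtopology_subtopology inf.absorb2)
  then show "p \<in> Int_mf M"
    unfolding mf_interior_def using o \<open>open (h ` (V1 \<inter> N))\<close> V1(2) \<phi>(2) by auto
qed

section \<open>Tangent cones and transition maps\<close>

text \<open>Stands in for the tangent cone. A whole initial segment is demanded, so that conditions
  from several sets can be met at once and one-sided derivatives along \<open>u\<close> make sense
  within \<open>S\<close>.\<close>

definition ray_in :: "'v::real_vector set \<Rightarrow> 'v \<Rightarrow> 'v \<Rightarrow> bool" where
  "ray_in S x u \<longleftrightarrow> (\<exists>e>0. \<forall>t. 0 \<le> t \<and> t \<le> e \<longrightarrow> x + t *\<^sub>R u \<in> S)"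

lemma ray_in_subset: "ray_in S x u \<Longrightarrow> S \<subseteq> T \<Longrightarrow> ray_in T x u"
  unfolding ray_in_def by blast

lemma ray_in_Int:
  assumes "ray_in S x u" "ray_in T x u" shows "ray_in (S \<inter> T) x u"
proof -
  obtain d e where "d > 0" "e > 0"
    "\<forall>t. 0 \<le> t \<and> t \<le> d \<longrightarrow> x + t *\<^sub>R u \<in> S" "\<forall>t. 0 \<le> t \<and> t \<le> e \<longrightarrow> x + t *\<^sub>R u \<in> T"
    using assms unfolding ray_in_def by blast
  then show ?thesis unfolding ray_in_def by (intro exI[of _ "min d e"]) simp
qed

lemma ray_in_INT:
  assumes "finite I" "\<And>i. i \<in> I \<Longrightarrow> ray_in (S i) x u" shows "ray_in (\<Inter>i\<in>I. S i) x u"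
  using assms
proof (induction I rule: finite_induct)
  case empty
  then show ?case unfolding ray_in_def by (auto intro: exI[of _ 1])
next
  case (insert i I)
  then show ?case using ray_in_Int[of "S i" x u "\<Inter>i\<in>I. S i"] by simp
qed

lemma ray_in_open:
  fixes x u :: "'v::real_normed_vector"
  assumes "open S" "x \<in> S" shows "ray_in S x u"
proof -
  have "open ((\<lambda>t. x + t *\<^sub>R u) -` S)"
    using assms(1) by (intro open_vimage continuous_intros)
  moreover have "0 \<in> (\<lambda>t. x + t *\<^sub>R u) -` S" using assms by simp
  ultimately obtain e where "e > 0" "cball 0 e \<subseteq> (\<lambda>t. x + t *\<^sub>R u) -` S"
    using open_contains_cball by metis
  then show ?thesis unfolding ray_in_def by (intro exI[of _ e]) (auto simp: subset_eq)
qed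

abbreviation active :: "'n set \<Rightarrow> real ^ 'n::finite \<Rightarrow> 'n set" where
  "active K x \<equiv> {i \<in> K. x $ i = 0}"

text \<open>Constraints with slack at \<open>x\<close> survive a short move in any direction; the
  tight ones are preserved because \<open>u\<close> is nonnegative there.\<close>

lemma ray_in_orthant:
  assumes "x \<in> orthant K" "u \<in> orthant (active K x)" shows "ray_in (orthant K) x u"
proof -
  have "ray_in (\<Inter>i\<in>K. {y. 0 \<le> y $ i}) x u"
  proof (rule ray_in_INT)
    fix i assume i: "i \<in> K"
    show "ray_in {y. 0 \<le> y $ i} x u"
    proof (cases "x $ i = 0")
      case True
      then have "0 \<le> u $ i" using assms(2) i by (simp add: orthant_def)
      then show ?thesis using True unfolding ray_in_def by (auto intro: exI[of _ 1])
    next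
      case False
      then have "0 < x $ i" using assms(1) i by (simp add: orthant_def less_le)
      moreover have "open {y :: real ^ 'a. 0 < y $ i}" by (intro open_Collect_less continuous_intros)
      ultimately have "ray_in {y. 0 < y $ i} x u" by (intro ray_in_open) auto
      then show ?thesis by (rule ray_in_subset) auto
    qed
  qed simp
  then show ?thesis by (rule ray_in_subset) (auto simp: orthant_def)
qed

lemma has_derivative_on_ray:
  assumes "(F has_derivative D) (at x within S)" "\<forall>t. 0 \<le> t \<and> t \<le> e \<longrightarrow> x + t *\<^sub>R u \<in> S"
  shows "((\<lambda>t. F (x + t *\<^sub>R u)) has_vector_derivative D u) (at 0 within {0..e})"
proof -
  have lin: "linear D" using assms(1) has_derivative_linear by blast
  have "((\<lambda>t. x + t *\<^sub>R u) has_derivative (\<lambda>t. t *\<^sub>R u)) (at 0 within {0..e})"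
    by (auto intro!: derivative_eq_intros)
  moreover have "(F has_derivative D) (at (x + 0 *\<^sub>R u) within (\<lambda>t. x + t *\<^sub>R u) ` {0..e})"
    using assms by (auto intro: has_derivative_subset)
  ultimately have "((\<lambda>t. F (x + t *\<^sub>R u)) has_derivative (\<lambda>t. D (t *\<^sub>R u))) (at 0 within {0..e})"
    by (rule has_derivative_in_compose)
  then show ?thesis using lin by (simp add: has_vector_derivative_def linear_cmul)
qed

text \<open>Derivatives within arbitrary sets need not be unique; along a common ray both restrict
  to the one-sided derivative of the same function of one variable, which is.\<close>

lemma derivative_unique_on_ray:
  assumes "(F has_derivative D) (at x within S)" "(G has_derivative E) (at x within T)"
    and "ray_in (S \<inter> T) x u" "\<And>y. y \<in> S \<inter> T \<Longrightarrow> F y = G y"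
  shows "D u = E u"
proof -
  obtain e where e: "e > 0" "\<forall>t. 0 \<le> t \<and> t \<le> e \<longrightarrow> x + t *\<^sub>R u \<in> S \<inter> T"
    using assms(3) unfolding ray_in_def by blast
  have D: "((\<lambda>t. F (x + t *\<^sub>R u)) has_vector_derivative D u) (at 0 within {0..e})"
    by (rule has_derivative_on_ray[OF assms(1)]) (use e in auto)
  have "((\<lambda>t. G (x + t *\<^sub>R u)) has_vector_derivative E u) (at 0 within {0..e})"
    by (rule has_derivative_on_ray[OF assms(2)]) (use e in auto)
  then have "((\<lambda>t. F (x + t *\<^sub>R u)) has_vector_derivative E u) (at 0 within {0..e})"
    by (rule has_vector_derivative_transform[rotated 2]) (use e assms(4) in auto)
  then show ?thesis
    using vector_derivative_unique_within_closed_interval[of 0 e 0] D e(1) by simp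
qed

text \<open>The steps \<open>inverse (real (Suc n))\<close> turn statements about points on the ray
  into eventual statements about a sequence, which can be intersected.\<close>

lemma derivative_ray_sequence:
  fixes F :: "'v::real_normed_vector \<Rightarrow> real"
  assumes "(F has_derivative D) (at x within S)" "ray_in S x u"
  shows "(\<lambda>n. (F (x + inverse (real (Suc n)) *\<^sub>R u) - F x) / inverse (real (Suc n))) \<longlonglongrightarrow> D u"
proof -
  obtain e where e: "e > 0" "\<forall>t. 0 \<le> t \<and> t \<le> e \<longrightarrow> x + t *\<^sub>R u \<in> S"
    using assms(2) unfolding ray_in_def by blast
  have "((\<lambda>t. F (x + t *\<^sub>R u)) has_real_derivative D u) (at 0 within {0..e})"
    using has_derivative_on_ray[OF assms(1) e(2)] by (simp add: has_real_derivative_iff_has_vector_derivative)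
  then have "((\<lambda>t. (F (x + t *\<^sub>R u) - F x) / t) \<longlongrightarrow> D u) (at 0 within {0..e})"
    by (simp add: has_field_derivative_iff)
  moreover have "filterlim (\<lambda>n. inverse (real (Suc n))) (at 0 within {0..e}) sequentially"
    unfolding filterlim_at
  proof
    show lim: "(\<lambda>n. inverse (real (Suc n))) \<longlonglongrightarrow> 0" by (rule LIMSEQ_inverse_real_of_nat)
    from order_tendstoD(2)[OF lim e(1)]
    show "\<forall>\<^sub>F n in sequentially. inverse (real (Suc n)) \<in> {0..e} \<and> inverse (real (Suc n)) \<noteq> 0"
      by eventually_elim auto
  qed
  ultimately show ?thesis by (rule filterlim_compose)
qed

lemma ray_in_eventually:
  assumes "ray_in S x u"
  shows "\<forall>\<^sub>F n in sequentially. x + inverse (real (Suc n)) *\<^sub>R u \<in> S"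
proof -
  obtain e where e: "e > 0" "\<forall>t. 0 \<le> t \<and> t \<le> e \<longrightarrow> x + t *\<^sub>R u \<in> S"
    using assms unfolding ray_in_def by blast
  from order_tendstoD(2)[OF LIMSEQ_inverse_real_of_nat e(1)] show ?thesis
    by eventually_elim (use e(2) in simp)
qed

lemma has_derivative_vec_nth:
  "(F has_derivative D) net \<Longrightarrow> ((\<lambda>x. F x $ i :: real) has_derivative (\<lambda>v. D v $ i)) net"
  by (rule bounded_linear.has_derivative[OF bounded_linear_vec_nth])

text \<open>A coordinate that is tight at \<open>F x\<close> and nonnegative on \<open>S\<close> has
  nonnegative difference quotients along the ray; the limit inherits the sign.\<close>

lemma derivative_in_orthant:
  fixes F :: "real ^ 'n::finite \<Rightarrow> real ^ 'n"
  assumes "(F has_derivative D) (at x within S)" "ray_in S x u" "F ` S \<subseteq> orthant L"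
  shows "D u \<in> orthant (active L (F x))"
  unfolding orthant_def
proof (clarify)
  fix i assume i: "i \<in> L" "F x $ i = 0"
  have "(\<lambda>n. (F (x + inverse (real (Suc n)) *\<^sub>R u) $ i - F x $ i) / inverse (real (Suc n))) \<longlonglongrightarrow> D u $ i"
    by (rule derivative_ray_sequence[OF has_derivative_vec_nth[OF assms(1)] assms(2)])
  moreover have "\<forall>\<^sub>F n in sequentially. 0 \<le> (F (x + inverse (real (Suc n)) *\<^sub>R u) $ i - F x $ i) / inverse (real (Suc n))"
    using ray_in_eventually[OF assms(2)]
  proof eventually_elim
    case (elim n)
    then have "0 \<le> F (x + inverse (real (Suc n)) *\<^sub>R u) $ i" using assms(3) i(1) by (auto simp: orthant_def)
    then show ?case using i(2) by simp
  qed
  ultimately show "0 \<le> D u $ i" by (rule tendsto_lowerbound) simp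
qed

text \<open>Every orthant contains the standard basis, so agreement on admissible directions is
  already agreement everywhere.\<close>

lemma linear_eq_on_orthant:
  fixes D E :: "real ^ 'n::finite \<Rightarrow> 'v::real_vector"
  assumes "linear D" "linear E" "\<And>u. u \<in> orthant A \<Longrightarrow> D u = E u"
  shows "D = E"
proof (rule linear_eq_stdbasis[OF assms(1,2)])
  fix b :: "real ^ 'n" assume "b \<in> Basis"
  then have "b \<in> orthant A" by (auto simp: Basis_vec_def orthant_def axis_def)
  then show "D b = E b" by (rule assms(3))
qed

text \<open>Coordinates outside \<open>A\<close> are free, so both signs of such an axis lie in the
  orthant and the functional must vanish on it.\<close>

lemma linear_nonneg_on_orthant:
  fixes f :: "real ^ 'n::finite \<Rightarrow> real"
  assumes "linear f" "\<And>u. u \<in> orthant A \<Longrightarrow> 0 \<le> f u"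
  shows "f v = (\<Sum>i\<in>A. f (axis i 1) * v $ i)"
proof -
  have z: "f (axis i 1) = 0" if "i \<notin> A" for i
  proof -
    have "axis i 1 \<in> orthant A" "- axis i (1 :: real) \<in> orthant A"
      using that by (auto simp: orthant_def axis_def)
    then have "0 \<le> f (axis i 1)" "0 \<le> f (- axis i 1)" using assms(2) by blast+
    then show ?thesis using linear_neg[OF assms(1)] by simp
  qed
  have "v = (\<Sum>i\<in>UNIV. v $ i *\<^sub>R axis i 1)"
    by (simp add: vec_eq_iff axis_def if_distrib cong: if_cong)
  then have "f v = f (\<Sum>i\<in>UNIV. v $ i *\<^sub>R axis i 1)" by (rule arg_cong)
  also have "\<dots> = (\<Sum>i\<in>UNIV. f (axis i 1) * v $ i)"
    by (simp add: linear_sum[OF assms(1)] linear_cmul[OF assms(1)] mult.commute)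
  also have "\<dots> = (\<Sum>i\<in>A. f (axis i 1) * v $ i)"
    by (rule sum.mono_neutral_right) (use z in auto)
  finally show ?thesis .
qed

lemma dim_zero_coordinates: "dim {u :: real ^ 'n::finite. \<forall>i\<in>A. u $ i = 0} = CARD('n) - card A"
proof -
  have "{u :: real ^ 'n. \<forall>i\<in>A. u $ i = 0} = {u. \<forall>i. i \<notin> - A \<longrightarrow> u $ i = 0}" by auto
  then show ?thesis
    using dim_substandard_cart[where 'a = real and 'n = 'n, of "- A"] by (simp add: dim_vec_eq Compl_eq_Diff_UNIV card_Diff_subset)
qed

text \<open>Compares lineality spaces. The largest linear subspace of \<open>orthant A\<close> is
  cut out by the coordinates in \<open>A\<close>; \<open>B\<close> is injective and carries it into
  the corresponding subspace for \<open>A'\<close>, and the inequality of dimensions reverses for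
  the cardinalities.\<close>

lemma card_le_of_orthant_map:
  fixes B C :: "real ^ 'n::finite \<Rightarrow> real ^ 'n"
  assumes "linear B" "\<And>u. C (B u) = u" "\<And>u. u \<in> orthant A \<Longrightarrow> B u \<in> orthant A'"
  shows "card A' \<le> card A"
proof -
  have "B ` {u :: real ^ 'n. \<forall>i\<in>A. u $ i = 0} \<subseteq> {u. \<forall>i\<in>A'. u $ i = 0}"
  proof clarify
    fix u :: "real ^ 'n" and i assume u: "\<forall>i\<in>A. u $ i = 0" and i: "i \<in> A'"
    have "B u \<in> orthant A'" "B (- u) \<in> orthant A'" using assms(3) u by (auto simp: orthant_def)
    then show "B u $ i = 0" using i by (simp add: orthant_def linear_neg[OF assms(1)] order_antisym)
  qed
  then have "dim (B ` {u :: real ^ 'n. \<forall>i\<in>A. u $ i = 0}) \<le> dim {u :: real ^ 'n. \<forall>i\<in>A'. u $ i = 0}"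
    by (rule dim_subset)
  moreover have "inj_on B (span {u :: real ^ 'n. \<forall>i\<in>A. u $ i = 0})" using assms(2) by (rule inj_on_inverseI)
  ultimately have "dim {u :: real ^ 'n. \<forall>i\<in>A. u $ i = 0} \<le> dim {u :: real ^ 'n. \<forall>i\<in>A'. u $ i = 0}"
    using dim_image_eq[OF assms(1)] by simp
  moreover have "card A \<le> CARD('n)" "card A' \<le> CARD('n)" by (auto intro: card_mono)
  ultimately show ?thesis unfolding dim_zero_coordinates by linarith
qed

text \<open>The derivative \<open>B\<close> at \<open>\<psi> p\<close> of the coordinate change from the chart \<open>(V', \<psi>)\<close> to \<open>(V, \<phi>)\<close>.\<close>

definition transition_derivative ::
  "'a set \<Rightarrow> ('a \<Rightarrow> real ^ 'n::finite) \<Rightarrow> 'a set \<Rightarrow> ('a \<Rightarrow> real ^ 'n) \<Rightarrow> 'a \<Rightarrow> (real ^ 'n \<Rightarrow> real ^ 'n) \<Rightarrow> bool" where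
  "transition_derivative V' \<psi> V \<phi> p B \<longleftrightarrow>
     ((\<lambda>x. \<phi> (inv_into V' \<psi> x)) has_derivative B) (at (\<psi> p) within \<psi> ` (V \<inter> V'))"

section \<open>Calculus of coordinate changes between corner charts\<close>

lemma extension_has_derivative:
  assumes W: "open W" "x \<in> W" "smooth_on W g" "\<And>y. y \<in> W \<inter> S \<Longrightarrow> g y = f y" and x: "x \<in> S"
  shows "(f has_derivative frechet_derivative g (at x)) (at x within S)"
proof -
  have "(g has_derivative frechet_derivative g (at x)) (at x within S)"
    using smooth_on_has_derivative[OF W(3,2)] has_derivative_at_withinI by blast
  moreover obtain d where d: "d > 0" "ball x d \<subseteq> W" using W openE by blast
  ultimately show ?thesis
    by (elim has_derivative_transform_within[OF _ d(1) x])
      (use d(2) W(4) in \<open>auto simp: subset_eq dist_commute\<close>)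
qed

lemma smooth_ext_has_derivative:
  assumes "smooth_ext S f" "x \<in> S"
  obtains D where "(f has_derivative D) (at x within S)"
  using assms extension_has_derivative unfolding smooth_ext_def by metis

lemma transition_derivative_exists:
  assumes M: "manifold_with_corners M" and \<phi>: "chart_on M S V \<phi> L" and \<psi>: "chart_on M S' V' \<psi> K"
    and p: "p \<in> V" "p \<in> V'"
  obtains B where "transition_derivative V' \<psi> V \<phi> p B" "linear B"
proof -
  have "smooth_ext (\<psi> ` (V \<inter> V')) (\<lambda>x. \<phi> (inv_into V' \<psi> x))"
    by (rule smooth_fun_in_chart[OF M chart_on_smooth[OF \<phi>] \<psi>])
  then show ?thesis
    using smooth_ext_has_derivative[of _ _ "\<psi> p"] p that has_derivative_linear
    unfolding transition_derivative_def by (metis IntI imageI)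
qed

text \<open>The image of a chart is relatively open in its orthant, so directions allowed by the
  tight constraints stay inside for a short time. The set \<open>N\<close> serves to impose further
  open conditions on the points of the ray.\<close>

lemma ray_in_chart:
  assumes \<psi>: "chart_on M S V \<psi> K" and N: "openin (subtopology (mtop M) S) N" and p: "p \<in> V" "p \<in> N"
    and u: "u \<in> orthant (active K (\<psi> p))"
  shows "ray_in (\<psi> ` (V \<inter> N)) (\<psi> p) u"
proof -
  have "openin (subtopology (subtopology (mtop M) S) V) (V \<inter> N)"
    by (rule openin_subtopology_Int2[OF N])
  then have "openin (subtopology (mtop M) V) (V \<inter> N)"
    using chart_on_subset[OF \<psi>] by (simp add: subtopology_subtopology inf.absorb2)
  then have "openin (top_of_set (\<psi> ` V)) (\<psi> ` (V \<inter> N))"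
    using chart_on_openness[OF \<psi>, of "V \<inter> N"] by simp
  then have "openin (top_of_set (orthant K)) (\<psi> ` (V \<inter> N))"
    using openin_trans chart_on_openin_image[OF \<psi>] by blast
  then obtain X where X: "open X" "\<psi> ` (V \<inter> N) = orthant K \<inter> X" by (auto simp: openin_open)
  then have "\<psi> p \<in> orthant K" "\<psi> p \<in> X" using p by blast+
  then show ?thesis
    unfolding X(2) using ray_in_Int[OF ray_in_orthant[OF _ u] ray_in_open[OF X(1)]] by blast
qed

lemma chart_on_Int_openin:
  assumes \<phi>: "chart_on M (topspace (mtop M)) V \<phi> L"
  shows "openin (subtopology (mtop M) S) (S \<inter> V)"
  using chart_on_openin[OF \<phi>] by (simp add: openin_subtopology_Int2)

text \<open>The three derivatives are taken within different sets, so the chain rule applies only on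
  a common domain. In the coordinates of \<open>\<psi>\<close> that domain contains rays in all
  directions of the cone at \<open>p\<close>, and these determine a linear map.\<close>

lemma transition_derivative_chain:
  assumes M: "manifold_with_corners M"
    and \<phi>: "chart_on M (topspace (mtop M)) V \<phi> L" and \<phi>1: "chart_on M (topspace (mtop M)) V1 \<phi>1 L1"
    and \<psi>: "chart_on M S V' \<psi> K" and p: "p \<in> V" "p \<in> V1" "p \<in> V'"
    and A: "transition_derivative V \<phi> V1 \<phi>1 p A" and B: "transition_derivative V' \<psi> V \<phi> p B"
    and B1: "transition_derivative V' \<psi> V1 \<phi>1 p B1"
  shows "B1 = A \<circ> B"
proof (rule linear_eq_on_orthant)
  show "linear B1" "linear (A \<circ> B)"
    using A B B1 unfolding transition_derivative_def
    by (auto intro: linear_compose has_derivative_linear)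
  let ?X = "\<psi> ` (V' \<inter> (S \<inter> V \<inter> (S \<inter> V1)))"
  have injV: "inj_on \<phi> V" and injV': "inj_on \<psi> V'" using chart_on_inj \<phi> \<psi> by blast+
  have sub: "V' \<subseteq> S" by (rule chart_on_subset[OF \<psi>])
  have "((\<lambda>x. (\<lambda>y. \<phi>1 (inv_into V \<phi> y)) (\<phi> (inv_into V' \<psi> x))) has_derivative (\<lambda>x. A (B x))) (at (\<psi> p) within ?X)"
  proof (rule has_derivative_in_compose[where f = "\<lambda>x. \<phi> (inv_into V' \<psi> x)" and f' = B and g = "\<lambda>y. \<phi>1 (inv_into V \<phi> y)" and g' = A])
    show "((\<lambda>x. \<phi> (inv_into V' \<psi> x)) has_derivative B) (at (\<psi> p) within ?X)"
      using B unfolding transition_derivative_def by (rule has_derivative_subset) auto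
    have "\<phi> (inv_into V' \<psi> (\<psi> p)) = \<phi> p" using injV' p by simp
    moreover have "(\<lambda>x. \<phi> (inv_into V' \<psi> x)) ` ?X \<subseteq> \<phi> ` (V1 \<inter> V)" using injV' by auto
    ultimately show "((\<lambda>y. \<phi>1 (inv_into V \<phi> y)) has_derivative A)
        (at (\<phi> (inv_into V' \<psi> (\<psi> p))) within (\<lambda>x. \<phi> (inv_into V' \<psi> x)) ` ?X)"
      using A unfolding transition_derivative_def by (auto intro: has_derivative_subset)
  qed
  then have AB: "((\<lambda>x. \<phi>1 (inv_into V \<phi> (\<phi> (inv_into V' \<psi> x)))) has_derivative A \<circ> B) (at (\<psi> p) within ?X)"
    by (simp add: comp_def)
  fix u assume u: "u \<in> orthant (active K (\<psi> p))"
  have "ray_in ?X (\<psi> p) u"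
    by (rule ray_in_chart[OF \<psi> _ p(3) _ u])
      (use p sub chart_on_Int_openin[OF \<phi>] chart_on_Int_openin[OF \<phi>1] in auto)
  then have "ray_in (\<psi> ` (V1 \<inter> V') \<inter> ?X) (\<psi> p) u" by (rule ray_in_subset) auto
  then show "B1 u = (A \<circ> B) u"
    by (rule derivative_unique_on_ray[OF B1[unfolded transition_derivative_def] AB])
      (use injV injV' in auto)
qed

text \<open>In the coordinates of \<open>\<psi>\<close> the overlap is relatively open in the
  orthant, so \<open>C \<circ> B = id\<close> can be tested along rays. In the coordinates of
  \<open>\<phi>\<close> the overlap need not be a neighbourhood, and the other identity comes from
  finite dimension instead.\<close>

lemma transition_derivative_inverse:
  assumes M: "manifold_with_corners M"
    and \<phi>: "chart_on M (topspace (mtop M)) V \<phi> L"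
    and \<psi>: "chart_on M S V' \<psi> K" and p: "p \<in> V" "p \<in> V'"
    and C: "transition_derivative V \<phi> V' \<psi> p C" and B: "transition_derivative V' \<psi> V \<phi> p B"
  shows "C \<circ> B = id" "B \<circ> C = id"
proof -
  have lin: "linear B" "linear C" using B C unfolding transition_derivative_def
    by (auto intro: has_derivative_linear)
  show CB: "C \<circ> B = id"
  proof (rule linear_eq_on_orthant)
    show "linear (C \<circ> B)" "linear (id :: real ^ 'b \<Rightarrow> _)" using lin by (auto intro: linear_compose linear_id)
    let ?X = "\<psi> ` (V' \<inter> (S \<inter> V))"
    have injV: "inj_on \<phi> V" and injV': "inj_on \<psi> V'" using chart_on_inj \<phi> \<psi> by blast+
    have sub: "V' \<subseteq> S" by (rule chart_on_subset[OF \<psi>])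
    have "((\<lambda>x. (\<lambda>y. \<psi> (inv_into V \<phi> y)) (\<phi> (inv_into V' \<psi> x))) has_derivative (\<lambda>x. C (B x))) (at (\<psi> p) within ?X)"
    proof (rule has_derivative_in_compose[where f = "\<lambda>x. \<phi> (inv_into V' \<psi> x)" and f' = B and g = "\<lambda>y. \<psi> (inv_into V \<phi> y)" and g' = C])
      show "((\<lambda>x. \<phi> (inv_into V' \<psi> x)) has_derivative B) (at (\<psi> p) within ?X)"
        using B unfolding transition_derivative_def by (rule has_derivative_subset) auto
      have "\<phi> (inv_into V' \<psi> (\<psi> p)) = \<phi> p" using injV' p by simp
      moreover have "(\<lambda>x. \<phi> (inv_into V' \<psi> x)) ` ?X \<subseteq> \<phi> ` (V' \<inter> V)" using injV' by auto
      ultimately show "((\<lambda>y. \<psi> (inv_into V \<phi> y)) has_derivative C)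
          (at (\<phi> (inv_into V' \<psi> (\<psi> p))) within (\<lambda>x. \<phi> (inv_into V' \<psi> x)) ` ?X)"
        using C unfolding transition_derivative_def by (auto intro: has_derivative_subset)
    qed
    then have CB: "((\<lambda>x. \<psi> (inv_into V \<phi> (\<phi> (inv_into V' \<psi> x)))) has_derivative C \<circ> B) (at (\<psi> p) within ?X)"
      by (simp add: comp_def)
    fix u assume u: "u \<in> orthant (active K (\<psi> p))"
    have "ray_in ?X (\<psi> p) u"
      by (rule ray_in_chart[OF \<psi> _ p(2) _ u])
        (use p sub chart_on_Int_openin[OF \<phi>] in auto)
    then have "ray_in (?X \<inter> UNIV) (\<psi> p) u" by simp
    then show "(C \<circ> B) u = id u"
      by (rule derivative_unique_on_ray[OF CB has_derivative_id])
        (use injV injV' in auto)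
  qed
  then show "B \<circ> C = id"
    using lin left_inverse_linear by (metis linear_inverse_left)
qed

lemma transition_derivative_orthant:
  assumes M: "manifold_with_corners M"
    and \<phi>: "chart_on M (topspace (mtop M)) V \<phi> L"
    and \<psi>: "chart_on M S V' \<psi> K" and p: "p \<in> V" "p \<in> V'"
    and B: "transition_derivative V' \<psi> V \<phi> p B" and u: "u \<in> orthant (active K (\<psi> p))"
  shows "B u \<in> orthant (active L (\<phi> p))"
proof -
  have injV': "inj_on \<psi> V'" using chart_on_inj \<psi> by blast
  have sub: "V' \<subseteq> S" by (rule chart_on_subset[OF \<psi>])
  have "ray_in (\<psi> ` (V' \<inter> (S \<inter> V))) (\<psi> p) u"
    by (rule ray_in_chart[OF \<psi> _ p(2) _ u]) (use p sub chart_on_Int_openin[OF \<phi>] in auto)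
  then have r: "ray_in (\<psi> ` (V \<inter> V')) (\<psi> p) u" by (rule ray_in_subset) auto
  have "B u \<in> orthant (active L (\<phi> (inv_into V' \<psi> (\<psi> p))))"
    by (rule derivative_in_orthant[OF B[unfolded transition_derivative_def] r])
      (use p injV' chart_on_image[OF \<phi>] in \<open>auto simp: orthant_def\<close>)
  then show ?thesis using p injV' by simp
qed

text \<open>Each transition derivative maps the cone of one chart into the cone of the other, and
  the two are mutually inverse; hence the corner codimension of a point of \<open>M\<close> does not
  depend on the chart.\<close>

lemma card_active_unique:
  assumes M: "manifold_with_corners M"
    and \<phi>: "chart_on M (topspace (mtop M)) V \<phi> L" "p \<in> V" and \<psi>: "chart_on M (topspace (mtop M)) V' \<psi> K" "p \<in> V'"
  shows "card (active L (\<phi> p)) = card (active K (\<psi> p))"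
proof -
  obtain B where B: "transition_derivative V' \<psi> V \<phi> p B" "linear B"
    using transition_derivative_exists[OF M \<phi>(1) \<psi>(1) \<phi>(2) \<psi>(2)] by blast
  obtain C where C: "transition_derivative V \<phi> V' \<psi> p C" "linear C"
    using transition_derivative_exists[OF M \<psi>(1) \<phi>(1) \<psi>(2) \<phi>(2)] by blast
  have inv: "C \<circ> B = id" "B \<circ> C = id"
    using transition_derivative_inverse[OF M \<phi>(1) \<psi>(1) \<phi>(2) \<psi>(2) C(1) B(1)] by auto
  have "card (active L (\<phi> p)) \<le> card (active K (\<psi> p))"
    by (rule card_le_of_orthant_map[OF B(2), of C])
      (use inv transition_derivative_orthant[OF M \<phi>(1) \<psi>(1) \<phi>(2) \<psi>(2) B(1)] in \<open>auto simp: pointfree_idE\<close>)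
  moreover have "card (active K (\<psi> p)) \<le> card (active L (\<phi> p))"
    by (rule card_le_of_orthant_map[OF C(2), of B])
      (use inv transition_derivative_orthant[OF M \<psi>(1) \<phi>(1) \<psi>(2) \<phi>(2) C(1)] in \<open>auto simp: pointfree_idE\<close>)
  ultimately show ?thesis by simp
qed

text \<open>\<open>B\<close> maps the cone of a corner into the cone of the ambient corner. Facets of the small cone that
  are not walls lie in facets of the ambient one, hence by independence of the walls from the
  ambient facets, walls and ambient facets together account for all facets of the small cone.\<close>

lemma card_facets_of_subcone:
  fixes B C :: "real ^ 'n::finite \<Rightarrow> real ^ 'n"
  assumes lin: "linear B" "linear C" and inv: "C \<circ> B = id" "B \<circ> C = id" and W: "W \<subseteq> A"
    and cone: "\<And>u. u \<in> orthant A \<Longrightarrow> B u \<in> orthant L"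
    and bdry: "\<And>i. i \<in> A - W \<Longrightarrow> \<exists>l\<in>L. \<forall>u. u $ i = 0 \<longrightarrow> B u $ l = 0"
    and indep: "\<And>a b. (\<And>v. (\<Sum>l\<in>L. a l * v $ l) + (\<Sum>i\<in>W. b i * C v $ i) = 0) \<Longrightarrow> (\<forall>l\<in>L. a l = 0)"
  shows "card A = card W + card L"
proof -
  have CB: "C (B u) = u" and BC: "B (C u) = u" for u using inv by (auto simp: pointfree_idE)
  obtain \<sigma> where \<sigma>: "\<And>i. i \<in> A - W \<Longrightarrow> \<sigma> i \<in> L" "\<And>i u. i \<in> A - W \<Longrightarrow> u $ i = 0 \<Longrightarrow> B u $ \<sigma> i = 0"
    using bdry by metis
  \<comment> \<open>The coefficient of the small facet functional \<open>i\<close> in the ambient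
    functional \<open>l\<close>; by the cone condition \<open>B u $ l\<close> involves only the
    coordinates in \<open>A\<close>.\<close>
  define f where "f l i = B (axis i 1) $ l" for l i
  have Bl: "B u $ l = (\<Sum>i\<in>A. f l i * u $ i)" if "l \<in> L" for u l
    unfolding f_def
  proof (rule linear_nonneg_on_orthant)
    show "linear (\<lambda>u. B u $ l)" using lin(1) by (auto simp: linear_iff)
  qed (use cone that in \<open>auto simp: orthant_def\<close>)
  have B\<sigma>: "B u $ \<sigma> i = f (\<sigma> i) i * u $ i" if i: "i \<in> A - W" for u i
  proof -
    have "B (u - u $ i *\<^sub>R axis i 1) $ \<sigma> i = 0" by (rule \<sigma>(2)[OF i]) simp
    then show ?thesis by (simp add: linear_diff[OF lin(1)] linear_cmul[OF lin(1)] f_def)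
  qed
  \<comment> \<open>Otherwise the functional \<open>\<sigma> i\<close> would vanish on the image of
    \<open>B\<close>, although \<open>B\<close> is onto.\<close>
  have f0: "f (\<sigma> i) i \<noteq> 0" if i: "i \<in> A - W" for i
  proof
    assume "f (\<sigma> i) i = 0"
    then have "B (C (axis (\<sigma> i) 1)) $ \<sigma> i = 0" using B\<sigma>[OF i] by simp
    then show False by (simp add: BC)
  qed
  have inj: "inj_on \<sigma> (A - W)"
  proof (rule inj_onI, rule ccontr)
    fix i j assume ij: "i \<in> A - W" "j \<in> A - W" "\<sigma> i = \<sigma> j" "i \<noteq> j"
    have "f (\<sigma> i) i * axis i 1 $ i = f (\<sigma> j) j * axis i 1 $ j"
      using B\<sigma>[OF ij(1), of "axis i 1"] B\<sigma>[OF ij(2), of "axis i 1"] ij(3) by simp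
    then show False using f0[OF ij(1)] ij(4) by (simp add: axis_def)
  qed
  have "\<sigma> ` (A - W) = L"
  proof (rule ccontr)
    assume "\<sigma> ` (A - W) \<noteq> L"
    then obtain l where l: "l \<in> L" "l \<notin> \<sigma> ` (A - W)" using \<sigma>(1) by blast
    \<comment> \<open>Solves for the coordinate \<open>i\<close> through the ambient coordinate
      \<open>\<sigma> i\<close>. If \<open>l\<close> is missed by \<open>\<sigma>\<close>,
      substituting this in the expansion of the functional \<open>l\<close> leaves a relation
      between ambient facets and walls with coefficient \<open>- 1\<close> at
      \<open>l\<close>.\<close>
    define g where "g m = (let i = inv_into (A - W) \<sigma> m in f l i / f m i)" for m
    define a where "a m = (if m = l then - 1 else if m \<in> \<sigma> ` (A - W) then g m else 0)" for m
    have "(\<Sum>m\<in>L. a m * v $ m) + (\<Sum>i\<in>W. f l i * C v $ i) = 0" for v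
    proof -
      have "(\<Sum>m\<in>L. a m * v $ m) = (\<Sum>m\<in>insert l (\<sigma> ` (A - W)). a m * v $ m)"
        by (rule sum.mono_neutral_right) (use l \<sigma>(1) in \<open>auto simp: a_def\<close>)
      also have "\<dots> = - v $ l + (\<Sum>m\<in>\<sigma> ` (A - W). g m * v $ m)"
        using l by (simp add: a_def) (rule sum.cong, auto simp: a_def)
      also have "(\<Sum>m\<in>\<sigma> ` (A - W). g m * v $ m) = (\<Sum>i\<in>A - W. g (\<sigma> i) * v $ \<sigma> i)"
        by (rule sum.reindex_cong[OF inj]) auto
      also have "\<dots> = (\<Sum>i\<in>A - W. f l i * C v $ i)"
      proof (rule sum.cong)
        fix i assume i: "i \<in> A - W"
        have "v $ \<sigma> i = f (\<sigma> i) i * C v $ i" using B\<sigma>[OF i, of "C v"] BC by simp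
        then show "g (\<sigma> i) * v $ \<sigma> i = f l i * C v $ i"
          using f0[OF i] inj i by (simp add: g_def)
      qed simp
      finally have "(\<Sum>m\<in>L. a m * v $ m) = - v $ l + (\<Sum>i\<in>A - W. f l i * C v $ i)" .
      moreover have "v $ l = (\<Sum>i\<in>A - W. f l i * C v $ i) + (\<Sum>i\<in>W. f l i * C v $ i)"
        using Bl[OF l(1), of "C v"] BC sum.subset_diff[OF W] by simp
      ultimately show ?thesis by simp
    qed
    from indep[OF this] have "a l = 0" using l(1) by blast
    then show False by (simp add: a_def)
  qed
  then have "card L = card (A - W)" using card_image[OF inj] by simp
  moreover have "card W \<le> card A" using W by (simp add: card_mono)
  ultimately show ?thesis using card_Diff_subset[OF _ W] by simp
qed

section \<open>Wall sheets and transversality\<close>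

text \<open>If every ambient facet were left by some vector of the sheet, a single direction inside
  the sheet would point strictly into the ambient cone. The sheet would then contain points of
  \<open>Int_mf M\<close> arbitrarily near \<open>p\<close>, which is what makes it a wall
  sheet.\<close>

lemma boundary_sheet_in_facet:
  assumes M: "manifold_with_corners M"
    and \<phi>: "chart_on M (topspace (mtop M)) V \<phi> L" and \<psi>: "chart_on M S V' \<psi> K" and p: "p \<in> V" "p \<in> V'"
    and B: "transition_derivative V' \<psi> V \<phi> p B"
    and i: "i \<in> active K (\<psi> p)" "i \<notin> wall_sheets M p V' \<psi> K"
  shows "\<exists>l \<in> active L (\<phi> p). \<forall>u. u $ i = 0 \<longrightarrow> B u $ l = 0"
proof (rule ccontr)
  assume no: "\<not> (\<exists>l \<in> active L (\<phi> p). \<forall>u. u $ i = 0 \<longrightarrow> B u $ l = 0)"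
  have injV': "inj_on \<psi> V'" and injV: "inj_on \<phi> V" using chart_on_inj \<phi> \<psi> by blast+
  have pT: "p \<in> topspace (mtop M)" using chart_on_subset_topspace[OF \<phi>] p by blast
  have sub: "V' \<subseteq> S" by (rule chart_on_subset[OF \<psi>])
  obtain O1 where O1: "openin (mtop M) O1" "p \<in> O1" "O1 \<inter> ({q \<in> V'. \<psi> q $ i = 0} \<inter> Int_mf M) = {}"
    using i pT unfolding wall_sheets_def in_closure_of by blast
  \<comment> \<open>All coordinates but \<open>i\<close> are positive, so \<open>u\<close> has a
    positive value under every functional that is nonnegative on the cone and nonzero on the
    sheet.\<close>
  define u :: "real ^ 'b" where "u = (\<chi> k. if k = i then 0 else 1)"
  have u: "u \<in> orthant (active K (\<psi> p))" by (simp add: u_def orthant_def)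
  have lin: "linear B" using B unfolding transition_derivative_def by (rule has_derivative_linear)
  have pos: "0 < B u $ l" if l: "l \<in> active L (\<phi> p)" for l
  proof -
    have cone: "0 \<le> B v $ l" if "v \<in> orthant (active K (\<psi> p))" for v
      using transition_derivative_orthant[OF M \<phi> \<psi> p B that] l by (simp add: orthant_def)
    have eq: "B v $ l = (\<Sum>k\<in>active K (\<psi> p). B (axis k 1) $ l * v $ k)" for v
    proof (rule linear_nonneg_on_orthant)
      show "linear (\<lambda>u. B u $ l)" using lin by (auto simp: linear_iff)
    qed (rule cone)
    have ax: "0 \<le> B (axis k 1) $ l" for k by (rule cone) (auto simp: orthant_def axis_def)
    obtain k where k: "k \<in> active K (\<psi> p)" "k \<noteq> i" "B (axis k 1) $ l \<noteq> 0"
    proof -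
      obtain v where v: "v $ i = 0" "B v $ l \<noteq> 0" using no l by blast
      then obtain k where "k \<in> active K (\<psi> p)" "B (axis k 1) $ l * v $ k \<noteq> 0"
        using eq[of v] by (metis (no_types, lifting) sum.neutral)
      then show ?thesis using that v(1) by auto
    qed
    have "0 < (\<Sum>k\<in>active K (\<psi> p). B (axis k 1) $ l * u $ k)"
      by (rule sum_pos2[of _ k]) (use k ax[of k] ax in \<open>auto simp: u_def less_le\<close>)
    then show ?thesis using eq[of u] by simp
  qed
  \<comment> \<open>Keeps the coordinates of \<open>L\<close> that are positive at \<open>p\<close>
    positive, so that only the active ones have to be controlled along the ray.\<close>
  define X where "X = {y :: real ^ 'b. \<forall>l\<in>L - active L (\<phi> p). 0 < y $ l}"
  have "X = (\<Inter>l\<in>L - active L (\<phi> p). {x. 0 < x $ l})" by (auto simp: X_def)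
  then have oX: "open X" by (auto intro!: open_INT open_Collect_less continuous_intros)
  have pX: "\<phi> p \<in> X" using chart_on_image[OF \<phi> p(1)] by (auto simp: X_def less_le)
  let ?V = "{q \<in> V. \<phi> q \<in> X}"
  have oV: "openin (mtop M) ?V" using chart_on_openin_preimage[OF \<phi> oX] by simp
  have r: "ray_in (\<psi> ` (V' \<inter> (S \<inter> (?V \<inter> O1)))) (\<psi> p) u"
    by (rule ray_in_chart[OF \<psi> _ p(2) _ u])
      (use sub p pX O1 oV in \<open>auto intro!: openin_subtopology_Int2\<close>)
  have r': "ray_in (\<psi> ` (V \<inter> V')) (\<psi> p) u" by (rule ray_in_subset[OF r]) auto
  define q where "q n = inv_into V' \<psi> (\<psi> p + inverse (real (Suc n)) *\<^sub>R u)" for n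
  have "\<forall>\<^sub>F n in sequentially. \<forall>l\<in>active L (\<phi> p). 0 < \<phi> (q n) $ l"
  proof (rule eventually_ball_finite)
    show "\<forall>l\<in>active L (\<phi> p). \<forall>\<^sub>F n in sequentially. 0 < \<phi> (q n) $ l"
    proof
      fix l assume l: "l \<in> active L (\<phi> p)"
      have "(\<lambda>n. (\<phi> (q n) $ l - \<phi> (inv_into V' \<psi> (\<psi> p)) $ l) / inverse (real (Suc n))) \<longlonglongrightarrow> B u $ l"
        unfolding q_def
        by (rule derivative_ray_sequence[OF has_derivative_vec_nth[OF B[unfolded transition_derivative_def]] r'])
      then have "\<forall>\<^sub>F n in sequentially. 0 < (\<phi> (q n) $ l - \<phi> (inv_into V' \<psi> (\<psi> p)) $ l) / inverse (real (Suc n))"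
        using pos[OF l] order_tendstoD(1) by blast
      then show "\<forall>\<^sub>F n in sequentially. 0 < \<phi> (q n) $ l"
        by eventually_elim (use p injV' l in \<open>simp add: zero_less_divide_iff\<close>)
    qed
  qed simp
  moreover have "\<forall>\<^sub>F n in sequentially. \<psi> p + inverse (real (Suc n)) *\<^sub>R u \<in> \<psi> ` (V' \<inter> (S \<inter> (?V \<inter> O1)))"
    by (rule ray_in_eventually[OF r])
  ultimately have "\<forall>\<^sub>F n in sequentially. False"
  proof eventually_elim
    case (elim n)
    then obtain q' where q': "q' \<in> V' \<inter> (S \<inter> (?V \<inter> O1))" "\<psi> p + inverse (real (Suc n)) *\<^sub>R u = \<psi> q'" by blast
    have qn: "q n = q'" unfolding q_def q'(2) using q'(1) injV' by simp
    have "\<psi> q' $ i = 0" using q'(2)[symmetric] i(1) by (simp add: u_def)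
    then have "q' \<notin> Int_mf M" using q'(1) O1(3) by blast
    then obtain l where l: "l \<in> L" "\<phi> q' $ l = 0" using mf_interior_chart[OF \<phi>, of q'] q'(1) by blast
    show False
    proof (cases "l \<in> active L (\<phi> p)")
      case True
      then show ?thesis using elim(1) qn l(2) by auto
    next
      case False
      then have "l \<in> L - active L (\<phi> p)" using l by blast
      then have "0 < \<phi> q' $ l" using q'(1) unfolding X_def by blast
      then show ?thesis using l by simp
    qed
  qed
  then show False by simp
qed

lemma wall_sheets_active:
  assumes \<psi>: "chart_on M S V' \<psi> K" and p: "p \<in> V'"
  shows "wall_sheets M p V' \<psi> K \<subseteq> active K (\<psi> p)"
proof
  fix i assume i: "i \<in> wall_sheets M p V' \<psi> K"
  have "\<psi> p $ i = 0"
  proof (rule ccontr)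
    assume nz: "\<psi> p $ i \<noteq> 0"
    have "open {x :: real ^ 'b. x $ i \<noteq> 0}" by (intro open_Collect_neq continuous_intros)
    from chart_on_openin_preimage[OF \<psi> this] obtain O1 where
      O1: "openin (mtop M) O1" "{q \<in> V'. \<psi> q \<in> {x. x $ i \<noteq> 0}} = O1 \<inter> S" unfolding openin_subtopology by blast
    then have "p \<in> O1" using nz p by blast
    then obtain q where "q \<in> O1" "q \<in> V'" "\<psi> q $ i = 0"
      using i O1(1) unfolding wall_sheets_def in_closure_of by blast
    then show False using O1(2) chart_on_subset[OF \<psi>] by blast
  qed
  then show "i \<in> active K (\<psi> p)" using i unfolding wall_sheets_def by blast
qed

text \<open>\<open>transverse_at\<close> supplies some derivative within the overlap in the
  coordinates of \<open>\<phi>\<close>, where uniqueness is not at hand. After composition with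
  \<open>B\<close> it is the derivative of a coordinate function along rays of the small cone and
  therefore determined.\<close>

lemma covector_transition:
  assumes \<phi>: "chart_on M (topspace (mtop M)) V \<phi> L" and \<psi>: "chart_on M S V' \<psi> K" and p: "p \<in> V" "p \<in> V'"
    and D: "((\<lambda>x. \<psi> (inv_into V \<phi> x) $ i) has_derivative D) (at (\<phi> p) within \<phi> ` (V \<inter> V'))"
    and B: "transition_derivative V' \<psi> V \<phi> p B"
  shows "D (B v) = v $ i"
proof -
  have lin: "linear D" "linear B" using D B unfolding transition_derivative_def
    by (auto intro: has_derivative_linear)
  have "D \<circ> B = (\<lambda>v. v $ i)"
  proof (rule linear_eq_on_orthant)
    show "linear (D \<circ> B)" "linear (\<lambda>v :: real ^ 'b. v $ i)"
      using lin by (auto intro: linear_compose bounded_linear.linear bounded_linear_vec_nth)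
    let ?X = "\<psi> ` (V' \<inter> (S \<inter> V))"
    have injV: "inj_on \<phi> V" and injV': "inj_on \<psi> V'" using chart_on_inj \<phi> \<psi> by blast+
    have sub: "V' \<subseteq> S" by (rule chart_on_subset[OF \<psi>])
    have "((\<lambda>x. (\<lambda>y. \<psi> (inv_into V \<phi> y) $ i) (\<phi> (inv_into V' \<psi> x))) has_derivative (\<lambda>x. D (B x))) (at (\<psi> p) within ?X)"
    proof (rule has_derivative_in_compose[where f = "\<lambda>x. \<phi> (inv_into V' \<psi> x)" and f' = B
          and g = "\<lambda>y. \<psi> (inv_into V \<phi> y) $ i" and g' = D])
      show "((\<lambda>x. \<phi> (inv_into V' \<psi> x)) has_derivative B) (at (\<psi> p) within ?X)"
        using B unfolding transition_derivative_def by (rule has_derivative_subset) auto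
      have "\<phi> (inv_into V' \<psi> (\<psi> p)) = \<phi> p" using injV' p by simp
      moreover have "(\<lambda>x. \<phi> (inv_into V' \<psi> x)) ` ?X \<subseteq> \<phi> ` (V \<inter> V')" using injV' by auto
      ultimately show "((\<lambda>y. \<psi> (inv_into V \<phi> y) $ i) has_derivative D)
          (at (\<phi> (inv_into V' \<psi> (\<psi> p))) within (\<lambda>x. \<phi> (inv_into V' \<psi> x)) ` ?X)"
        using D by (auto intro: has_derivative_subset)
    qed
    then have DB: "((\<lambda>x. \<psi> (inv_into V \<phi> (\<phi> (inv_into V' \<psi> x))) $ i) has_derivative D \<circ> B) (at (\<psi> p) within ?X)"
      by (simp add: comp_def)
    fix u assume u: "u \<in> orthant (active K (\<psi> p))"
    have "ray_in ?X (\<psi> p) u"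
      by (rule ray_in_chart[OF \<psi> _ p(2) _ u]) (use p sub chart_on_Int_openin[OF \<phi>] in auto)
    then have "ray_in (?X \<inter> UNIV) (\<psi> p) u" by simp
    then show "(D \<circ> B) u = u $ i"
      by (rule derivative_unique_on_ray[OF DB has_derivative_vec_nth[OF has_derivative_ident]])
        (use injV injV' in auto)
  qed
  then show ?thesis by (metis comp_apply)
qed

text \<open>The covectors of \<open>transverse_at\<close>, written with the differentials \<open>C j\<close> of the corner charts in a
  given chart \<open>(V, \<phi>, L)\<close> of \<open>M\<close>.\<close>

definition independent_walls ::
  "('a, 'n::finite) mcorner \<Rightarrow> nat set \<Rightarrow> (nat \<Rightarrow> 'a set) \<Rightarrow> 'a \<Rightarrow> 'a set \<Rightarrow> ('a \<Rightarrow> real ^ 'n) \<Rightarrow> 'n set \<Rightarrow>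
   (nat \<Rightarrow> 'a set) \<Rightarrow> (nat \<Rightarrow> 'a \<Rightarrow> real ^ 'n) \<Rightarrow> (nat \<Rightarrow> 'n set) \<Rightarrow> bool" where
  "independent_walls M J U p V \<phi> L V' \<psi> K \<longleftrightarrow>
     (\<forall>j\<in>J. p \<in> mtop M closure_of U j \<longrightarrow>
        chart_on M (mtop M closure_of U j) (V' j) (\<psi> j) (K j) \<and> p \<in> V' j) \<and>
     (\<forall>C a b. (\<forall>j\<in>J. p \<in> mtop M closure_of U j \<longrightarrow> transition_derivative V \<phi> (V' j) (\<psi> j) p (C j)) \<longrightarrow>
        (\<forall>v. (\<Sum>l\<in>active L (\<phi> p). a l * v $ l) + (\<Sum>(j, i) \<in> {(j, i). j \<in> J \<and> p \<in> mtop M closure_of U j \<and>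
          i \<in> wall_sheets M p (V' j) (\<psi> j) (K j)}. b (j, i) * C j v $ i) = 0) \<longrightarrow>
        (\<forall>l\<in>active L (\<phi> p). a l = 0) \<and> (\<forall>j i. j \<in> J \<and> p \<in> mtop M closure_of U j \<and>
          i \<in> wall_sheets M p (V' j) (\<psi> j) (K j) \<longrightarrow> b (j, i) = 0))"

text \<open>The witnesses of \<open>transverse_at\<close> live in one chart of \<open>M\<close>. A
  relation in the given chart is pulled back by the derivative \<open>A'\<close> of the coordinate
  change: facet functionals of one chart are combinations of those of the other, because cones go to
  cones, and wall covectors correspond.\<close>

lemma transverse_at_in_chart:
  assumes M: "manifold_with_corners M" and tr: "transverse_at M J U p"
    and \<phi>: "chart_on M (topspace (mtop M)) V \<phi> L" "p \<in> V"
  obtains V' \<psi> K where "independent_walls M J U p V \<phi> L V' \<psi> K"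
proof -
  let ?S = "\<lambda>j. mtop M closure_of U j"
  obtain V1 \<phi>1 L1 V' \<psi> K D where all: "chart_on M (topspace (mtop M)) V1 \<phi>1 L1 \<and> p \<in> V1 \<and>
    (\<forall>j\<in>J. p \<in> ?S j \<longrightarrow> chart_on M (?S j) (V' j) (\<psi> j) (K j) \<and> p \<in> V' j \<and>
       (\<forall>i\<in>K j. ((\<lambda>x. \<psi> j (inv_into V1 \<phi>1 x) $ i) has_derivative D j i) (at (\<phi>1 p) within \<phi>1 ` (V1 \<inter> V' j)))) \<and>
    (let L0 = active L1 (\<phi>1 p);
         R = {(j, i). j \<in> J \<and> p \<in> ?S j \<and> i \<in> wall_sheets M p (V' j) (\<psi> j) (K j)}
     in \<forall>(a :: 'b \<Rightarrow> real) (b :: nat \<times> 'b \<Rightarrow> real).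
          (\<forall>v. (\<Sum>i\<in>L0. a i * v $ i) + (\<Sum>(j, i)\<in>R. b (j, i) * D j i v) = 0) \<longrightarrow>
          (\<forall>i\<in>L0. a i = 0) \<and> (\<forall>r\<in>R. b r = 0))"
    using tr unfolding transverse_at_def by (elim exE) (erule that)
  note \<phi>1 = all[THEN conjunct1] all[THEN conjunct2, THEN conjunct1]
    and \<psi> = all[THEN conjunct2, THEN conjunct2, THEN conjunct1, THEN bspec, THEN mp]
    and ind = all[THEN conjunct2, THEN conjunct2, THEN conjunct2]
  define R where "R = {(j, i). j \<in> J \<and> p \<in> ?S j \<and> i \<in> wall_sheets M p (V' j) (\<psi> j) (K j)}"
  obtain A' where A': "transition_derivative V1 \<phi>1 V \<phi> p A'" "linear A'"
    using transition_derivative_exists[OF M \<phi>(1) \<phi>1(1) \<phi>(2) \<phi>1(2)] by blast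
  have *: "(\<forall>l\<in>active L (\<phi> p). a l = 0) \<and> (\<forall>r\<in>R. b r = 0)"
    if C: "\<And>j. j \<in> J \<Longrightarrow> p \<in> ?S j \<Longrightarrow> transition_derivative V \<phi> (V' j) (\<psi> j) p (C j)"
      and eq: "\<And>v. (\<Sum>l\<in>active L (\<phi> p). a l * v $ l) + (\<Sum>(j, i) \<in> R. b (j, i) * C j v $ i) = 0" for C a b
  proof -
    \<comment> \<open>Both sides are known on vectors of the form \<open>B1 x\<close>, and
      \<open>B1\<close> is onto.\<close>
    have D: "D j i w = C j (A' w) $ i" if ji: "(j, i) \<in> R" for j i w
    proof -
      have j: "j \<in> J" "p \<in> ?S j" "i \<in> K j" using ji by (auto simp: R_def wall_sheets_def)
      note \<psi>j = \<psi>[OF j(1,2), THEN conjunct1] \<psi>[OF j(1,2), THEN conjunct2, THEN conjunct1]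
        \<psi>[OF j(1,2), THEN conjunct2, THEN conjunct2, THEN bspec, OF j(3)]
      obtain B1 where B1: "transition_derivative (V' j) (\<psi> j) V1 \<phi>1 p B1" "linear B1"
        using transition_derivative_exists[OF M \<phi>1(1) \<psi>j(1) \<phi>1(2) \<psi>j(2)] by blast
      obtain C1 where C1: "transition_derivative V1 \<phi>1 (V' j) (\<psi> j) p C1"
        using transition_derivative_exists[OF M \<psi>j(1) \<phi>1(1) \<psi>j(2) \<phi>1(2)] by blast
      obtain B where B: "transition_derivative (V' j) (\<psi> j) V \<phi> p B"
        using transition_derivative_exists[OF M \<phi>(1) \<psi>j(1) \<phi>(2) \<psi>j(2)] by blast
      have w: "w = B1 (C1 w)"
        using transition_derivative_inverse(2)[OF M \<phi>1(1) \<psi>j(1) \<phi>1(2) \<psi>j(2) C1 B1(1)] by (metis comp_apply id_apply)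
      have "B = A' \<circ> B1"
        by (rule transition_derivative_chain[OF M \<phi>1(1) \<phi>(1) \<psi>j(1) \<phi>1(2) \<phi>(2) \<psi>j(2) A'(1) B1(1) B])
      then have "C j (A' w) = C1 w"
        using transition_derivative_inverse(1)[OF M \<phi>(1) \<psi>j(1) \<phi>(2) \<psi>j(2) C[OF j(1,2)] B] w
        by (metis comp_apply id_apply)
      moreover have "D j i w = C1 w $ i"
        using covector_transition[OF \<phi>1(1) \<psi>j(1) \<phi>1(2) \<psi>j(2,3) B1(1), of "C1 w"] w by simp
      ultimately show ?thesis by simp
    qed
    have A'l: "A' w $ l = (\<Sum>m\<in>active L1 (\<phi>1 p). A' (axis m 1) $ l * w $ m)" if l: "l \<in> active L (\<phi> p)" for l w
    proof (rule linear_nonneg_on_orthant)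
      show "linear (\<lambda>u. A' u $ l)" using A'(2) by (auto simp: linear_iff)
      show "0 \<le> A' u $ l" if "u \<in> orthant (active L1 (\<phi>1 p))" for u
        using transition_derivative_orthant[OF M \<phi>(1) \<phi>1(1) \<phi>(2) \<phi>1(2) A'(1) that] l by (simp add: orthant_def)
    qed
    define a1 where "a1 m = (\<Sum>l\<in>active L (\<phi> p). a l * A' (axis m 1) $ l)" for m
    have "(\<Sum>m\<in>active L1 (\<phi>1 p). a1 m * w $ m) + (\<Sum>(j, i) \<in> R. b (j, i) * D j i w) = 0" for w
    proof -
      have "(\<Sum>m\<in>active L1 (\<phi>1 p). a1 m * w $ m) = (\<Sum>l\<in>active L (\<phi> p). a l * A' w $ l)"
        unfolding a1_def sum_distrib_right
        by (subst sum.swap) (auto simp: A'l sum_distrib_left mult.assoc intro!: sum.cong)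
      moreover have "(\<Sum>(j, i) \<in> R. b (j, i) * D j i w) = (\<Sum>(j, i) \<in> R. b (j, i) * C j (A' w) $ i)"
        by (rule sum.cong) (use D in auto)
      ultimately show ?thesis using eq[of "A' w"] by simp
    qed
    then have b: "\<forall>r\<in>R. b r = 0"
      using ind unfolding Let_def R_def[symmetric] by blast
    then have "(\<Sum>(j, i) \<in> R. b (j, i) * C j v $ i) = 0" for v by (auto intro!: sum.neutral)
    then have z: "(\<Sum>m\<in>active L (\<phi> p). a m * v $ m) = 0" for v using eq[of v] by simp
    have "a l = 0" if l: "l \<in> active L (\<phi> p)" for l
    proof -
      have "(\<Sum>m\<in>active L (\<phi> p). a m * axis l 1 $ m) = a l"
        using l by (simp add: axis_def if_distrib cong: if_cong)
      then show ?thesis using z by metis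
    qed
    then show ?thesis using b by blast
  qed
  have "independent_walls M J U p V \<phi> L V' \<psi> K"
    unfolding independent_walls_def R_def[symmetric]
  proof (intro conjI ballI allI impI)
    fix C a b
    assume C: "\<forall>j\<in>J. p \<in> ?S j \<longrightarrow> transition_derivative V \<phi> (V' j) (\<psi> j) p (C j)"
      and eq: "\<forall>v. (\<Sum>l\<in>active L (\<phi> p). a l * v $ l) + (\<Sum>(j, i)\<in>R. b (j, i) * C j v $ i) = 0"
    note 0 = *[of C a b, OF C[rule_format] eq[rule_format]]
    show "a l = 0" if "l \<in> active L (\<phi> p)" for l using 0 that by blast
    show "b (j, i) = 0" if "j \<in> J \<and> p \<in> ?S j \<and> i \<in> wall_sheets M p (V' j) (\<psi> j) (K j)" for j i
      using 0 that unfolding R_def by blast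
  qed (use \<psi> in auto)
  then show ?thesis by (rule that)
qed

text \<open>An exchange argument: the next covector \<open>d j\<close>, written in the coordinates
  already found, must involve one outside \<open>L\<close> and outside the slots used so far, since
  otherwise it would depend on the earlier covectors. That coordinate is replaced by
  \<open>d j\<close>.\<close>

lemma coordinate_completion:
  fixes L :: "'n::finite set" and d :: "'j \<Rightarrow> real ^ 'n \<Rightarrow> real"
  assumes "finite J" "\<And>j. j \<in> J \<Longrightarrow> linear (d j)"
    and "\<And>a b. (\<And>v. (\<Sum>l\<in>L. a l * v $ l) + (\<Sum>j\<in>J. b j * d j v) = 0) \<Longrightarrow> \<forall>j\<in>J. b j = 0"
  shows "\<exists>\<kappa> \<Lambda>. inj_on \<kappa> J \<and> \<kappa> ` J \<inter> L = {} \<and> linear \<Lambda> \<and> inj \<Lambda> \<and>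
    (\<forall>v. (\<forall>l\<in>L. \<Lambda> v $ l = v $ l) \<and> (\<forall>j\<in>J. \<Lambda> v $ \<kappa> j = d j v))"
  using assms
proof (induction J rule: finite_induct)
  case empty
  show ?case by (rule exI[of _ "\<lambda>_. undefined"], rule exI[of _ id]) (simp add: linear_iff)
next
  case (insert j J)
  have "\<exists>\<kappa> \<Lambda>. inj_on \<kappa> J \<and> \<kappa> ` J \<inter> L = {} \<and> linear \<Lambda> \<and> inj \<Lambda> \<and>
    (\<forall>v. (\<forall>l\<in>L. \<Lambda> v $ l = v $ l) \<and> (\<forall>j\<in>J. \<Lambda> v $ \<kappa> j = d j v))"
  proof (rule insert.IH)
    fix a b assume *: "\<And>v. (\<Sum>l\<in>L. a l * v $ l) + (\<Sum>j\<in>J. b j * d j v) = 0"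
    have "(\<Sum>i\<in>J. (b(j := 0)) i * d i v) = (\<Sum>i\<in>J. b i * d i v)" for v
      by (rule sum.cong) (use insert.hyps in auto)
    then have "\<forall>i\<in>insert j J. (b(j := 0)) i = 0"
      by (intro insert.prems(2)[of a]) (use insert.hyps * in simp)
    then show "\<forall>i\<in>J. b i = 0" using insert.hyps by (metis fun_upd_other insertCI)
  qed (use insert.prems in auto)
  then obtain \<kappa> \<Lambda> where \<kappa>: "inj_on \<kappa> J" "\<kappa> ` J \<inter> L = {}" and \<Lambda>: "linear \<Lambda>" "inj \<Lambda>"
    "\<And>v l. l \<in> L \<Longrightarrow> \<Lambda> v $ l = v $ l" "\<And>v i. i \<in> J \<Longrightarrow> \<Lambda> v $ \<kappa> i = d i v" by metis
  obtain \<Lambda>' where \<Lambda>': "linear \<Lambda>'" "\<And>v. \<Lambda>' (\<Lambda> v) = v"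
    using linear_injective_left_inverse[OF \<Lambda>(1,2)] by (metis comp_apply id_apply)
  define c where "c m = d j (\<Lambda>' (axis m 1))" for m
  have dj: "d j v = (\<Sum>m\<in>UNIV. c m * \<Lambda> v $ m)" for v
  proof -
    have lin: "linear (\<lambda>w. d j (\<Lambda>' w))" using linear_compose[OF \<Lambda>'(1) insert.prems(1)[of j]] by (simp add: comp_def)
    have "d j v = d j (\<Lambda>' (\<Sum>m\<in>UNIV. \<Lambda> v $ m *\<^sub>R axis m 1))"
    proof -
      have "\<Lambda> v = (\<Sum>m\<in>UNIV. \<Lambda> v $ m *\<^sub>R axis m 1)"
        by (simp add: vec_eq_iff axis_def if_distrib cong: if_cong)
      then show ?thesis using \<Lambda>'(2)[of v] by simp
    qed
    also have "\<dots> = (\<Sum>m\<in>UNIV. c m * \<Lambda> v $ m)"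
      by (simp add: linear_sum[OF lin] linear_cmul[OF lin] c_def mult.commute)
    finally show ?thesis .
  qed
  have "\<exists>m. m \<notin> L \<and> m \<notin> \<kappa> ` J \<and> c m \<noteq> 0"
  proof (rule ccontr)
    assume "\<not> ?thesis"
    then have c0: "c m = 0" if "m \<notin> L" "m \<notin> \<kappa> ` J" for m using that by blast
    have "(\<Sum>l\<in>L. c l * v $ l) + (\<Sum>i\<in>insert j J. (if i = j then - 1 else c (\<kappa> i)) * d i v) = 0" for v
    proof -
      have "d j v = (\<Sum>m\<in>L \<union> \<kappa> ` J. c m * \<Lambda> v $ m)"
        unfolding dj by (rule sum.mono_neutral_right) (use c0 in auto)
      also have "\<dots> = (\<Sum>m\<in>L. c m * \<Lambda> v $ m) + (\<Sum>m\<in>\<kappa> ` J. c m * \<Lambda> v $ m)"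
        by (rule sum.union_disjoint) (use \<kappa> in auto)
      also have "(\<Sum>m\<in>L. c m * \<Lambda> v $ m) = (\<Sum>l\<in>L. c l * v $ l)"
        by (rule sum.cong) (use \<Lambda>(3) in auto)
      also have "(\<Sum>m\<in>\<kappa> ` J. c m * \<Lambda> v $ m) = (\<Sum>i\<in>J. c (\<kappa> i) * d i v)"
        by (rule sum.reindex_cong[OF \<kappa>(1)]) (use \<Lambda>(4) in auto)
      also have "\<dots> = (\<Sum>i\<in>J. (if i = j then - 1 else c (\<kappa> i)) * d i v)"
        by (rule sum.cong) (use insert.hyps in auto)
      finally show ?thesis using insert.hyps by simp
    qed
    from insert.prems(2)[OF this] show False by simp
  qed
  then obtain m where m: "m \<notin> L" "m \<notin> \<kappa> ` J" "c m \<noteq> 0" by blast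
  let ?\<Lambda> = "\<lambda>v. \<chi> i. if i = m then d j v else \<Lambda> v $ i"
  show ?case
  proof (intro exI[of _ "\<kappa>(j := m)"] exI[of _ ?\<Lambda>] conjI allI ballI)
    show "inj_on (\<kappa>(j := m)) (insert j J)"
      using \<kappa>(1) m(2) insert.hyps by (auto simp: inj_on_def)
    show "(\<kappa>(j := m)) ` insert j J \<inter> L = {}"
      using \<kappa>(2) m insert.hyps by auto
    have ldj: "linear (d j)" using insert.prems(1) by simp
    show lin: "linear ?\<Lambda>"
      by (rule linearI) (simp_all add: vec_eq_iff linear_add[OF ldj] linear_add[OF \<Lambda>(1)]
          linear_cmul[OF ldj] linear_cmul[OF \<Lambda>(1)])
    show "inj ?\<Lambda>"
      unfolding linear_injective_0[OF lin]
    proof (intro allI impI)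
      fix v assume v: "?\<Lambda> v = 0"
      have z: "\<Lambda> v $ i = 0" if "i \<noteq> m" for i using arg_cong[OF v, of "\<lambda>x. x $ i"] that by simp
      have "0 = d j v" using arg_cong[OF v, of "\<lambda>x. x $ m"] by simp
      also have "\<dots> = (\<Sum>i\<in>{m}. c i * \<Lambda> v $ i)"
        unfolding dj by (rule sum.mono_neutral_right) (use z in auto)
      finally have "\<Lambda> v $ m = 0" using m(3) by simp
      then have "\<Lambda> v = 0" using z by (metis vec_eq_iff zero_index)
      then show "v = 0" using \<Lambda>(1,2) linear_injective_0 by blast
    qed
    show "?\<Lambda> v $ l = v $ l" if "l \<in> L" for v l using that \<Lambda>(3) m(1) by auto
    show "?\<Lambda> v $ (\<kappa>(j := m)) i = d i v" if "i \<in> insert j J" for v i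
      using that \<Lambda>(4) m(2) insert.hyps by auto
  qed
qed

section \<open>Charts adapted to a regular covering\<close>

text \<open>A ball for the supremum norm: the condition is imposed coordinate by coordinate, so it
  is preserved by sign changes and cuts convex boxes out of orthants.\<close>

definition cube :: "real \<Rightarrow> (real ^ 'n::finite) set" where
  "cube e = {x. \<forall>i. \<bar>x $ i\<bar> < e}"

lemma open_cube: "open (cube e :: (real ^ 'n::finite) set)"
proof -
  have "cube e = (\<Inter>i. {x :: real ^ 'n. \<bar>x $ i\<bar> < e})" by (auto simp: cube_def)
  then show ?thesis by (auto intro!: open_INT open_Collect_less continuous_intros)
qed

text \<open>The bound \<open>r / real CARD('n)\<close> works because the Euclidean norm is at most
  the sum of the absolute coordinates.\<close>

lemma cube_subset_open:
  assumes "open (X :: (real ^ 'n::finite) set)" "0 \<in> X"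
  obtains e where "e > 0" "cube e \<subseteq> X"
proof -
  obtain r where r: "r > 0" "ball 0 r \<subseteq> X" using assms openE by blast
  have "cube (r / real CARD('n)) \<subseteq> ball (0 :: real ^ 'n) r"
  proof
    fix x :: "real ^ 'n" assume x: "x \<in> cube (r / real CARD('n))"
    have "norm x \<le> (\<Sum>i\<in>UNIV. \<bar>x $ i\<bar>)" by (rule norm_le_l1_cart)
    also have "\<dots> < (\<Sum>i\<in>(UNIV :: 'n set). r / real CARD('n))"
      by (rule sum_strict_mono) (use x in \<open>auto simp: cube_def\<close>)
    finally show "x \<in> ball 0 r" by simp
  qed
  then show ?thesis using that[of "r / real CARD('n)"] r by fastforce
qed

text \<open>Constraints that are slack at \<open>p\<close> are dropped by shrinking the domain; the
  active ones become homogeneous after translating \<open>p\<close> to the origin, so the model is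
  again an orthant.\<close>

lemma centred_chart:
  assumes M: "manifold_with_corners M" and p: "p \<in> topspace (mtop M)"
  obtains N \<phi> L where "chart_on M (topspace (mtop M)) N \<phi> L" "p \<in> N" "\<phi> p = 0"
proof -
  obtain W \<eta> K where \<eta>: "chart_on M (topspace (mtop M)) W \<eta> K" "p \<in> W" using manifold_chart[OF M p] by metis
  define L where "L = active K (\<eta> p)"
  define X where "X = {y :: real ^ 'b. \<forall>l\<in>K - L. 0 < y $ l}"
  have "X = (\<Inter>l\<in>K - L. {x. 0 < x $ l})" by (auto simp: X_def)
  then have oX: "open X" by (auto intro!: open_INT open_Collect_less continuous_intros)
  have pX: "\<eta> p \<in> X" using chart_on_image[OF \<eta>] by (auto simp: X_def L_def less_le)
  let ?N = "{q \<in> W. \<eta> q \<in> X}"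
  obtain Z where Z: "open Z" "\<eta> ` W = orthant K \<inter> Z"
    using chart_on_openin_image[OF \<eta>(1)] by (auto simp: openin_open)
  let ?\<theta> = "\<lambda>y. y - \<eta> p" and ?\<theta>' = "\<lambda>y. y + \<eta> p"
  have d: "smooth_diffeo UNIV UNIV ?\<theta> ?\<theta>'"
  proof -
    have c: "smooth_on UNIV (\<lambda>y :: real ^ 'b. y + c)" for c
      unfolding smooth_on_def
      using cont_diff_add[OF open_UNIV cont_diff_bounded_linear[OF bounded_linear_ident] cont_diff_const] by blast
    have "homeomorphism UNIV UNIV ?\<theta> ?\<theta>'"
      unfolding homeomorphism_def by (auto simp: surj_diff_right intro!: continuous_intros)
    then show ?thesis using c[of "\<eta> p"] c[of "- \<eta> p"] by (simp add: smooth_diffeo_def)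
  qed
  have im: "?\<theta> ` \<eta> ` ?N = orthant L \<inter> {y. y + \<eta> p \<in> Z \<inter> X}"
  proof -
    have "\<eta> ` ?N = \<eta> ` W \<inter> X" by auto
    then have N: "\<eta> ` ?N = orthant K \<inter> Z \<inter> X" using Z(2) by simp
    have "y \<in> orthant K \<longleftrightarrow> y - \<eta> p \<in> orthant L" if "y \<in> X" for y
    proof
      show "y - \<eta> p \<in> orthant L" if "y \<in> orthant K" using that by (simp add: orthant_def L_def)
      show "y \<in> orthant K" if y: "y - \<eta> p \<in> orthant L"
        unfolding orthant_def
      proof clarify
        fix i assume i: "i \<in> K"
        show "0 \<le> y $ i"
        proof (cases "i \<in> L")
          case True
          then have "0 \<le> (y - \<eta> p) $ i" "\<eta> p $ i = 0" using y unfolding orthant_def L_def by blast+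
          then show ?thesis by simp
        next
          case False
          then have "0 < y $ i" using \<open>y \<in> X\<close> i unfolding X_def by blast
          then show ?thesis by simp
        qed
      qed
    qed
    then have "orthant K \<inter> Z \<inter> X = {y. y - \<eta> p \<in> orthant L} \<inter> Z \<inter> X" by blast
    moreover have "?\<theta> ` A = {y. y + \<eta> p \<in> A}" for A
    proof
      show "{y. y + \<eta> p \<in> A} \<subseteq> ?\<theta> ` A"
      proof
        fix y assume "y \<in> {y. y + \<eta> p \<in> A}"
        then have "?\<theta> (y + \<eta> p) \<in> ?\<theta> ` A" by blast
        then show "y \<in> ?\<theta> ` A" by simp
      qed
    qed auto
    ultimately show ?thesis unfolding N by auto
  qed
  have oN: "openin (mtop M) ?N" using chart_on_openin_preimage[OF \<eta>(1) oX] by simp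
  have "open {y. y + \<eta> p \<in> Z \<inter> X}"
  proof -
    have "open ((\<lambda>y. y + \<eta> p) -` (Z \<inter> X))" using Z(1) oX by (intro open_vimage continuous_intros) auto
    then show ?thesis by (simp add: vimage_def)
  qed
  then have "chart_on M (topspace (mtop M)) ?N (?\<theta> \<circ> \<eta>) L"
    by (intro chart_on_transform[OF M \<eta>(1) _ _ d]) (use oN im in \<open>auto intro!: openin_open_Int\<close>)
  then show ?thesis by (rule that) (use \<eta>(2) pX in auto)
qed

section \<open>Standing hypotheses on the covering and the local form of its members\<close>

locale regular_cover =
  fixes M :: "('a, 'n::finite) mcorner" and J :: "nat set" and U :: "nat \<Rightarrow> 'a set"
  assumes manifold: "manifold_with_corners M" and covering: "regular_covering M J U"
begin

abbreviation S :: "nat \<Rightarrow> 'a set" where "S j \<equiv> mtop M closure_of U j"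
abbreviation T :: "'a set" where "T \<equiv> topspace (mtop M)"

lemma finite_J: "finite J"
  and openin_U: "j \<in> J \<Longrightarrow> openin (mtop M) (U j)"
  and cover_U: "p \<in> T \<Longrightarrow> \<exists>j\<in>J. p \<in> U j"
  and U_interior: "j \<in> J \<Longrightarrow> U j = mtop M interior_of S j"
  and corner_S: "j \<in> J \<Longrightarrow> 2 \<le> k \<Longrightarrow> corner_point M (S j) k p \<Longrightarrow>
    corner_point M T k p \<or> corner_point M T (k - 1) p"
  and transverse: "p \<in> T \<Longrightarrow> transverse_at M J U p"
proof -
  show "finite J" using covering unfolding regular_covering_def by simp
  show "openin (mtop M) (U j)" if "j \<in> J" for j using covering that unfolding regular_covering_def by simp
  show "\<exists>j\<in>J. p \<in> U j" if "p \<in> T" for p using covering that unfolding regular_covering_def by blast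
  show "U j = mtop M interior_of S j" if "j \<in> J" for j
    using covering that unfolding regular_covering_def by blast
  show "corner_point M T k p \<or> corner_point M T (k - 1) p"
    if "j \<in> J" "2 \<le> k" "corner_point M (S j) k p" for j k p
    using covering that unfolding regular_covering_def by blast
  show "transverse_at M J U p" if "p \<in> T" for p
    using covering that unfolding regular_covering_def by blast
qed

lemma U_subset_S: "j \<in> J \<Longrightarrow> U j \<subseteq> S j"
  using closure_of_subset openin_U openin_subset by metis

lemma S_subset: "S j \<subseteq> T" by (rule closure_of_subset_topspace)

text \<open>The walls \<open>p\<close> lies on; see \<open>wall_eq_frontier\<close>.\<close>

definition walls_at :: "'a \<Rightarrow> nat set" where
  "walls_at p = {j \<in> J. p \<in> S j - U j}"

text \<open>\<open>\<kappa> j\<close> is the coordinate that defines the wall \<open>j\<close>. A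
  member whose wall misses \<open>p\<close> contains all of \<open>V\<close> or misses it, which the
  disjunct \<open>p \<in> U j\<close> records. The image is a full box of the model, so that regions
  given by signs are convex and hence connected.\<close>

definition adapted_chart ::
  "'a \<Rightarrow> 'a set \<Rightarrow> ('a \<Rightarrow> real ^ 'n) \<Rightarrow> 'n set \<Rightarrow> (nat \<Rightarrow> 'n) \<Rightarrow> real \<Rightarrow> bool" where
  "adapted_chart p V \<Phi> L \<kappa> e \<longleftrightarrow>
     chart_on M T V \<Phi> L \<and> p \<in> V \<and> \<Phi> p = 0 \<and> 0 < e \<and> \<Phi> ` V = orthant L \<inter> cube e \<and>
     inj_on \<kappa> (walls_at p) \<and> \<kappa> ` walls_at p \<inter> L = {} \<and>
     (\<forall>q\<in>V. \<forall>j\<in>J.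
        (q \<in> S j \<longleftrightarrow> p \<in> U j \<or> j \<in> walls_at p \<and> 0 \<le> \<Phi> q $ \<kappa> j) \<and>
        (q \<in> U j \<longleftrightarrow> p \<in> U j \<or> j \<in> walls_at p \<and> 0 < \<Phi> q $ \<kappa> j))"

text \<open>Where all coordinates of the corner chart \<open>\<psi>\<close> are positive, the closed set \<open>S j\<close> is also open by
  invariance of domain; as the part of a convex chart with \<open>\<Phi> $ m > 0\<close> is connected, \<open>S j\<close> fills it.\<close>

lemma closure_in_adapted_chart:
  assumes \<Phi>: "chart_on M T V \<Phi> L" "p \<in> V" "\<Phi> p = 0" "0 < e" "\<Phi> ` V = orthant L \<inter> cube e"
    and j: "j \<in> J" and \<psi>: "chart_on M (S j) V' \<psi> K" "p \<in> V'"
    and sub: "V \<inter> S j \<subseteq> V'" and W: "W \<subseteq> active K (\<psi> p)" and m: "m \<inter> L = {}"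
    and inactive: "\<And>q i. q \<in> V \<inter> S j \<Longrightarrow> i \<in> K - active K (\<psi> p) \<Longrightarrow> 0 < \<psi> q $ i"
    and boundary: "\<And>q i. q \<in> V \<inter> S j \<Longrightarrow> q \<in> Int_mf M \<Longrightarrow> i \<in> active K (\<psi> p) - W \<Longrightarrow> \<psi> q $ i \<noteq> 0"
    and wall_pos: "\<And>q i. q \<in> V \<inter> S j \<Longrightarrow> \<forall>k\<in>m. 0 < \<Phi> q $ k \<Longrightarrow> i \<in> W \<Longrightarrow> 0 < \<psi> q $ i"
    and wall_nonneg: "\<And>q k. q \<in> V \<inter> S j \<Longrightarrow> k \<in> m \<Longrightarrow> 0 \<le> \<Phi> q $ k"
    and wall_pos': "\<And>q k. q \<in> V \<inter> S j \<Longrightarrow> \<forall>i\<in>W. 0 < \<psi> q $ i \<Longrightarrow> k \<in> m \<Longrightarrow> 0 < \<Phi> q $ k"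
    and q: "q \<in> V"
  shows "q \<in> S j \<longleftrightarrow> (\<forall>k\<in>m. 0 \<le> \<Phi> q $ k)" "q \<in> U j \<longleftrightarrow> (\<forall>k\<in>m. 0 < \<Phi> q $ k)"
proof -
  have inj: "inj_on \<Phi> V" by (rule chart_on_inj[OF \<Phi>(1)])
  have oV: "openin (mtop M) V" using chart_on_openin[OF \<Phi>(1)] by simp
  have pS: "p \<in> S j" using \<psi> chart_on_subset by blast
  have interior: "q' \<in> Int_mf M \<longleftrightarrow> (\<forall>l\<in>L. 0 < \<Phi> q' $ l)" if "q' \<in> V" for q'
    using mf_interior_chart[OF \<Phi>(1) that] chart_on_image[OF \<Phi>(1) that] by (auto simp: less_le)
  \<comment> \<open>The part of the box off all boundary facets and on the positive side of the
    coordinates in \<open>m\<close>; in the application \<open>m\<close> is empty or a single wall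
    coordinate.\<close>
  define X where "X = (cube e \<inter> {x :: real ^ 'n. \<forall>k\<in>L \<union> m. 0 < x $ k})"
  have oX: "open X"
  proof -
    have "X = cube e \<inter> (\<Inter>k\<in>L \<union> m. {x. 0 < x $ k})" by (auto simp: X_def)
    then show ?thesis using open_cube
      by (auto intro!: open_Int open_INT open_Collect_less continuous_intros)
  qed
  have XV: "X \<subseteq> \<Phi> ` V" unfolding \<Phi>(5) by (auto simp: X_def orthant_def less_imp_le)
  have conv: "convex X"
  proof -
    have vim: "convex ((\<lambda>x :: real ^ 'n. x $ k) -` I)" if "convex I" for k I
      by (rule convex_linear_vimage[OF bounded_linear.linear[OF bounded_linear_vec_nth] that])
    have "convex {x :: real ^ 'n. 0 < x $ k}" for k
      using vim[of "{0<..}" k] by (simp add: vimage_def)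
    moreover have "convex {x :: real ^ 'n. \<bar>x $ k\<bar> < e}" for k
      using vim[of "ball 0 e" k] by (simp add: vimage_def)
    moreover have "X = (\<Inter>i. {x. \<bar>x $ i\<bar> < e}) \<inter> (\<Inter>k\<in>L \<union> m. {x. 0 < x $ k})"
      by (auto simp: X_def cube_def)
    ultimately show ?thesis by (auto intro!: convex_Int convex_INT)
  qed
  define Q where "Q = {q \<in> V. \<Phi> q \<in> X}"
  have oQ: "openin (mtop M) Q" using chart_on_openin_preimage[OF \<Phi>(1) oX] by (simp add: Q_def)
  have QX: "\<Phi> ` Q = X" using XV by (auto simp: Q_def)
  \<comment> \<open>No coordinate of \<open>\<psi>\<close> in \<open>K\<close> vanishes at such a
    point, so it is interior to \<open>S j\<close> and lies in \<open>U j\<close>.\<close>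
  have QS: "Q \<inter> S j = Q \<inter> U j"
  proof
    show "Q \<inter> S j \<subseteq> Q \<inter> U j"
    proof
      fix q' assume q': "q' \<in> Q \<inter> S j"
      then have V: "q' \<in> V \<inter> S j" and X: "\<Phi> q' \<in> X" by (auto simp: Q_def)
      have int: "q' \<in> Int_mf M" using interior[of q'] V X by (auto simp: X_def)
      have "\<psi> q' $ i \<noteq> 0" if i: "i \<in> K" for i
      proof -
        consider "i \<in> K - active K (\<psi> p)" | "i \<in> active K (\<psi> p) - W" | "i \<in> W" using i by blast
        then show ?thesis
        proof cases
          case 1 then show ?thesis using inactive[OF V] by fastforce
        next
          case 2 then show ?thesis by (rule boundary[OF V int])
        next
          case 3 then show ?thesis using wall_pos[OF V _ 3] X by (force simp: X_def)
        qed
      qed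
      then have "q' \<in> mf_interior M (S j)" using mf_interior_chart[OF \<psi>(1)] sub V by blast
      then show "q' \<in> Q \<inter> U j" using mf_interior_open(1)[OF manifold] U_interior[OF j] q' by blast
    qed
  qed (use U_subset_S[OF j] in blast)
  have oim: "openin (top_of_set X) (\<Phi> ` A)" if "openin (mtop M) A" "A \<subseteq> Q" for A
  proof -
    have "openin (subtopology (mtop M) V) A" using that oV
      by (metis (no_types, lifting) Q_def mem_Collect_eq openin_open_subtopology subset_eq)
    then have "openin (top_of_set (\<Phi> ` V)) (\<Phi> ` A)"
      using chart_on_openness[OF \<Phi>(1), of A] that(2) by (auto simp: Q_def)
    then show ?thesis using openin_subset_trans[OF _ _ XV] that(2) QX by blast
  qed
  have QinS: "Q \<subseteq> S j"
  proof -
    have "openin (top_of_set X) (\<Phi> ` (Q \<inter> U j))" by (rule oim) (use oQ openin_U[OF j] in auto)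
    moreover have "closedin (top_of_set X) (\<Phi> ` (Q \<inter> U j))"
    proof -
      have "openin (mtop M) (Q - S j)" using oQ by (simp add: openin_diff)
      then have "openin (top_of_set X) (\<Phi> ` (Q - S j))" by (rule oim) auto
      moreover have "X - \<Phi> ` (Q \<inter> U j) = \<Phi> ` (Q - S j)"
      proof -
        have "\<Phi> ` (Q - Q \<inter> U j) = \<Phi> ` Q - \<Phi> ` (Q \<inter> U j)"
          by (rule inj_on_image_set_diff[OF inj]) (auto simp: Q_def)
        moreover have "Q - Q \<inter> U j = Q - S j" using QS by blast
        ultimately show ?thesis using QX by simp
      qed
      ultimately show ?thesis unfolding closedin_def using QX by auto
    qed
    ultimately have "\<Phi> ` (Q \<inter> U j) = {} \<or> \<Phi> ` (Q \<inter> U j) = X"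
      using convex_connected[OF conv] unfolding connected_clopen by blast
    \<comment> \<open>The diagonal direction in the corner chart leads into the interior of
      \<open>S j\<close>, hence of \<open>M\<close>, and to the positive side of the wall.\<close>
    moreover have "Q \<inter> S j \<noteq> {}"
    proof -
      define u :: "real ^ 'n" where "u = (\<chi> i. 1)"
      have u: "u \<in> orthant (active K (\<psi> p))" by (simp add: u_def orthant_def)
      have "ray_in (\<psi> ` (V' \<inter> (S j \<inter> V))) (\<psi> p) u"
        by (rule ray_in_chart[OF \<psi>(1) chart_on_Int_openin[OF \<Phi>(1)] \<psi>(2) _ u]) (use pS \<Phi> in auto)
      then obtain t where t: "0 < t" "\<psi> p + t *\<^sub>R u \<in> \<psi> ` (V' \<inter> (S j \<inter> V))"
        unfolding ray_in_def by (metis less_imp_le order_refl)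
      then obtain q' where q': "q' \<in> V'" "q' \<in> S j" "q' \<in> V" "\<psi> p + t *\<^sub>R u = \<psi> q'" by blast
      have pos: "0 < \<psi> q' $ i" if "i \<in> K" for i
        unfolding q'(4)[symmetric] using chart_on_image[OF \<psi> that] t(1) by (simp add: u_def add_nonneg_pos)
      then have "q' \<in> mf_interior M (S j)" using mf_interior_chart[OF \<psi>(1) q'(1)] by force
      then have "q' \<in> Int_mf M" by (rule mf_interior_open(2)[OF manifold])
      then have "\<forall>l\<in>L. 0 < \<Phi> q' $ l" using interior q'(3) by blast
      moreover have "0 < \<Phi> q' $ k" if "k \<in> m" for k
        by (rule wall_pos'[OF _ _ that]) (use q' pos W in auto)
      moreover have "\<Phi> q' \<in> cube e" using \<Phi>(5) q'(3) by blast
      ultimately have "q' \<in> Q" using q'(3) by (auto simp: Q_def X_def)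
      then show ?thesis using q'(2) by blast
    qed
    ultimately have "\<Phi> ` (Q \<inter> U j) = X" using QS by auto
    then have "\<Phi> ` (Q \<inter> U j) = \<Phi> ` Q" using QX by simp
    then have "Q \<inter> U j = Q" using inj inj_on_image_eq_iff[OF inj, of "Q \<inter> U j" Q] by (auto simp: Q_def)
    then show ?thesis using QS by blast
  qed
  \<comment> \<open>Perturbation within an open set \<open>A\<close>, used to push points into
    \<open>Q\<close> or across a wall.\<close>
  have move: "\<exists>q'\<in>V. q' \<in> A \<and> (\<exists>t>0. \<Phi> q' = \<Phi> q + t *\<^sub>R u)"
    if A: "openin (mtop M) A" "q \<in> A" and u: "u \<in> orthant L" and qV: "q \<in> V" for A q u
  proof -
    have "ray_in (\<Phi> ` (V \<inter> A)) (\<Phi> q) u"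
      by (rule ray_in_chart[OF \<Phi>(1)]) (use that in \<open>auto simp: orthant_def\<close>)
    then obtain t where "0 < t" "\<Phi> q + t *\<^sub>R u \<in> \<Phi> ` (V \<inter> A)"
      unfolding ray_in_def by (metis less_imp_le order_refl)
    then show ?thesis by (metis IntD1 IntD2 imageE)
  qed
  have oTS: "openin (mtop M) (T - S j)" by (simp add: openin_diff)
  have one: "(\<chi> i. 1) \<in> orthant L" by (simp add: orthant_def)
  show S: "q \<in> S j \<longleftrightarrow> (\<forall>k\<in>m. 0 \<le> \<Phi> q $ k)"
  proof
    assume "q \<in> S j"
    then show "\<forall>k\<in>m. 0 \<le> \<Phi> q $ k" using wall_nonneg q by blast
  next
    assume nn: "\<forall>k\<in>m. 0 \<le> \<Phi> q $ k"
    show "q \<in> S j"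
    proof (rule ccontr)
      assume "q \<notin> S j"
      then have "q \<in> T - S j" using q chart_on_subset[OF \<Phi>(1)] by blast
      then obtain q' t where q': "q' \<in> V" "q' \<in> T - S j" "0 < t" "\<Phi> q' = \<Phi> q + t *\<^sub>R (\<chi> i. 1)"
        using move[OF oTS _ one q] by blast
      have "0 < \<Phi> q' $ k" if "k \<in> L \<union> m" for k
        using that nn chart_on_image[OF \<Phi>(1) q] q'(3) unfolding q'(4) by (auto simp: add_nonneg_pos)
      moreover have "\<Phi> q' \<in> cube e" using \<Phi>(5) q'(1) by blast
      ultimately have "q' \<in> Q" using q'(1) by (auto simp: Q_def X_def)
      then show False using QinS q'(2) by blast
    qed
  qed
  show "q \<in> U j \<longleftrightarrow> (\<forall>k\<in>m. 0 < \<Phi> q $ k)"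
  proof
    assume qU: "q \<in> U j"
    show "\<forall>k\<in>m. 0 < \<Phi> q $ k"
    proof (rule ballI, rule ccontr)
      fix k assume k: "k \<in> m" "\<not> 0 < \<Phi> q $ k"
      \<comment> \<open>A move against axis \<open>k\<close> is allowed because \<open>k\<close> is
        not in \<open>L\<close>; it would produce a point of \<open>S j\<close> with negative
        coordinate \<open>k\<close>.\<close>
      have "- axis k 1 \<in> orthant L" using m k by (auto simp: orthant_def axis_def)
      then obtain q' t where q': "q' \<in> V" "q' \<in> U j" "0 < t" "\<Phi> q' = \<Phi> q + t *\<^sub>R (- axis k 1)"
        using move[OF openin_U[OF j] qU _ q] by blast
      then have "0 \<le> \<Phi> q' $ k" using wall_nonneg[OF _ k(1)] U_subset_S[OF j] by blast
      then show False using k(2) q'(3) unfolding q'(4) by simp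
    qed
  next
    assume pos: "\<forall>k\<in>m. 0 < \<Phi> q $ k"
    have "{x :: real ^ 'n. \<forall>k\<in>m. 0 < x $ k} = (\<Inter>k\<in>m. {x. 0 < x $ k})" by auto
    then have om: "open {x :: real ^ 'n. \<forall>k\<in>m. 0 < x $ k}"
      by (auto intro!: open_INT open_Collect_less continuous_intros)
    have "openin (mtop M) {q \<in> V. \<Phi> q \<in> {x. \<forall>k\<in>m. 0 < x $ k}}"
      using chart_on_openin_preimage[OF \<Phi>(1) om] by simp
    moreover have "q' \<in> S j" if q': "q' \<in> V" "\<forall>k\<in>m. 0 < \<Phi> q' $ k" for q'
    proof (rule ccontr)
      assume "q' \<notin> S j"
      then have "q' \<in> T - S j" using q' chart_on_subset[OF \<Phi>(1)] by blast
      then obtain r t where r: "r \<in> V" "r \<in> T - S j" "0 < t" "\<Phi> r = \<Phi> q' + t *\<^sub>R (\<chi> i. 1)"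
        using move[OF oTS _ one q'(1)] by blast
      have "0 < \<Phi> r $ k" if "k \<in> L \<union> m" for k
        using that q' chart_on_image[OF \<Phi>(1) q'(1)] r(3) unfolding r(4) by (auto simp: add_nonneg_pos less_imp_le)
      moreover have "\<Phi> r \<in> cube e" using \<Phi>(5) r(1) by blast
      ultimately have "r \<in> Q" using r(1) by (auto simp: Q_def X_def)
      then show False using QinS r(2) by blast
    qed
    ultimately have "q \<in> mtop M interior_of S j"
      unfolding interior_of_def using pos q by (auto intro!: exI[of _ "{q \<in> V. \<Phi> q \<in> {x. \<forall>k\<in>m. 0 < x $ k}}"])
    then show "q \<in> U j" using U_interior[OF j] by blast
  qed
qed

text \<open>The sheets at \<open>p\<close> number the corner codimension in \<open>S j\<close> minus
  that in \<open>M\<close>. From codimension two on the covering condition makes this zero or one;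
  below that the codimension itself is at most one.\<close>

lemma card_wall_sheets_le_1:
  assumes \<phi>: "chart_on M T N \<phi> L" "p \<in> N"
    and iw: "independent_walls M J U p N \<phi> L V' \<psi> K"
    and j: "j \<in> J" "p \<in> S j"
  shows "card (wall_sheets M p (V' j) (\<psi> j) (K j)) \<le> 1"
proof -
  note \<psi> = iw[unfolded independent_walls_def, THEN conjunct1, rule_format, THEN conjunct1]
      iw[unfolded independent_walls_def, THEN conjunct1, rule_format, THEN conjunct2]
    and indep = iw[unfolded independent_walls_def, THEN conjunct2, rule_format]
  let ?W = "\<lambda>j. wall_sheets M p (V' j) (\<psi> j) (K j)"
  let ?R = "{(j, i). j \<in> J \<and> p \<in> S j \<and> i \<in> ?W j}"
  have "\<forall>j. \<exists>C. j \<in> J \<and> p \<in> S j \<longrightarrow> transition_derivative N \<phi> (V' j) (\<psi> j) p C"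
    using transition_derivative_exists[OF manifold \<psi>(1) \<phi>(1) \<psi>(2) \<phi>(2)] by metis
  then obtain C where C: "\<And>j. j \<in> J \<Longrightarrow> p \<in> S j \<Longrightarrow> transition_derivative N \<phi> (V' j) (\<psi> j) p (C j)" by metis
  obtain B where B: "transition_derivative (V' j) (\<psi> j) N \<phi> p B" "linear B"
    using transition_derivative_exists[OF manifold \<phi>(1) \<psi>(1)[OF j] \<phi>(2) \<psi>(2)[OF j]] by metis
  have finR: "finite ?R" by (rule finite_subset[of _ "J \<times> UNIV"]) (use finite_J in auto)
  let ?A = "active (K j) (\<psi> j p)"
  have "card ?A = card (?W j) + card (active L (\<phi> p))"
  proof (rule card_facets_of_subcone[OF B(2)])
    show "linear (C j)" using C[OF j] unfolding transition_derivative_def by (rule has_derivative_linear)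
    show "C j \<circ> B = id" "B \<circ> C j = id"
      by (rule transition_derivative_inverse[OF manifold \<phi>(1) \<psi>(1)[OF j] \<phi>(2) \<psi>(2)[OF j] C[OF j] B(1)])+
    show "?W j \<subseteq> ?A" by (rule wall_sheets_active[OF \<psi>(1)[OF j] \<psi>(2)[OF j]])
    show "B u \<in> orthant (active L (\<phi> p))" if "u \<in> orthant ?A" for u
      by (rule transition_derivative_orthant[OF manifold \<phi>(1) \<psi>(1)[OF j] \<phi>(2) \<psi>(2)[OF j] B(1) that])
    show "\<exists>l\<in>active L (\<phi> p). \<forall>u. u $ i = 0 \<longrightarrow> B u $ l = 0" if "i \<in> ?A - ?W j" for i
      by (rule boundary_sheet_in_facet[OF manifold \<phi>(1) \<psi>(1)[OF j] \<phi>(2) \<psi>(2)[OF j] B(1)]) (use that in auto)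
    fix a b assume eq: "\<And>v. (\<Sum>l\<in>active L (\<phi> p). a l * v $ l) + (\<Sum>i\<in>?W j. b i * C j v $ i) = 0"
    \<comment> \<open>Extension by zero to the other members, so that the joint independence of all
      walls applies to the single index \<open>j\<close>.\<close>
    define b' where "b' = (\<lambda>(j', i). if j' = j then b i else 0)"
    have sumR: "(\<Sum>(j', i) \<in> ?R. b' (j', i) * C j' v $ i) = (\<Sum>i\<in>?W j. b i * C j v $ i)" for v
    proof -
      have "(\<Sum>(j', i) \<in> ?R. b' (j', i) * C j' v $ i) = (\<Sum>(j', i) \<in> {j} \<times> ?W j. b' (j', i) * C j' v $ i)"
        by (rule sum.mono_neutral_right[OF finR]) (use j in \<open>auto simp: b'_def split: if_splits\<close>)
      also have "\<dots> = (\<Sum>i\<in>?W j. b i * C j v $ i)"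
        by (subst sum.cartesian_product[symmetric]) (simp add: b'_def)
      finally show ?thesis .
    qed
    have "\<forall>v. (\<Sum>l\<in>active L (\<phi> p). a l * v $ l) + (\<Sum>(j', i) \<in> ?R. b' (j', i) * C j' v $ i) = 0"
      unfolding sumR using eq by blast
    moreover have "\<forall>j\<in>J. p \<in> S j \<longrightarrow> transition_derivative N \<phi> (V' j) (\<psi> j) p (C j)" using C by blast
    ultimately show "\<forall>l\<in>active L (\<phi> p). a l = 0"
      using iw[unfolded independent_walls_def, THEN conjunct2, THEN spec, of C, THEN spec, of a, THEN spec, of b']
      by blast
  qed
  moreover have "corner_point M (S j) (card ?A) p"
    unfolding corner_point_def using \<psi>[OF j] by blast
  moreover have "k = card (active L (\<phi> p))" if "corner_point M T k p" for k
    using that unfolding corner_point_def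
    by (elim exE conjE) (drule (1) card_active_unique[OF manifold \<phi>], simp)
  ultimately have "2 \<le> card ?A \<Longrightarrow> card ?A = card (active L (\<phi> p)) \<or> card ?A - 1 = card (active L (\<phi> p))"
    and "card ?A = card (?W j) + card (active L (\<phi> p))"
    using corner_S[OF j(1), of "card ?A" p] by blast+
  then show ?thesis by linarith
qed

text \<open>By the inverse function theorem the wall functions can be taken as coordinates.\<close>

theorem adapted_chart_exists:
  assumes \<phi>: "chart_on M T N \<phi> L" "p \<in> N" "\<phi> p = 0"
  obtains V \<Phi> \<kappa> e where "V \<subseteq> N" "adapted_chart p V \<Phi> L \<kappa> e"
proof -
  have pT: "p \<in> T" using chart_on_subset[OF \<phi>(1)] \<phi>(2) by blast
  have act: "active L (\<phi> p) = L" using \<phi>(3) by simp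
  have injN: "inj_on \<phi> N" by (rule chart_on_inj[OF \<phi>(1)])
  obtain V' \<psi> K where iw: "independent_walls M J U p N \<phi> L V' \<psi> K"
    using transverse_at_in_chart[OF manifold transverse[OF pT] \<phi>(1,2)] by metis
  note \<psi> = iw[unfolded independent_walls_def, THEN conjunct1, rule_format, THEN conjunct1]
      iw[unfolded independent_walls_def, THEN conjunct1, rule_format, THEN conjunct2]
    and indep = iw[unfolded independent_walls_def, THEN conjunct2, rule_format]
  define W where "W j = wall_sheets M p (V' j) (\<psi> j) (K j)" for j
  have Wact: "W j \<subseteq> active (K j) (\<psi> j p)" if "j \<in> J" "p \<in> S j" for j
    unfolding W_def by (rule wall_sheets_active[OF \<psi>(1)[OF that] \<psi>(2)[OF that]])
  \<comment> \<open>The indices with an actual wall sheet at \<open>p\<close>; they are identified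
    with \<open>walls_at p\<close> only after the chart is built.\<close>
  define Jw where "Jw = {j \<in> J. p \<in> S j \<and> W j \<noteq> {}}"
  have "\<exists>i. W j = {i}" if "j \<in> Jw" for j
  proof -
    have "card (W j) \<le> 1"
      unfolding W_def by (rule card_wall_sheets_le_1[OF \<phi>(1,2) iw]) (use that in \<open>auto simp: Jw_def\<close>)
    moreover have "card (W j) \<noteq> 0" using that by (simp add: Jw_def)
    ultimately have "card (W j) = 1" by linarith
    then show ?thesis by (rule card_1_singletonE) blast
  qed
  then obtain w where w: "\<And>j. j \<in> Jw \<Longrightarrow> W j = {w j}" by metis
  have JwJ: "j \<in> J" "p \<in> S j" if "j \<in> Jw" for j using that by (auto simp: Jw_def)
  have finJw: "finite Jw" using finite_J by (simp add: Jw_def)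
  \<comment> \<open>Each corner chart is extended smoothly beyond \<open>S j\<close>; the pair holds
    the extension and its open domain.\<close>
  have "\<forall>j\<in>{j \<in> J. p \<in> S j}. \<exists>H. open (snd H) \<and> 0 \<in> snd H \<and> smooth_on (snd H) (fst H) \<and>
    (\<forall>y \<in> snd H \<inter> \<phi> ` (V' j \<inter> N). fst H y = \<psi> j (inv_into N \<phi> y))"
  proof clarify
    fix j assume j: "j \<in> J" "p \<in> S j"
    have "smooth_ext (\<phi> ` (V' j \<inter> N)) (\<lambda>y. \<psi> j (inv_into N \<phi> y))"
      by (rule smooth_fun_in_chart[OF manifold chart_on_smooth[OF \<psi>(1)[OF j]] \<phi>(1)])
    moreover have "0 \<in> \<phi> ` (V' j \<inter> N)" using \<phi>(2,3) \<psi>(2)[OF j] by (metis IntI imageI)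
    ultimately obtain Q G where "open Q" "0 \<in> Q" "smooth_on Q G"
      "\<forall>y \<in> Q \<inter> \<phi> ` (V' j \<inter> N). G y = \<psi> j (inv_into N \<phi> y)" unfolding smooth_ext_def by blast
    then show "\<exists>H. open (snd H) \<and> 0 \<in> snd H \<and> smooth_on (snd H) (fst H) \<and>
      (\<forall>y \<in> snd H \<inter> \<phi> ` (V' j \<inter> N). fst H y = \<psi> j (inv_into N \<phi> y))"
      by (intro exI[of _ "(G, Q)"]) simp
  qed
  from bchoice[OF this] obtain H where H: "\<forall>j\<in>{j \<in> J. p \<in> S j}. open (snd (H j)) \<and> 0 \<in> snd (H j) \<and>
    smooth_on (snd (H j)) (fst (H j)) \<and> (\<forall>y \<in> snd (H j) \<inter> \<phi> ` (V' j \<inter> N). fst (H j) y = \<psi> j (inv_into N \<phi> y))"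
    by blast
  define G Q where "G j = fst (H j)" and "Q j = snd (H j)" for j
  have GQ: "open (Q j)" "0 \<in> Q j" "smooth_on (Q j) (G j)"
    "\<And>y. y \<in> Q j \<inter> \<phi> ` (V' j \<inter> N) \<Longrightarrow> G j y = \<psi> j (inv_into N \<phi> y)"
    if "j \<in> J" "p \<in> S j" for j
    using H that unfolding G_def Q_def by blast+
  define C where "C j = frechet_derivative (G j) (at 0)" for j
  have Cd: "(G j has_derivative C j) (at 0)" if "j \<in> J" "p \<in> S j" for j
    unfolding C_def by (rule smooth_on_has_derivative[OF GQ(3)[OF that] GQ(2)[OF that]])
  have C: "transition_derivative N \<phi> (V' j) (\<psi> j) p (C j)" if "j \<in> J" "p \<in> S j" for j
    unfolding transition_derivative_def \<phi>(3) C_def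
    by (rule extension_has_derivative[OF GQ(1-3)[OF that] GQ(4)[OF that]]) (assumption, rule image_eqI[of _ _ p], use \<phi>(2,3) \<psi>(2)[OF that] in auto)
  have lin: "linear (\<lambda>v. C j v $ w j)" if "j \<in> Jw" for j
    using has_derivative_linear[OF has_derivative_vec_nth[OF Cd[OF JwJ[OF that]]]] .
  have "\<exists>\<kappa> \<Lambda>. inj_on \<kappa> Jw \<and> \<kappa> ` Jw \<inter> L = {} \<and> linear \<Lambda> \<and> inj \<Lambda> \<and>
    (\<forall>v. (\<forall>l\<in>L. \<Lambda> v $ l = v $ l) \<and> (\<forall>j\<in>Jw. \<Lambda> v $ \<kappa> j = C j v $ w j))"
  proof (rule coordinate_completion[OF finJw lin])
    fix a b assume eq: "\<And>v. (\<Sum>l\<in>L. a l * v $ l) + (\<Sum>j\<in>Jw. b j * C j v $ w j) = 0"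
    define b' where "b' = (\<lambda>(j :: nat, i :: 'n). b j)"
    have R: "{(j, i). j \<in> J \<and> p \<in> S j \<and> i \<in> wall_sheets M p (V' j) (\<psi> j) (K j)} = (\<lambda>j. (j, w j)) ` Jw"
      unfolding W_def[symmetric] using w by (auto simp: Jw_def)
    have sumR: "(\<Sum>(j, i) \<in> (\<lambda>j. (j, w j)) ` Jw. b' (j, i) * C j v $ i) = (\<Sum>j\<in>Jw. b j * C j v $ w j)" for v
      by (subst sum.reindex) (auto simp: inj_on_def b'_def)
    have "\<forall>v. (\<Sum>l\<in>L. a l * v $ l) + (\<Sum>(j, i) \<in> (\<lambda>j. (j, w j)) ` Jw. b' (j, i) * C j v $ i) = 0"
      unfolding sumR using eq by blast
    moreover have "\<forall>j\<in>J. p \<in> S j \<longrightarrow> transition_derivative N \<phi> (V' j) (\<psi> j) p (C j)" using C by blast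
    ultimately have "\<forall>j i. j \<in> J \<and> p \<in> S j \<and> i \<in> wall_sheets M p (V' j) (\<psi> j) (K j) \<longrightarrow> b' (j, i) = 0"
      using iw[unfolded independent_walls_def, THEN conjunct2, THEN spec, of C, THEN spec, of a, THEN spec, of b']
      unfolding R act by blast
    then show "\<forall>j\<in>Jw. b j = 0" unfolding W_def[symmetric] by (auto simp: Jw_def b'_def)
  qed
  then obtain \<kappa> \<Lambda> where \<kappa>: "inj_on \<kappa> Jw" "\<kappa> ` Jw \<inter> L = {}" and \<Lambda>: "linear \<Lambda>" "inj \<Lambda>"
    "\<And>v l. l \<in> L \<Longrightarrow> \<Lambda> v $ l = v $ l" "\<And>v j. j \<in> Jw \<Longrightarrow> \<Lambda> v $ \<kappa> j = C j v $ w j" by metis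
  \<comment> \<open>The slots \<open>\<kappa> j\<close> carry the extended wall functions and the
    others the linear coordinates from the completion, so the derivative at the origin is
    \<open>\<Lambda>\<close> and the coordinates in \<open>L\<close> are unchanged.\<close>
  define \<Theta> where "\<Theta> y = (\<chi> i. if i \<in> \<kappa> ` Jw then G (inv_into Jw \<kappa> i) y $ w (inv_into Jw \<kappa> i) else \<Lambda> y $ i)" for y
  have \<Theta>\<kappa>: "\<Theta> y $ \<kappa> j = G j y $ w j" if "j \<in> Jw" for y j using that \<kappa>(1) by (simp add: \<Theta>_def)
  have \<Theta>L: "\<Theta> y $ l = y $ l" if "l \<in> L" for y l using that \<kappa>(2) \<Lambda>(3) by (auto simp: \<Theta>_def)
  define Q0 where "Q0 = (\<Inter>j\<in>Jw. Q j)"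
  have Q0: "open Q0" "0 \<in> Q0"
    unfolding Q0_def using finJw GQ(1,2) JwJ by auto
  have \<Lambda>bl: "bounded_linear \<Lambda>" using \<Lambda>(1) linear_conv_bounded_linear by blast
  have smooth\<Theta>: "smooth_on Q0 \<Theta>"
  proof (rule smooth_on_vec[OF Q0(1)])
    fix i show "smooth_on Q0 (\<lambda>y. \<Theta> y $ i)"
    proof (cases "i \<in> \<kappa> ` Jw")
      case True
      then obtain j where j: "j \<in> Jw" "i = \<kappa> j" by blast
      have "smooth_on Q0 (G j)" by (rule smooth_on_subset[OF GQ(3)[OF JwJ[OF j(1)]]]) (use j in \<open>auto simp: Q0_def\<close>)
      then show ?thesis using smooth_on_vec_nth[OF Q0(1)] by (simp add: j \<Theta>\<kappa>)
    next
      case False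
      then show ?thesis
        using smooth_on_vec_nth[OF Q0(1) smooth_on_bounded_linear[OF \<Lambda>bl]] by (simp add: \<Theta>_def)
    qed
  qed
  have \<Theta>der: "frechet_derivative \<Theta> (at 0) = \<Lambda>"
  proof -
    have D: "(\<Theta> has_derivative frechet_derivative \<Theta> (at 0)) (at 0)"
      by (rule smooth_on_has_derivative[OF smooth\<Theta> Q0(2)])
    have "frechet_derivative \<Theta> (at 0) v $ i = \<Lambda> v $ i" for v i
    proof (cases "i \<in> \<kappa> ` Jw")
      case True
      then obtain j where j: "j \<in> Jw" "i = \<kappa> j" by blast
      have "((\<lambda>y. G j y $ w j) has_derivative (\<lambda>v. frechet_derivative \<Theta> (at 0) v $ i)) (at 0)"
        using has_derivative_vec_nth[OF D, of i] by (simp add: j \<Theta>\<kappa>)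
      from has_derivative_unique[OF this has_derivative_vec_nth[OF Cd[OF JwJ[OF j(1)]]]]
      show ?thesis using j \<Lambda>(4) by (metis (no_types))
    next
      case False
      then have "((\<lambda>y. \<Lambda> y $ i) has_derivative (\<lambda>v. frechet_derivative \<Theta> (at 0) v $ i)) (at 0)"
        using has_derivative_vec_nth[OF D, of i] by (simp add: \<Theta>_def)
      from has_derivative_unique[OF this has_derivative_vec_nth[OF bounded_linear_imp_has_derivative[OF \<Lambda>bl]]]
      show ?thesis by metis
    qed
    then show ?thesis by (simp add: fun_eq_iff vec_eq_iff)
  qed
  obtain X Y \<Theta>' where XY: "X \<subseteq> Q0" "0 \<in> X" "smooth_diffeo X Y \<Theta> \<Theta>'"
    using smooth_inverse_function_theorem[OF Q0(1) smooth\<Theta> Q0(2)] \<Lambda>(2) \<Theta>der by metis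
  have hom: "homeomorphism X Y \<Theta> \<Theta>'" and oX: "open X" and oY: "open Y" using XY(3) by (auto simp: smooth_diffeo_def)
  have \<Theta>0: "\<Theta> 0 = 0"
  proof -
    have "\<Theta> 0 $ i = 0" for i
    proof (cases "i \<in> \<kappa> ` Jw")
      case True
      then obtain j where j: "j \<in> Jw" "i = \<kappa> j" by blast
      have "0 \<in> Q j \<inter> \<phi> ` (V' j \<inter> N)" using GQ(2) JwJ[OF j(1)] \<psi>(2) \<phi>(2,3) by (metis IntI imageI)
      then have "G j 0 = \<psi> j p" using GQ(4)[OF JwJ[OF j(1)]] injN \<phi>(2,3) by (metis inv_into_f_f)
      moreover have "w j \<in> active (K j) (\<psi> j p)" using Wact[OF JwJ[OF j(1)]] w[OF j(1)] by blast
      ultimately show ?thesis by (simp add: j \<Theta>\<kappa>)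
    next
      case False
      then show ?thesis by (simp add: \<Theta>_def linear_0[OF \<Lambda>(1)])
    qed
    then show ?thesis by (simp add: vec_eq_iff)
  qed
  \<comment> \<open>For each member a neighbourhood on which slack coordinates stay positive and the
    non-wall sheets avoid \<open>Int_mf M\<close>; the latter is the failure of the closure
    condition in \<open>wall_sheets\<close>.\<close>
  have nbhd: "\<exists>P. openin (mtop M) P \<and> p \<in> P \<and> (p \<notin> S j \<longrightarrow> P \<inter> S j = {}) \<and>
      (p \<in> S j \<longrightarrow> P \<inter> S j \<subseteq> V' j \<and> (\<forall>q\<in>P \<inter> S j. \<forall>i\<in>K j - active (K j) (\<psi> j p). 0 < \<psi> j q $ i) \<and>
        (\<forall>q\<in>P \<inter> S j. q \<in> Int_mf M \<longrightarrow> (\<forall>i\<in>active (K j) (\<psi> j p) - W j. \<psi> j q $ i \<noteq> 0)))"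
    if j: "j \<in> J" for j
  proof (cases "p \<in> S j")
    case False
    then show ?thesis using pT by (intro exI[of _ "T - S j"]) (auto simp: openin_diff)
  next
    case True
    note \<psi>j = \<psi>(1)[OF j True] \<psi>(2)[OF j True]
    let ?A = "active (K j) (\<psi> j p)"
    define X1 where "X1 = {y :: real ^ 'n. \<forall>i\<in>K j - ?A. 0 < y $ i}"
    have "X1 = (\<Inter>i\<in>K j - ?A. {x. 0 < x $ i})" by (auto simp: X1_def)
    then have oX1: "open X1" by (auto intro!: open_INT open_Collect_less continuous_intros)
    have pX1: "\<psi> j p \<in> X1" using chart_on_image[OF \<psi>j] by (auto simp: X1_def less_le)
    obtain P1 where P1: "openin (mtop M) P1" "{q \<in> V' j. \<psi> j q \<in> X1} = P1 \<inter> S j"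
      using chart_on_openin_preimage[OF \<psi>j(1) oX1] unfolding openin_subtopology by blast
    have "\<forall>i\<in>?A - W j. \<exists>P. openin (mtop M) P \<and> p \<in> P \<and> P \<inter> ({q \<in> V' j. \<psi> j q $ i = 0} \<inter> Int_mf M) = {}"
    proof
      fix i assume "i \<in> ?A - W j"
      then have "p \<notin> mtop M closure_of ({q \<in> V' j. \<psi> j q $ i = 0} \<inter> Int_mf M)"
        by (simp add: W_def wall_sheets_def)
      then show "\<exists>P. openin (mtop M) P \<and> p \<in> P \<and> P \<inter> ({q \<in> V' j. \<psi> j q $ i = 0} \<inter> Int_mf M) = {}"
        using pT unfolding in_closure_of by blast
    qed
    from bchoice[OF this] obtain P2 where P2: "\<forall>i\<in>?A - W j. openin (mtop M) (P2 i) \<and> p \<in> P2 i \<and>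
      P2 i \<inter> ({q \<in> V' j. \<psi> j q $ i = 0} \<inter> Int_mf M) = {}"
      by blast
    let ?P = "P1 \<inter> ((\<Inter>i\<in>?A - W j. P2 i) \<inter> T)"
    have "openin (mtop M) ?P" by (intro openin_Int openin_INT P1(1)) (use P2 in auto)
    moreover have "p \<in> ?P" using P1(2) P2 pX1 \<psi>j(2) True pT by blast
    moreover have "?P \<inter> S j \<subseteq> V' j" "\<forall>q\<in>?P \<inter> S j. \<forall>i\<in>K j - ?A. 0 < \<psi> j q $ i"
      using P1(2) unfolding X1_def by blast+
    moreover have "\<forall>q\<in>?P \<inter> S j. q \<in> Int_mf M \<longrightarrow> (\<forall>i\<in>?A - W j. \<psi> j q $ i \<noteq> 0)"
      using P2 P1(2) by blast
    ultimately show ?thesis using True by blast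
  qed
  then have "\<forall>j\<in>J. \<exists>P. openin (mtop M) P \<and> p \<in> P \<and> (p \<notin> S j \<longrightarrow> P \<inter> S j = {}) \<and>
      (p \<in> S j \<longrightarrow> P \<inter> S j \<subseteq> V' j \<and> (\<forall>q\<in>P \<inter> S j. \<forall>i\<in>K j - active (K j) (\<psi> j p). 0 < \<psi> j q $ i) \<and>
        (\<forall>q\<in>P \<inter> S j. q \<in> Int_mf M \<longrightarrow> (\<forall>i\<in>active (K j) (\<psi> j p) - W j. \<psi> j q $ i \<noteq> 0)))" by blast
  from bchoice[OF this] obtain P where P': "\<forall>j\<in>J. openin (mtop M) (P j) \<and> p \<in> P j \<and> (p \<notin> S j \<longrightarrow> P j \<inter> S j = {}) \<and>
      (p \<in> S j \<longrightarrow> P j \<inter> S j \<subseteq> V' j \<and> (\<forall>q\<in>P j \<inter> S j. \<forall>i\<in>K j - active (K j) (\<psi> j p). 0 < \<psi> j q $ i) \<and>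
        (\<forall>q\<in>P j \<inter> S j. q \<in> Int_mf M \<longrightarrow> (\<forall>i\<in>active (K j) (\<psi> j p) - W j. \<psi> j q $ i \<noteq> 0)))" by blast
  have P: "\<And>j. j \<in> J \<Longrightarrow> openin (mtop M) (P j)" "\<And>j. j \<in> J \<Longrightarrow> p \<in> P j"
    "\<And>j. j \<in> J \<Longrightarrow> p \<notin> S j \<Longrightarrow> P j \<inter> S j = {}" "\<And>j. j \<in> J \<Longrightarrow> p \<in> S j \<Longrightarrow> P j \<inter> S j \<subseteq> V' j"
    "\<And>j q i. j \<in> J \<Longrightarrow> p \<in> S j \<Longrightarrow> q \<in> P j \<inter> S j \<Longrightarrow> i \<in> K j - active (K j) (\<psi> j p) \<Longrightarrow> 0 < \<psi> j q $ i"
    "\<And>j q i. j \<in> J \<Longrightarrow> p \<in> S j \<Longrightarrow> q \<in> P j \<inter> S j \<Longrightarrow> q \<in> Int_mf M \<Longrightarrow>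
       i \<in> active (K j) (\<psi> j p) - W j \<Longrightarrow> \<psi> j q $ i \<noteq> 0"
    using P' by blast+
  define P0 where "P0 = N \<inter> ((\<Inter>j\<in>J. P j) \<inter> T)"
  have oN: "openin (mtop M) N" using chart_on_openin[OF \<phi>(1)] by simp
  have oP0: "openin (mtop M) P0"
    unfolding P0_def by (intro openin_Int openin_INT P(1) oN finite_J)
  have P0: "p \<in> P0" "P0 \<subseteq> N" using \<phi>(2) pT P(2) by (auto simp: P0_def)
  have "openin (top_of_set (\<phi> ` N)) (\<phi> ` P0)"
    using chart_on_openness[OF \<phi>(1) P0(2)] oP0 oN P0(2) openin_open_subtopology by blast
  then have "openin (top_of_set (orthant L)) (\<phi> ` P0)"
    using chart_on_openin_image[OF \<phi>(1)] openin_trans by blast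
  then obtain Z where Z: "open Z" "\<phi> ` P0 = orthant L \<inter> Z" by (auto simp: openin_open)
  have "openin (top_of_set X) (X \<inter> Z)" using Z(1) by blast
  then have "openin (top_of_set Y) (\<Theta> ` (X \<inter> Z))" by (rule homeomorphism_imp_open_map[OF hom])
  then have oXZ: "open (\<Theta> ` (X \<inter> Z))" using oY openin_open_trans by blast
  have "0 \<in> \<Theta> ` (X \<inter> Z)"
  proof -
    have "0 \<in> Z" using Z(2) P0(1) \<phi>(3) by (metis IntD2 imageI)
    then show ?thesis using XY(2) \<Theta>0 by force
  qed
  then obtain e where e: "e > 0" "cube e \<subseteq> \<Theta> ` (X \<inter> Z)" using cube_subset_open[OF oXZ] by metis
  define X' where "X' = X \<inter> \<Theta> -` cube e"
  have oX': "open X'"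
    using continuous_on_open_vimage[OF oX, of \<Theta>] homeomorphism_cont1[OF hom]
    unfolding X'_def by (simp add: Int_commute open_cube)
  define V where "V = P0 \<inter> {q \<in> N. \<phi> q \<in> X'}"
  define \<Phi> where "\<Phi> = \<Theta> \<circ> \<phi>"
  have oV: "openin (mtop M) V"
    unfolding V_def using oP0 chart_on_openin_preimage[OF \<phi>(1) oX'] by (simp add: openin_Int)
  have VX: "\<phi> ` V \<subseteq> X" by (auto simp: V_def X'_def)
  have im: "\<Phi> ` V = orthant L \<inter> cube e"
  proof
    show "\<Phi> ` V \<subseteq> orthant L \<inter> cube e"
      using chart_on_image[OF \<phi>(1)] by (auto simp: \<Phi>_def V_def X'_def orthant_def \<Theta>L)
    show "orthant L \<inter> cube e \<subseteq> \<Phi> ` V"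
    proof
      fix z assume z: "z \<in> orthant L \<inter> cube e"
      then obtain y where y: "y \<in> X" "y \<in> Z" "z = \<Theta> y" using e(2) by blast
      then have "y \<in> orthant L" using z by (simp add: orthant_def \<Theta>L)
      then obtain q where "q \<in> P0" "y = \<phi> q" using Z(2) y(2) by blast
      then show "z \<in> \<Phi> ` V" using y z P0(2) by (auto simp: V_def X'_def \<Phi>_def)
    qed
  qed
  have \<Phi>: "chart_on M T V \<Phi> L"
    unfolding \<Phi>_def
  proof (rule chart_on_transform[OF manifold \<phi>(1) _ _ XY(3) VX])
    have "openin (top_of_set (orthant L)) (orthant L \<inter> cube e)" using open_cube by blast
    then show "openin (top_of_set (orthant L)) (\<Theta> ` \<phi> ` V)"
      using im by (simp add: \<Phi>_def image_comp)
  qed (use oV in \<open>auto simp: V_def\<close>)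
  have pV: "p \<in> V" "\<Phi> p = 0"
    using P0(1) \<phi> XY(2) \<Theta>0 e(1) by (auto simp: V_def X'_def \<Phi>_def cube_def)
  have VP: "V \<subseteq> P j" if "j \<in> J" for j using that by (auto simp: V_def P0_def)
  \<comment> \<open>The extension \<open>G j\<close> is tied to the corner chart only on
    \<open>S j\<close>, hence the restriction to \<open>q \<in> S j\<close>.\<close>
  have \<Phi>\<kappa>: "\<Phi> q $ \<kappa> j = \<psi> j q $ w j" if "j \<in> Jw" "q \<in> V" "q \<in> S j" for q j
  proof -
    note j = JwJ[OF that(1)]
    have q: "q \<in> V' j" "q \<in> N" using P(4)[OF j] VP[OF j(1)] that P0(2) by (auto simp: V_def)
    have "\<phi> q \<in> Q j" using VX XY(1) that(1,2) by (auto simp: Q0_def)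
    then have "G j (\<phi> q) = \<psi> j q" using GQ(4)[OF j, of "\<phi> q"] q injN by simp
    then show ?thesis by (simp add: \<Phi>_def \<Theta>\<kappa>[OF that(1)])
  qed
  \<comment> \<open>The image of \<open>Jw \<inter> {j}\<close> under \<open>\<kappa>\<close> is
    empty or a singleton, so one application covers members with a wall at \<open>p\<close> and
    members containing \<open>p\<close> in their interior.\<close>
  have local: "q \<in> S j \<longleftrightarrow> (\<forall>k\<in>\<kappa> ` (Jw \<inter> {j}). 0 \<le> \<Phi> q $ k)" "q \<in> U j \<longleftrightarrow> (\<forall>k\<in>\<kappa> ` (Jw \<inter> {j}). 0 < \<Phi> q $ k)"
    if j: "j \<in> J" "p \<in> S j" and q: "q \<in> V" for q j
  proof -
    have Wj: "W j = w ` (Jw \<inter> {j})" using w j by (cases "j \<in> Jw") (auto simp: Jw_def)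
    have VV': "V \<inter> S j \<subseteq> V' j" using P(4)[OF j] VP[OF j(1)] by blast
    have "(q \<in> S j \<longleftrightarrow> (\<forall>k\<in>\<kappa> ` (Jw \<inter> {j}). 0 \<le> \<Phi> q $ k)) \<and> (q \<in> U j \<longleftrightarrow> (\<forall>k\<in>\<kappa> ` (Jw \<inter> {j}). 0 < \<Phi> q $ k))"
      apply (intro conjI closure_in_adapted_chart[OF \<Phi> pV e(1) im j(1) \<psi>(1)[OF j] \<psi>(2)[OF j] VV' Wact[OF j]] q)
      subgoal using \<kappa>(2) by blast
      subgoal using P(5)[OF j] VP[OF j(1)] by blast
      subgoal using P(6)[OF j] VP[OF j(1)] by blast
      subgoal using \<Phi>\<kappa> Wj by auto
      subgoal using \<Phi>\<kappa> chart_on_image[OF \<psi>(1)[OF j]] Wact[OF j] w VV' by auto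
      subgoal using \<Phi>\<kappa> Wj by auto
      subgoal using \<kappa>(2) by blast
      subgoal using P(5)[OF j] VP[OF j(1)] by blast
      subgoal using P(6)[OF j] VP[OF j(1)] by blast
      subgoal using \<Phi>\<kappa> Wj by auto
      subgoal using \<Phi>\<kappa> chart_on_image[OF \<psi>(1)[OF j]] Wact[OF j] w VV' by auto
      subgoal using \<Phi>\<kappa> Wj by auto
      done
    then show "q \<in> S j \<longleftrightarrow> (\<forall>k\<in>\<kappa> ` (Jw \<inter> {j}). 0 \<le> \<Phi> q $ k)" "q \<in> U j \<longleftrightarrow> (\<forall>k\<in>\<kappa> ` (Jw \<inter> {j}). 0 < \<Phi> q $ k)"
      by blast+
  qed
  \<comment> \<open>At \<open>p\<close> all coordinates vanish, so membership in \<open>U j\<close>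
    fails exactly if there is a wall coordinate.\<close>
  have Jw: "walls_at p = Jw"
    unfolding walls_at_def using local[OF _ _ pV(1)] JwJ pV(2) by fastforce
  have ad: "adapted_chart p V \<Phi> L \<kappa> e"
    unfolding adapted_chart_def Jw
  proof (intro conjI ballI \<Phi> pV e(1) im \<kappa>)
    fix q j assume qj: "q \<in> V" "j \<in> J"
    have "p \<in> U j \<longleftrightarrow> p \<in> S j \<and> j \<notin> Jw"
      using Jw U_subset_S qj(2) JwJ unfolding walls_at_def by blast
    moreover have "q \<notin> S j" "q \<notin> U j" if "p \<notin> S j"
      using P(3)[OF qj(2) that] VP qj U_subset_S by blast+
    ultimately show "q \<in> S j \<longleftrightarrow> p \<in> U j \<or> j \<in> Jw \<and> 0 \<le> \<Phi> q $ \<kappa> j"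
      "q \<in> U j \<longleftrightarrow> p \<in> U j \<or> j \<in> Jw \<and> 0 < \<Phi> q $ \<kappa> j"
      using local[OF qj(2) _ qj(1)] JwJ(2)[of j] by (cases "j \<in> Jw"; cases "p \<in> S j"; auto)+
  qed
  have "V \<subseteq> N" by (auto simp: V_def)
  then show ?thesis using ad by (rule that)
qed

lemma adapted_chart_at:
  assumes "p \<in> T"
  obtains V \<Phi> L \<kappa> e where "adapted_chart p V \<Phi> L \<kappa> e"
proof -
  obtain N \<phi> L where "chart_on M T N \<phi> L" "p \<in> N" "\<phi> p = 0" by (rule centred_chart[OF manifold assms])
  then show ?thesis using that by (rule adapted_chart_exists)
qed

end

section \<open>The partition associated to a regular covering\<close>

context regular_cover
begin

abbreviation P :: "'a set set" where "P \<equiv> covering_partition M J U"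
abbreviation \<chi>_at :: "'a \<Rightarrow> nat set" where "\<chi>_at q \<equiv> chi J U q"
abbreviation Y :: "nat set \<Rightarrow> 'a set" where "Y A \<equiv> mtop M closure_of chi_fibre M J U A"
abbreviation idx :: "'a set \<Rightarrow> nat set" where "idx B \<equiv> block_index M J U B"

lemma adapted_chartD:
  assumes "adapted_chart p V \<Phi> L \<kappa> e"
  shows "chart_on M T V \<Phi> L" "p \<in> V" "\<Phi> p = 0" "0 < e" "\<Phi> ` V = orthant L \<inter> cube e"
    "inj_on \<kappa> (walls_at p)" "\<kappa> ` walls_at p \<inter> L = {}" "openin (mtop M) V" "inj_on \<Phi> V" "V \<subseteq> T"
proof -
  show c: "chart_on M T V \<Phi> L" using assms unfolding adapted_chart_def by blast
  show "openin (mtop M) V" "inj_on \<Phi> V" "V \<subseteq> T"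
    using chart_on_openin[OF c] chart_on_inj[OF c] chart_on_subset[OF c] by auto
qed (use assms in \<open>auto simp: adapted_chart_def\<close>)

lemma walls_at_subset: "walls_at p \<subseteq> J" "finite (walls_at p)"
  using finite_J by (auto simp: walls_at_def)

lemma chi_subset: "\<chi>_at p \<subseteq> J"
  by (auto simp: chi_def)

lemma chi_walls_disjoint: "\<chi>_at p \<inter> walls_at p = {}"
  by (auto simp: chi_def walls_at_def)

lemma chi_in_adapted_chart:
  assumes "adapted_chart p V \<Phi> L \<kappa> e" "q \<in> V"
  shows "\<chi>_at q = \<chi>_at p \<union> {j \<in> walls_at p. 0 < \<Phi> q $ \<kappa> j}"
    "walls_at q = {j \<in> walls_at p. \<Phi> q $ \<kappa> j = 0}"
proof -
  have *: "\<And>j. j \<in> J \<Longrightarrow> (q \<in> S j \<longleftrightarrow> p \<in> U j \<or> j \<in> walls_at p \<and> 0 \<le> \<Phi> q $ \<kappa> j) \<and>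
        (q \<in> U j \<longleftrightarrow> p \<in> U j \<or> j \<in> walls_at p \<and> 0 < \<Phi> q $ \<kappa> j)"
    using assms unfolding adapted_chart_def by blast
  show "\<chi>_at q = \<chi>_at p \<union> {j \<in> walls_at p. 0 < \<Phi> q $ \<kappa> j}"
    unfolding chi_def using * walls_at_subset(1) by blast
  show "walls_at q = {j \<in> walls_at p. \<Phi> q $ \<kappa> j = 0}"
  proof (intro set_eqI iffI)
    fix j assume "j \<in> walls_at q"
    then have "j \<in> J" "q \<in> S j" "q \<notin> U j" by (auto simp: walls_at_def)
    then show "j \<in> {j \<in> walls_at p. \<Phi> q $ \<kappa> j = 0}" using *[of j] by auto
  next
    fix j assume j: "j \<in> {j \<in> walls_at p. \<Phi> q $ \<kappa> j = 0}"
    then have "j \<in> J" "p \<notin> U j" by (auto simp: walls_at_def)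
    then show "j \<in> walls_at q" using *[of j] j by (auto simp: walls_at_def[of q])
  qed
qed

lemma interior_in_adapted_chart:
  assumes "adapted_chart p V \<Phi> L \<kappa> e" "q \<in> V"
  shows "q \<in> Int_mf M \<longleftrightarrow> (\<forall>l\<in>L. 0 < \<Phi> q $ l)"
  using mf_interior_chart[OF adapted_chartD(1)[OF assms(1)] assms(2)]
    chart_on_image[OF adapted_chartD(1)[OF assms(1)] assms(2)] by (auto simp: less_le)

lemma move_in_adapted_chart:
  assumes ad: "adapted_chart p V \<Phi> L \<kappa> e" and q: "q \<in> V" and A: "openin (mtop M) A" "q \<in> A" and u: "u \<in> orthant L"
  obtains q' t where "q' \<in> V" "q' \<in> A" "0 < t" "\<Phi> q' = \<Phi> q + t *\<^sub>R u"
proof -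
  note a = adapted_chartD[OF ad]
  have "ray_in (\<Phi> ` (V \<inter> A)) (\<Phi> q) u"
    by (rule ray_in_chart[OF a(1)]) (use q A u in \<open>auto simp: orthant_def\<close>)
  then obtain t where "0 < t" "\<Phi> q + t *\<^sub>R u \<in> \<Phi> ` (V \<inter> A)"
    unfolding ray_in_def by (metis less_imp_le order_refl)
  then show ?thesis using that by (metis IntD1 IntD2 imageE)
qed

text \<open>Inside the chart, step from \<open>p\<close> off every wall to a prescribed side, and off the boundary.\<close>

lemma generic_point:
  assumes p: "p \<in> T" and A: "\<chi>_at p \<subseteq> A" "A \<subseteq> \<chi>_at p \<union> walls_at p" and X: "openin (mtop M) X" "p \<in> X"
    and R: "R \<subseteq> walls_at p"
  obtains q where "q \<in> X" "\<chi>_at q = A - R" "walls_at q = R" "q \<in> Int_mf M"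
proof -
  obtain V \<Phi> L \<kappa> e where ad: "adapted_chart p V \<Phi> L \<kappa> e" using adapted_chart_at[OF p] by blast
  note a = adapted_chartD[OF ad]
  \<comment> \<open>Coordinates in \<open>L\<close> move off the boundary, those of walls in
    \<open>R\<close> stay put, and the remaining walls are left towards the side prescribed by
    \<open>A\<close>.\<close>
  define u :: "real ^ 'n" where "u = (\<chi> i. if i \<in> L then 1 else if i \<in> \<kappa> ` R then 0 else
    if i \<in> \<kappa> ` (walls_at p \<inter> A) then 1 else - 1)"
  have u: "u \<in> orthant L" by (simp add: u_def orthant_def)
  have u\<kappa>: "u $ \<kappa> j = (if j \<in> R then 0 else if j \<in> A then 1 else - 1)" if j: "j \<in> walls_at p" for j
  proof -
    have "\<kappa> j \<notin> L" using a(7) j by blast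
    moreover have "\<kappa> j \<in> \<kappa> ` R \<longleftrightarrow> j \<in> R" using a(6) j R by (auto dest: inj_onD)
    moreover have "\<kappa> j \<in> \<kappa> ` (walls_at p \<inter> A) \<longleftrightarrow> j \<in> A" using a(6) j by (auto dest: inj_onD)
    ultimately show ?thesis by (simp add: u_def)
  qed
  obtain q t where q: "q \<in> V" "q \<in> X" "0 < t" "\<Phi> q = \<Phi> p + t *\<^sub>R u"
    by (rule move_in_adapted_chart[OF ad a(2) X u])
  have \<Phi>q: "\<Phi> q $ \<kappa> j = t * (if j \<in> R then 0 else if j \<in> A then 1 else - 1)" if "j \<in> walls_at p" for j
    using q(4) a(3) u\<kappa>[OF that] by simp
  show ?thesis
  proof (rule that[OF q(2)])
    show "walls_at q = R"
      unfolding chi_in_adapted_chart(2)[OF ad q(1)] using \<Phi>q q(3) R by (auto split: if_splits)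
    have "{j \<in> walls_at p. 0 < \<Phi> q $ \<kappa> j} = {j \<in> walls_at p. j \<in> A - R}"
      using \<Phi>q q(3) by (auto simp: zero_less_mult_iff split: if_splits)
    then show "\<chi>_at q = A - R"
      unfolding chi_in_adapted_chart(1)[OF ad q(1)] using A R chi_walls_disjoint[of p] by blast
    show "q \<in> Int_mf M"
      unfolding interior_in_adapted_chart[OF ad q(1)] using q(3,4) a(3) by (simp add: u_def)
  qed
qed

text \<open>Near \<open>q\<close> only index sets between \<open>\<chi>_at q\<close> and
  \<open>\<chi>_at q \<union> walls_at q\<close> occur, and each of them occurs arbitrarily close;
  membership in a closure thus becomes a condition on finite sets.\<close>

lemma Y_iff:
  assumes q: "q \<in> T"
  shows "q \<in> Y A \<longleftrightarrow> \<chi>_at q \<subseteq> A \<and> A \<subseteq> \<chi>_at q \<union> walls_at q"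
proof
  assume "q \<in> Y A"
  obtain V \<Phi> L \<kappa> e where ad: "adapted_chart q V \<Phi> L \<kappa> e" using adapted_chart_at[OF q] by blast
  note a = adapted_chartD[OF ad]
  obtain q' where q': "q' \<in> V" "\<chi>_at q' = A"
    using \<open>q \<in> Y A\<close> a(2,8) unfolding in_closure_of chi_fibre_def by blast
  then show "\<chi>_at q \<subseteq> A \<and> A \<subseteq> \<chi>_at q \<union> walls_at q"
    using chi_in_adapted_chart(1)[OF ad q'(1)] by blast
next
  assume A: "\<chi>_at q \<subseteq> A \<and> A \<subseteq> \<chi>_at q \<union> walls_at q"
  show "q \<in> Y A"
    unfolding in_closure_of
  proof (intro conjI allI impI q)
    fix X assume X: "q \<in> X \<and> openin (mtop M) X"
    obtain q' where "q' \<in> X" "\<chi>_at q' = A - {}"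
      by (rule generic_point[OF q conjunct1[OF A] conjunct2[OF A] conjunct2[OF X] conjunct1[OF X] empty_subsetI])
    moreover have "q' \<in> T" using X openin_subset \<open>q' \<in> X\<close> by blast
    ultimately show "\<exists>y. y \<in> chi_fibre M J U A \<and> y \<in> X"
      unfolding chi_fibre_def by auto
  qed
qed

lemma Y_subset: "Y A \<subseteq> T" by (rule closure_of_subset_topspace)

text \<open>The chart image is convex, so it meets a convex region in a connected set, which pulls
  back along the homeomorphism.\<close>

lemma connected_in_adapted_chart:
  assumes ad: "adapted_chart p V \<Phi> L \<kappa> e" and X: "convex X"
  shows "connectedin (mtop M) {q \<in> V. \<Phi> q \<in> X}"
proof -
  note a = adapted_chartD[OF ad]
  let ?Q = "{q \<in> V. \<Phi> q \<in> X}"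
  have vim: "convex ((\<lambda>x :: real ^ 'n. x $ k) -` I)" if "convex I" for k I
    by (rule convex_linear_vimage[OF bounded_linear.linear[OF bounded_linear_vec_nth] that])
  have "orthant L \<inter> cube e = (\<Inter>k\<in>L. (\<lambda>x :: real ^ 'n. x $ k) -` {0..}) \<inter> (\<Inter>k. (\<lambda>x. x $ k) -` ball 0 e)"
    by (auto simp: orthant_def cube_def)
  moreover have "convex \<dots>" by (intro convex_Int convex_INT vim) (auto intro: convex_ball)
  ultimately have "convex (orthant L \<inter> cube e)" by simp
  then have "connected (orthant L \<inter> cube e \<inter> X)" using convex_connected[OF convex_Int[OF _ X]] by blast
  moreover have im: "\<Phi> ` ?Q = orthant L \<inter> cube e \<inter> X" using a(5) by auto
  ultimately have "connectedin (top_of_set (\<Phi> ` V)) (\<Phi> ` ?Q)"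
    by (auto simp: connectedin_subtopology)
  then have "connectedin (subtopology (mtop M) V) ?Q"
    using homeomorphic_map_connectedness[OF chart_on_homeo[OF a(1)], of ?Q] a(10) by auto
  then show ?thesis by (simp add: connectedin_subtopology)
qed

lemma convex_sign_orthant: "convex (sign_orthant K S' :: (real ^ 'n) set)"
proof -
  have vim: "convex ((\<lambda>x :: real ^ 'n. x $ k) -` I)" if "convex I" for k I
    by (rule convex_linear_vimage[OF bounded_linear.linear[OF bounded_linear_vec_nth] that])
  have "sign_orthant K S' = (\<Inter>k\<in>S'. (\<lambda>x :: real ^ 'n. x $ k) -` {0..}) \<inter> (\<Inter>k\<in>K - S'. (\<lambda>x. x $ k) -` {..0})"
    by (auto simp: sign_orthant_def)
  then show ?thesis by (auto intro!: convex_Int convex_INT vim)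
qed

text \<open>Each wall \<open>j\<close> at \<open>p\<close> demands a nonnegative coordinate if
  \<open>j \<in> A\<close> and a nonpositive one otherwise; this is how index sets become sign
  patterns.\<close>

lemma Y_in_adapted_chart:
  assumes ad: "adapted_chart p V \<Phi> L \<kappa> e" and A: "\<chi>_at p \<subseteq> A" "A \<subseteq> \<chi>_at p \<union> walls_at p" and q: "q \<in> V"
  shows "q \<in> Y A \<longleftrightarrow> \<Phi> q \<in> sign_orthant (\<kappa> ` walls_at p) (\<kappa> ` (A - \<chi>_at p))"
proof -
  note a = adapted_chartD[OF ad]
  have qT: "q \<in> T" using q a(10) by blast
  have sub: "A - \<chi>_at p \<subseteq> walls_at p" using A by blast
  have "\<kappa> ` walls_at p - \<kappa> ` (A - \<chi>_at p) = \<kappa> ` (walls_at p - (A - \<chi>_at p))"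
    using inj_on_image_set_diff[OF a(6)] sub by blast
  moreover have "walls_at p - (A - \<chi>_at p) = walls_at p - A" using chi_walls_disjoint[of p] by blast
  ultimately have so: "\<Phi> q \<in> sign_orthant (\<kappa> ` walls_at p) (\<kappa> ` (A - \<chi>_at p)) \<longleftrightarrow>
    (\<forall>j\<in>A - \<chi>_at p. 0 \<le> \<Phi> q $ \<kappa> j) \<and> (\<forall>j\<in>walls_at p - A. \<Phi> q $ \<kappa> j \<le> 0)"
    by (simp add: sign_orthant_def)
  have "\<chi>_at q \<subseteq> A \<longleftrightarrow> (\<forall>j\<in>walls_at p - A. \<Phi> q $ \<kappa> j \<le> 0)"
    unfolding chi_in_adapted_chart[OF ad q] using A(1) by (auto simp: not_less) (meson DiffI not_less)
  moreover have "A \<subseteq> \<chi>_at q \<union> walls_at q \<longleftrightarrow> (\<forall>j\<in>A - \<chi>_at p. 0 \<le> \<Phi> q $ \<kappa> j)"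
    unfolding chi_in_adapted_chart[OF ad q] using sub by (auto simp: le_less)
  ultimately show ?thesis unfolding Y_iff[OF qT] so by blast
qed

subsection \<open>Blocks\<close>

definition block :: "nat set \<Rightarrow> 'a \<Rightarrow> 'a set" where
  "block A p = connected_component_of_set (subtopology (mtop M) (Y A)) p"

lemma component_over_block:
  assumes "p \<in> Y A"
  shows "is_component_over M J U A (block A p)" "p \<in> block A p"
proof -
  have pT: "p \<in> T" using assms Y_subset by blast
  have "chi_fibre M J U A \<noteq> {}" using assms by auto
  moreover have "A \<subseteq> J" using Y_iff[OF pT, of A] assms chi_subset walls_at_subset by blast
  moreover have "block A p \<in> connected_components_of (subtopology (mtop M) (Y A))"
    unfolding block_def connected_components_of_def using assms pT by auto
  ultimately show "is_component_over M J U A (block A p)" by (simp add: is_component_over_def)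
  show "p \<in> block A p"
    unfolding block_def using assms pT by (simp add: connected_component_of_refl)
qed

lemma component_over_eq_block:
  assumes "is_component_over M J U A B" "p \<in> B"
  shows "B = block A p" "p \<in> Y A"
proof -
  obtain r where r: "r \<in> topspace (subtopology (mtop M) (Y A))"
    "B = connected_component_of_set (subtopology (mtop M) (Y A)) r"
    using assms(1) unfolding is_component_over_def connected_components_of_def by blast
  then have "connected_component_of (subtopology (mtop M) (Y A)) r p" using assms(2) by simp
  then show "B = block A p" unfolding block_def r(2) by (metis connected_component_of_equiv)
  show "p \<in> Y A"
    using \<open>connected_component_of (subtopology (mtop M) (Y A)) r p\<close> connected_component_in_topspace by fastforce
qed

lemma component_over:
  assumes "is_component_over M J U A B"
  shows "B \<noteq> {}" "B \<subseteq> Y A" "connectedin (mtop M) B" "closedin (mtop M) B"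
    "\<And>X. connectedin (mtop M) X \<Longrightarrow> X \<subseteq> Y A \<Longrightarrow> X \<inter> B \<noteq> {} \<Longrightarrow> X \<subseteq> B"
proof -
  have B: "B \<in> connected_components_of (subtopology (mtop M) (Y A))"
    using assms unfolding is_component_over_def by blast
  show "B \<noteq> {}" by (rule nonempty_connected_components_of[OF B])
  show "B \<subseteq> Y A" using connected_components_of_subset[OF B] by auto
  show "connectedin (mtop M) B" using connectedin_connected_components_of[OF B] by (simp add: connectedin_subtopology)
  have "closedin (subtopology (mtop M) (Y A)) B" by (rule closedin_connected_components_of[OF B])
  then show "closedin (mtop M) B" using closedin_trans_full closedin_closure_of by blast
  show "X \<subseteq> B" if "connectedin (mtop M) X" "X \<subseteq> Y A" "X \<inter> B \<noteq> {}" for X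
    using connected_components_of_maximal[OF B, of X] that
    by (auto simp: connectedin_subtopology disjnt_def)
qed

text \<open>In the chart \<open>Y A\<close> is a convex sign region, hence connected: a component
  that meets it contains all of it, including the centre \<open>p\<close>.\<close>

lemma component_over_in_adapted_chart:
  assumes ad: "adapted_chart p V \<Phi> L \<kappa> e" and B: "is_component_over M J U A B" "B \<inter> V \<noteq> {}"
  shows "B \<inter> V = Y A \<inter> V" "p \<in> B" "\<chi>_at p \<subseteq> A" "A \<subseteq> \<chi>_at p \<union> walls_at p"
proof -
  note a = adapted_chartD[OF ad]
  obtain q where q: "q \<in> B" "q \<in> V" "q \<in> Y A" using B component_over(2) by blast
  have "\<chi>_at q \<subseteq> A" "A \<subseteq> \<chi>_at q \<union> walls_at q" using Y_iff[of q A] q a(10) by blast+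
  then show A: "\<chi>_at p \<subseteq> A" "A \<subseteq> \<chi>_at p \<union> walls_at p"
    unfolding chi_in_adapted_chart[OF ad q(2)] by blast+
  have "Y A \<inter> V = {q \<in> V. \<Phi> q \<in> sign_orthant (\<kappa> ` walls_at p) (\<kappa> ` (A - \<chi>_at p))}"
    using Y_in_adapted_chart[OF ad A] by blast
  then have "connectedin (mtop M) (Y A \<inter> V)"
    using connected_in_adapted_chart[OF ad convex_sign_orthant] by simp
  then have "Y A \<inter> V \<subseteq> B" by (rule component_over(5)[OF B(1)]) (use q in auto)
  then show "B \<inter> V = Y A \<inter> V" using component_over(2)[OF B(1)] by blast
  have "p \<in> T" using a by blast
  then have "p \<in> Y A" unfolding Y_iff[OF \<open>p \<in> T\<close>] using A by blast
  then show "p \<in> B" using \<open>Y A \<inter> V \<subseteq> B\<close> a(2) by blast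
qed

text \<open>Close to any point of the block there are points of it off all walls, and such a point
  lies in \<open>Y A\<close> for its own index set only.\<close>

lemma component_over_unique:
  assumes "is_component_over M J U A B" "is_component_over M J U A' B"
  shows "A = A'"
proof -
  obtain p where p: "p \<in> B" using component_over(1)[OF assms(1)] by blast
  then have pY: "p \<in> Y A" "p \<in> T" using component_over(2)[OF assms(1)] Y_subset by blast+
  obtain V \<Phi> L \<kappa> e where ad: "adapted_chart p V \<Phi> L \<kappa> e" using adapted_chart_at[OF pY(2)] by blast
  note a = adapted_chartD[OF ad]
  have A: "\<chi>_at p \<subseteq> A" "A \<subseteq> \<chi>_at p \<union> walls_at p" using pY Y_iff[OF pY(2)] by blast+
  obtain q where q: "q \<in> V" "\<chi>_at q = A - {}" "walls_at q = {}"
    by (rule generic_point[OF pY(2) A a(8,2) empty_subsetI])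
  have qT: "q \<in> T" using q(1) a(10) by blast
  have "q \<in> Y A" unfolding Y_iff[OF qT] using q by blast
  then have "q \<in> B" using component_over_in_adapted_chart(1)[OF ad assms(1)] p a(2) q(1) by blast
  then have "q \<in> Y A'" using component_over(2)[OF assms(2)] by blast
  then show "A = A'" unfolding Y_iff[OF qT] using q by blast
qed

lemma ex1_component_over: "B \<in> P \<Longrightarrow> \<exists>!A. is_component_over M J U A B"
  unfolding covering_partition_def using component_over_unique by blast

lemma is_component_over_idx: "B \<in> P \<Longrightarrow> is_component_over M J U (idx B) B"
  unfolding block_index_def by (rule theI'[OF ex1_component_over])

lemma idx_eq: "is_component_over M J U A B \<Longrightarrow> idx B = A"
  using component_over_unique is_component_over_idx unfolding covering_partition_def by blast

lemma block_in_P: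
  assumes "p \<in> Y A" shows "block A p \<in> P" "idx (block A p) = A"
  using component_over_block[OF assms] idx_eq unfolding covering_partition_def by blast+

lemma in_block:
  assumes "B \<in> P" "p \<in> B"
  shows "B = block (idx B) p" "p \<in> Y (idx B)" "p \<in> T" "\<chi>_at p \<subseteq> idx B" "idx B \<subseteq> \<chi>_at p \<union> walls_at p"
proof -
  show "B = block (idx B) p" and Y: "p \<in> Y (idx B)"
    using component_over_eq_block[OF is_component_over_idx[OF assms(1)] assms(2)] by auto
  then show T: "p \<in> T" using Y_subset by blast
  show "\<chi>_at p \<subseteq> idx B" "idx B \<subseteq> \<chi>_at p \<union> walls_at p" using Y Y_iff[OF T] by auto
qed

text \<open>Nonemptiness comes from the covering property; it matters because an empty tensor
  product would have \<open>UNIV\<close> as its base.\<close>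

lemma idx_nonempty: "B \<in> P \<Longrightarrow> idx B \<noteq> {}" "B \<in> P \<Longrightarrow> idx B \<subseteq> J" "B \<in> P \<Longrightarrow> finite (idx B)"
proof -
  assume B: "B \<in> P"
  then obtain p where "p \<in> B" using component_over(1)[OF is_component_over_idx] by blast
  then have "\<chi>_at p \<subseteq> idx B" "p \<in> T" using in_block[OF B] by auto
  then show "idx B \<noteq> {}" using cover_U[of p] by (auto simp: chi_def)
  show "idx B \<subseteq> J" using is_component_over_idx[OF B] by (simp add: is_component_over_def)
  then show "finite (idx B)" using finite_J finite_subset by blast
qed

text \<open>A neighbourhood inside \<open>B\<close> realizes every index set admissible at
  \<open>q\<close>, and all of them must equal \<open>idx B\<close>; a wall through \<open>q\<close>
  would allow two different ones.\<close>

lemma mf_interior_block: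
  assumes B: "B \<in> P" and q: "q \<in> mf_interior M B"
  shows "walls_at q = {}" "\<chi>_at q = idx B"
proof -
  have "q \<in> mtop M interior_of B" by (rule mf_interior_open(1)[OF manifold q])
  then obtain X where X: "openin (mtop M) X" "q \<in> X" "X \<subseteq> B" unfolding interior_of_def by blast
  then have qT: "q \<in> T" and qB: "q \<in> B" using openin_subset by blast+
  have eq: "idx B = A" if A: "\<chi>_at q \<subseteq> A" "A \<subseteq> \<chi>_at q \<union> walls_at q" for A
  proof -
    obtain r where r: "r \<in> X" "\<chi>_at r = A - {}" "walls_at r = {}"
      by (rule generic_point[OF qT A X(1,2) empty_subsetI])
    then show ?thesis using in_block(4,5)[OF B, of r] X(3) by blast
  qed
  show "walls_at q = {}"
  proof (rule ccontr)
    assume "walls_at q \<noteq> {}"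
    then obtain j where j: "j \<in> walls_at q" by blast
    have "idx B = \<chi>_at q" "idx B = insert j (\<chi>_at q)" by (rule eq; use j in auto)+
    then show False using j chi_walls_disjoint[of q] by blast
  qed
  show "\<chi>_at q = idx B" using eq[of "\<chi>_at q"] by simp
qed

text \<open>In an adapted chart the block is a sign region. Reflecting the wall coordinates in which
  it is nonpositive turns it into an orthant, constrained in \<open>L\<close> and in all walls at
  the point.\<close>

lemma block_embedded:
  assumes B: "B \<in> P"
  shows "embedded_with_corners M B"
  unfolding embedded_with_corners_def
proof (intro conjI ballI)
  show "B \<subseteq> T" using in_block(3)[OF B] by blast
  fix p assume p: "p \<in> B"
  obtain V \<Phi> L \<kappa> e where ad: "adapted_chart p V \<Phi> L \<kappa> e" using adapted_chart_at in_block(3)[OF B p] by blast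
  note a = adapted_chartD[OF ad]
  let ?A = "idx B" and ?K = "\<kappa> ` walls_at p"
  note A = in_block(4,5)[OF B p]
  let ?S = "\<kappa> ` (?A - \<chi>_at p)"
  have BV: "B \<inter> V = {q \<in> V. \<Phi> q \<in> sign_orthant ?K ?S}"
    using component_over_in_adapted_chart(1)[OF ad is_component_over_idx[OF B]] p a(2)
      Y_in_adapted_chart[OF ad A] by blast
  define \<theta> :: "real ^ 'n \<Rightarrow> real ^ 'n" where "\<theta> x = (\<chi> i. if i \<in> ?K - ?S then - x $ i else x $ i)" for x
  have \<theta>\<theta>: "\<theta> (\<theta> x) = x" for x by (simp add: \<theta>_def vec_eq_iff)
  have "linear \<theta>" by (rule linearI) (auto simp: \<theta>_def vec_eq_iff)
  then have bl: "bounded_linear \<theta>" using linear_conv_bounded_linear by blast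
  have "\<theta> ` UNIV = UNIV" using \<theta>\<theta> by (rule surjI)
  then have d: "smooth_diffeo UNIV UNIV \<theta> \<theta>"
    unfolding smooth_diffeo_def homeomorphism_def
    using smooth_on_bounded_linear[OF bl] linear_continuous_on[OF bl] \<theta>\<theta> by auto
  have im: "\<theta> ` \<Phi> ` (B \<inter> V) = orthant (L \<union> ?K) \<inter> cube e"
  proof -
    have iff: "x \<in> orthant L \<inter> cube e \<inter> sign_orthant ?K ?S \<longleftrightarrow> \<theta> x \<in> orthant (L \<union> ?K) \<inter> cube e" for x
    proof -
      have "\<theta> x $ i = x $ i" if "i \<in> L" for i using a(7) that by (auto simp: \<theta>_def)
      then have "x \<in> orthant L \<longleftrightarrow> \<theta> x \<in> orthant L" by (simp add: orthant_def)
      moreover have "x \<in> cube e \<longleftrightarrow> \<theta> x \<in> cube e"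
      proof -
        have "\<bar>\<theta> x $ i\<bar> = \<bar>x $ i\<bar>" for i by (simp add: \<theta>_def)
        then show ?thesis unfolding cube_def by simp
      qed
      moreover have "x \<in> sign_orthant ?K ?S \<longleftrightarrow> \<theta> x \<in> orthant ?K"
      proof -
        have "S0 \<subseteq> K0 \<Longrightarrow> x \<in> sign_orthant K0 S0 \<longleftrightarrow> (\<forall>i\<in>K0. 0 \<le> (if i \<in> K0 - S0 then - x $ i else x $ i))" for S0 K0
          by (auto simp: sign_orthant_def)
        moreover have "?S \<subseteq> ?K" using A by blast
        ultimately show ?thesis by (simp add: orthant_def \<theta>_def)
      qed
      moreover have "\<theta> x \<in> orthant (L \<union> ?K) \<longleftrightarrow> \<theta> x \<in> orthant L \<and> \<theta> x \<in> orthant ?K"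
        by (auto simp: orthant_def)
      ultimately show ?thesis by blast
    qed
    have "\<Phi> ` (B \<inter> V) = orthant L \<inter> cube e \<inter> sign_orthant ?K ?S" unfolding BV using a(5) by auto
    moreover have "\<theta> ` X = {y. \<theta> y \<in> X}" for X using \<theta>\<theta> by (metis (mono_tags, lifting) image_eqI mem_Collect_eq subsetI subset_antisym image_subset_iff)
    ultimately show ?thesis using iff \<theta>\<theta> by auto
  qed
  have "chart_on M B (B \<inter> V) (\<theta> \<circ> \<Phi>) (L \<union> ?K)"
    by (rule chart_on_transform[OF manifold a(1) _ _ d])
      (use im a(8) in \<open>auto intro: openin_subtopology_Int2 openin_open_Int open_cube\<close>)
  then show "\<exists>V \<phi> K. chart_on M B V \<phi> K \<and> p \<in> V" using p a(2) by blast
qed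

lemma mf_partition_P: "mf_partition M P"
  unfolding mf_partition_def
proof (intro conjI ballI impI)
  show "\<Union>P = T"
  proof
    show "\<Union>P \<subseteq> T" using in_block(3) by blast
    show "T \<subseteq> \<Union>P"
    proof
      fix p assume "p \<in> T"
      then have "p \<in> Y (\<chi>_at p)" using Y_iff by blast
      then show "p \<in> \<Union>P" using block_in_P(1) component_over_block(2) by blast
    qed
  qed
  fix B assume B: "B \<in> P"
  note c = component_over[OF is_component_over_idx[OF B]]
  show "B \<noteq> {}" "closedin (mtop M) B" "connectedin (mtop M) B" by fact+
  show "embedded_with_corners M B" by (rule block_embedded[OF B])
  fix B' assume B': "B' \<in> P" "B \<noteq> B'"
  show "mf_interior M B \<inter> mf_interior M B' = {}"
  proof (rule ccontr)
    assume "mf_interior M B \<inter> mf_interior M B' \<noteq> {}"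
    then obtain q where q: "q \<in> mf_interior M B" "q \<in> mf_interior M B'" by blast
    then have "idx B = idx B'" using mf_interior_block(2) B B'(1) by metis
    moreover have "q \<in> B" "q \<in> B'"
      using subsetD[OF mf_interior_subset q(1)] subsetD[OF mf_interior_subset q(2)] by auto
    ultimately show False using in_block(1)[OF B] in_block(1)[OF B'(1)] B'(2) by metis
  qed
qed

lemma local_model_of_adapted_chart:
  assumes ad: "adapted_chart p V \<Phi> L \<kappa> e"
  shows "local_model M P p V L (\<kappa> ` walls_at p)"
  unfolding local_model_def
proof (intro conjI exI[of _ \<Phi>])
  note a = adapted_chartD[OF ad]
  let ?K = "\<kappa> ` walls_at p"
  show "L \<inter> ?K = {}" "chart_on M T V \<Phi> L" "p \<in> V" "\<Phi> p = 0" using a by auto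
  have im: "\<Phi> ` (B \<inter> V) = \<Phi> ` V \<inter> sign_orthant ?K (\<kappa> ` (idx B - \<chi>_at p))" if "B \<in> P" "B \<inter> V \<noteq> {}" for B
  proof -
    note c = component_over_in_adapted_chart[OF ad is_component_over_idx[OF that(1)] that(2)]
    have "B \<inter> V = {q \<in> V. \<Phi> q \<in> sign_orthant ?K (\<kappa> ` (idx B - \<chi>_at p))}"
      using c(1) Y_in_adapted_chart[OF ad c(3,4)] by blast
    then show ?thesis by auto
  qed
  show "{\<Phi> ` (B \<inter> V) |B. B \<in> P \<and> B \<inter> V \<noteq> {}} = {\<Phi> ` V \<inter> sign_orthant ?K S' |S'. S' \<subseteq> ?K}"
  proof (intro set_eqI iffI)
    fix X assume "X \<in> {\<Phi> ` (B \<inter> V) |B. B \<in> P \<and> B \<inter> V \<noteq> {}}"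
    then obtain B where B: "X = \<Phi> ` (B \<inter> V)" "B \<in> P" "B \<inter> V \<noteq> {}" by blast
    have "\<kappa> ` (idx B - \<chi>_at p) \<subseteq> ?K"
      using component_over_in_adapted_chart(4)[OF ad is_component_over_idx[OF B(2)] B(3)] by blast
    then show "X \<in> {\<Phi> ` V \<inter> sign_orthant ?K S' |S'. S' \<subseteq> ?K}" using im[OF B(2,3)] B(1) by blast
  next
    fix X assume "X \<in> {\<Phi> ` V \<inter> sign_orthant ?K S' |S'. S' \<subseteq> ?K}"
    then obtain S' where S': "X = \<Phi> ` V \<inter> sign_orthant ?K S'" "S' \<subseteq> ?K" by blast
    \<comment> \<open>The index set belonging to the sign pattern \<open>S'\<close>: the walls whose
      coordinate is required nonnegative are added to \<open>\<chi>_at p\<close>.\<close>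
    define A where "A = \<chi>_at p \<union> {j \<in> walls_at p. \<kappa> j \<in> S'}"
    have pY: "p \<in> Y A" using Y_iff[of p A] a(2,10) by (auto simp: A_def)
    have "A - \<chi>_at p = {j \<in> walls_at p. \<kappa> j \<in> S'}" using chi_walls_disjoint[of p] by (auto simp: A_def)
    then have "\<kappa> ` (A - \<chi>_at p) = S'" using S'(2) by blast
    moreover have "block A p \<inter> V \<noteq> {}" using component_over_block(2)[OF pY] a(2) by blast
    ultimately have "X = \<Phi> ` (block A p \<inter> V)" using im[OF block_in_P(1)[OF pY]] block_in_P(2)[OF pY] S'(1) by simp
    then show "X \<in> {\<Phi> ` (B \<inter> V) |B. B \<in> P \<and> B \<inter> V \<noteq> {}}"
      using block_in_P(1)[OF pY] \<open>block A p \<inter> V \<noteq> {}\<close> by blast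
  qed
qed

text \<open>The boundary clause prescribes the model \<open>L\<close> of the given chart, which is
  why adapted charts were built inside an arbitrary centred chart with the same
  \<open>L\<close>.\<close>

theorem regular_partition_P: "regular_partition M P"
  unfolding regular_partition_def
proof (intro conjI ballI allI impI mf_partition_P)
  fix p assume p: "p \<in> Int_mf M"
  then have "p \<in> T" using subsetD[OF mf_interior_subset p] by simp
  then obtain V \<Phi> L \<kappa> e where ad: "adapted_chart p V \<Phi> L \<kappa> e" using adapted_chart_at by blast
  \<comment> \<open>The centre has all coordinates zero, so at an interior point no coordinate can
    be constrained.\<close>
  have "L = {}"
    using interior_in_adapted_chart[OF ad adapted_chartD(2)[OF ad]] p adapted_chartD(3)[OF ad] by auto
  then show "\<exists>U K. local_model M P p U {} K" using local_model_of_adapted_chart[OF ad] by blast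
next
  fix p N \<phi> L assume "p \<in> Bd_mf M" and c: "chart_on M T N \<phi> L \<and> p \<in> N \<and> \<phi> p = 0"
  obtain V \<Phi> \<kappa> e where V: "V \<subseteq> N" "adapted_chart p V \<Phi> L \<kappa> e"
    using c by (elim conjE) (rule adapted_chart_exists)
  show "\<exists>U\<subseteq>N. \<exists>K. local_model M P p U L K" using local_model_of_adapted_chart[OF V(2)] V(1) by blast
qed

end

subsection \<open>Strata and facets\<close>

lemma connectedin_locally_constant:
  assumes C: "connectedin X C" and loc: "\<And>p. p \<in> C \<Longrightarrow> \<exists>V. openin X V \<and> p \<in> V \<and> (\<forall>q\<in>V \<inter> C. f q = f p)"
    and p: "p \<in> C" and q: "q \<in> C"
  shows "f q = f p"
proof -
  have o: "openin (subtopology X C) {r \<in> C. f r \<in> A}" for A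
  proof (subst openin_subopen, clarify)
    fix r assume r: "r \<in> C" "f r \<in> A"
    obtain V where V: "openin X V" "r \<in> V" "\<forall>q\<in>V \<inter> C. f q = f r" using loc[OF r(1)] by blast
    have "openin (subtopology X C) (C \<inter> V)" by (rule openin_subtopology_Int2[OF V(1)])
    moreover have "C \<inter> V \<subseteq> {r \<in> C. f r \<in> A}" using V(3) r(2) by auto
    ultimately show "\<exists>Ta. openin (subtopology X C) Ta \<and> r \<in> Ta \<and> Ta \<subseteq> {r \<in> C. f r \<in> A}"
      using r(1) V(2) by blast
  qed
  have top: "topspace (subtopology X C) = C" using connectedin_subset_topspace[OF C] by auto
  have "C - {r \<in> C. f r \<in> {f p}} = {r \<in> C. f r \<in> - {f p}}" by auto
  then have cl: "closedin (subtopology X C) {r \<in> C. f r \<in> {f p}}"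
    unfolding closedin_def top using o[of "- {f p}"] by auto
  have "connectedin (subtopology X C) C" using C by (simp add: connectedin_subtopology)
  then have "C \<subseteq> {r \<in> C. f r \<in> {f p}} \<or> disjnt C {r \<in> C. f r \<in> {f p}}"
    using connectedin_clopen_cases cl o by blast
  then show ?thesis using p q by (auto simp: disjnt_def)
qed

context regular_cover
begin

lemma generic_point_in_block:
  assumes B: "B \<in> P" "p \<in> B" and X: "openin (mtop M) X" "p \<in> X"
  obtains q where "q \<in> X" "q \<in> B" "\<chi>_at q = idx B" "walls_at q = {}"
proof -
  obtain V \<Phi> L \<kappa> e where ad: "adapted_chart p V \<Phi> L \<kappa> e"
    by (rule adapted_chart_at[OF in_block(3)[OF B]])
  note a = adapted_chartD[OF ad]
  have o: "openin (mtop M) (X \<inter> V)" using X(1) a(8) by (rule openin_Int)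
  obtain q where q: "q \<in> X \<inter> V" "\<chi>_at q = idx B - {}" "walls_at q = {}"
    by (rule generic_point[OF in_block(3,4,5)[OF B] o _ empty_subsetI]) (use X a in auto)
  have qT: "q \<in> T" using q(1) a(10) by blast
  then have "q \<in> Y (idx B) \<inter> V" using Y_iff[OF qT] q by auto
  then have "q \<in> B"
    using component_over_in_adapted_chart(1)[OF ad is_component_over_idx[OF B(1)]] B(2) a(2) by blast
  then show ?thesis using q by (intro that[of q]) auto
qed

text \<open>Makes the codimension of a local model a property of the point. Every block meeting the
  model contains \<open>p\<close>, since every sign orthant contains the origin; blocks are told
  apart by their traces and sign patterns by their strict points.\<close>

lemma card_blocks_local_model:
  assumes "local_model M P p W L K"
  shows "card {B \<in> P. p \<in> B} = 2 ^ card K"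
proof -
  obtain \<phi> where LK: "L \<inter> K = {}" and \<phi>: "chart_on M T W \<phi> L" "p \<in> W" "\<phi> p = 0"
    and eq: "{\<phi> ` (B \<inter> W) |B. B \<in> P \<and> B \<inter> W \<noteq> {}} = {\<phi> ` W \<inter> sign_orthant K S |S. S \<subseteq> K}"
    using assms unfolding local_model_def by blast
  have inj: "inj_on \<phi> W" by (rule chart_on_inj[OF \<phi>(1)])
  have oW: "openin (mtop M) W" using chart_on_openin[OF \<phi>(1)] by simp
  have pB: "p \<in> B" if B: "B \<in> P" "B \<inter> W \<noteq> {}" for B
  proof -
    have "\<phi> ` (B \<inter> W) \<in> {\<phi> ` W \<inter> sign_orthant K S |S. S \<subseteq> K}" using eq B by blast
    then obtain S' where S': "\<phi> ` (B \<inter> W) = \<phi> ` W \<inter> sign_orthant K S'" by blast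
    have "\<phi> p \<in> \<phi> ` W \<inter> sign_orthant K S'" using \<phi>(2,3) by (auto simp: sign_orthant_def)
    then obtain b where "b \<in> B" "b \<in> W" "\<phi> b = \<phi> p" unfolding S'[symmetric] by auto
    then show ?thesis using inj \<phi>(2) by (metis inj_onD)
  qed
  have "card ((\<lambda>B. \<phi> ` (B \<inter> W)) ` {B \<in> P. p \<in> B}) = card {B \<in> P. p \<in> B}"
  proof (rule card_image, rule inj_onI)
    fix B B' assume B: "B \<in> {B \<in> P. p \<in> B}" and B': "B' \<in> {B \<in> P. p \<in> B}" and "\<phi> ` (B \<inter> W) = \<phi> ` (B' \<inter> W)"
    then have BB': "B \<inter> W = B' \<inter> W" using inj_on_image_eq_iff[OF inj Int_lower2 Int_lower2] by blast
    obtain q where q: "q \<in> W" "q \<in> B" "\<chi>_at q = idx B" "walls_at q = {}"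
      by (rule generic_point_in_block[OF _ _ oW \<phi>(2), of B]) (use B in auto)
    then have "q \<in> B'" using BB' by blast
    then have "idx B' = idx B" using in_block(4,5)[of B' q] q B' by auto
    moreover have "B = block (idx B) p" "B' = block (idx B') p"
      by (rule in_block(1); use B B' in blast)+
    ultimately show "B = B'" by metis
  qed
  moreover have "(\<lambda>B. \<phi> ` (B \<inter> W)) ` {B \<in> P. p \<in> B} = (\<lambda>S. \<phi> ` W \<inter> sign_orthant K S) ` Pow K"
  proof -
    have "{B \<in> P. p \<in> B} = {B. B \<in> P \<and> B \<inter> W \<noteq> {}}" using pB \<phi>(2) by blast
    then have "(\<lambda>B. \<phi> ` (B \<inter> W)) ` {B \<in> P. p \<in> B} = {\<phi> ` (B \<inter> W) |B. B \<in> P \<and> B \<inter> W \<noteq> {}}"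
      unfolding setcompr_eq_image by (rule arg_cong)
    also have "\<dots> = (\<lambda>S. \<phi> ` W \<inter> sign_orthant K S) ` Pow K"
      unfolding eq Pow_def by (rule setcompr_eq_image)
    finally show ?thesis .
  qed
  moreover have "card ((\<lambda>S. \<phi> ` W \<inter> sign_orthant K S) ` Pow K) = card (Pow K)"
  proof (rule card_image, rule inj_onI)
    have le: "S1 \<subseteq> S2" if S: "S1 \<subseteq> K" "\<phi> ` W \<inter> sign_orthant K S1 = \<phi> ` W \<inter> sign_orthant K S2" for S1 S2
    proof
      fix i assume i: "i \<in> S1"
      \<comment> \<open>Strictly of pattern \<open>S1\<close> in the directions of \<open>K\<close>,
        so its signs recover \<open>S1\<close>.\<close>
      define u :: "real ^ 'n" where "u = (\<chi> k. if k \<in> S1 then 1 else if k \<in> K then - 1 else 0)"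
      have "u \<in> orthant (active L (\<phi> p))" using LK S(1) by (auto simp: u_def orthant_def)
      then have "ray_in (\<phi> ` (W \<inter> W)) (\<phi> p) u"
        by (intro ray_in_chart[OF \<phi>(1)]) (use \<phi>(2) oW in auto)
      then obtain t where t: "0 < t" "t *\<^sub>R u \<in> \<phi> ` W"
        unfolding ray_in_def \<phi>(3) by (metis add_0 inf.idem less_imp_le order_refl)
      then have "t *\<^sub>R u \<in> \<phi> ` W \<inter> sign_orthant K S1" using S(1) by (auto simp: sign_orthant_def u_def)
      then have "t *\<^sub>R u \<in> sign_orthant K S2" using S(2) by blast
      then show "i \<in> S2" using i t(1) S(1) unfolding sign_orthant_def u_def by force
    qed
    fix S1 S2 assume "S1 \<in> Pow K" "S2 \<in> Pow K" "\<phi> ` W \<inter> sign_orthant K S1 = \<phi> ` W \<inter> sign_orthant K S2"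
    then show "S1 = S2" using le[of S1 S2] le[of S2 S1] by auto
  qed
  ultimately show ?thesis by (simp add: card_Pow)
qed

text \<open>An arbitrary model and an adapted chart at the same point count the same blocks, so
  \<open>2 ^ card K\<close> and \<open>2 ^ card (walls_at p)\<close> agree.\<close>

lemma stratum_eq: "stratum M P k = {p \<in> T. card (walls_at p) = k}"
proof (intro set_eqI iffI)
  have ad: "local_model M P p V L (\<kappa> ` walls_at p)" "card (\<kappa> ` walls_at p) = card (walls_at p)"
    if "adapted_chart p V \<Phi> L \<kappa> e" for p V \<Phi> L \<kappa> e
    using local_model_of_adapted_chart[OF that] adapted_chartD(6)[OF that] by (auto simp: card_image)
  {
    fix p assume "p \<in> stratum M P k"
    then obtain W L K where lm: "local_model M P p W L K" "card K = k" unfolding stratum_def by blast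
    have pT: "p \<in> T"
    proof -
      obtain \<phi> where "chart_on M T W \<phi> L" "p \<in> W" using lm(1) unfolding local_model_def by blast
      then show ?thesis using chart_on_subset by blast
    qed
    obtain V \<Phi> L' \<kappa> e where a: "adapted_chart p V \<Phi> L' \<kappa> e" by (rule adapted_chart_at[OF pT])
    have "2 ^ card K = (2 :: nat) ^ card (walls_at p)"
      using card_blocks_local_model[OF lm(1)] card_blocks_local_model[OF ad(1)[OF a]] ad(2)[OF a] by simp
    then show "p \<in> {p \<in> T. card (walls_at p) = k}" using lm(2) pT by simp
  }
  fix p assume p: "p \<in> {p \<in> T. card (walls_at p) = k}"
  then have pT: "p \<in> T" by simp
  obtain V \<Phi> L \<kappa> e where a: "adapted_chart p V \<Phi> L \<kappa> e" by (rule adapted_chart_at[OF pT])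
  show "p \<in> stratum M P k" unfolding stratum_def using ad[OF a] p by blast
qed

text \<open>Inside an adapted chart walls can only be lost, so equal number means equal sets; then
  all wall coordinates vanish and no index is gained.\<close>

lemma stratum_locally_constant:
  assumes "adapted_chart p V \<Phi> L \<kappa> e" "q \<in> V" "card (walls_at q) = card (walls_at p)"
  shows "walls_at q = walls_at p" "\<chi>_at q = \<chi>_at p"
proof -
  show w: "walls_at q = walls_at p"
    using chi_in_adapted_chart(2)[OF assms(1,2)] assms(3) walls_at_subset(2)
    by (metis (no_types, lifting) card_subset_eq mem_Collect_eq subsetI)
  then have "\<Phi> q $ \<kappa> j = 0" if "j \<in> walls_at p" for j
    using chi_in_adapted_chart(2)[OF assms(1,2)] that by blast
  then show "\<chi>_at q = \<chi>_at p" using chi_in_adapted_chart(1)[OF assms(1,2)] by auto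
qed

text \<open>The component before taking its closure. Walls and index set are constant on it but need
  not be on the closure, so arguments about a facet use points of its core.\<close>

definition facet_core :: "nat \<Rightarrow> 'a set \<Rightarrow> bool" where
  "facet_core k C \<longleftrightarrow> C \<in> connected_components_of (subtopology (mtop M) (stratum M P k))"

lemma facets_eq: "facets M P k = (\<lambda>C. mtop M closure_of C) ` {C. facet_core k C}"
  by (simp add: facets_def facet_core_def)

lemma facet_core:
  assumes "facet_core k C"
  shows "C \<noteq> {}" "connectedin (mtop M) C" "C \<subseteq> stratum M P k" "C \<subseteq> T"
    "\<And>X. connectedin (mtop M) X \<Longrightarrow> X \<subseteq> stratum M P k \<Longrightarrow> X \<inter> C \<noteq> {} \<Longrightarrow> X \<subseteq> C"
proof -
  note C = assms[unfolded facet_core_def]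
  show "C \<noteq> {}" by (rule nonempty_connected_components_of[OF C])
  show "connectedin (mtop M) C"
    using connectedin_connected_components_of[OF C] by (simp add: connectedin_subtopology)
  show "C \<subseteq> stratum M P k" "C \<subseteq> T" using connected_components_of_subset[OF C] by auto
  show "X \<subseteq> C" if "connectedin (mtop M) X" "X \<subseteq> stratum M P k" "X \<inter> C \<noteq> {}" for X
    using connected_components_of_maximal[OF C, of X] that by (auto simp: connectedin_subtopology disjnt_def)
qed

lemma facet_core_constant:
  assumes C: "facet_core k C" and p: "p \<in> C" and q: "q \<in> C"
  shows "walls_at q = walls_at p" "\<chi>_at q = \<chi>_at p"
proof -
  have "(walls_at q, \<chi>_at q) = (walls_at p, \<chi>_at p)"
  proof (rule connectedin_locally_constant[OF facet_core(2)[OF C] _ p q, where f = "\<lambda>q. (walls_at q, \<chi>_at q)"])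
    fix r assume r: "r \<in> C"
    obtain V \<Phi> L \<kappa> e where ad: "adapted_chart r V \<Phi> L \<kappa> e"
      by (rule adapted_chart_at[OF subsetD[OF facet_core(4)[OF C] r]])
    have "(walls_at q, \<chi>_at q) = (walls_at r, \<chi>_at r)" if "q \<in> V \<inter> C" for q
      using stratum_locally_constant[OF ad, of q] facet_core(3)[OF C] r that unfolding stratum_eq by auto
    then show "\<exists>V. openin (mtop M) V \<and> r \<in> V \<and> (\<forall>q\<in>V \<inter> C. (walls_at q, \<chi>_at q) = (walls_at r, \<chi>_at r))"
      using adapted_chartD(2,8)[OF ad] by blast
  qed
  then show "walls_at q = walls_at p" "\<chi>_at q = \<chi>_at p" by auto
qed

text \<open>The core is connected and stays in one \<open>Y (idx B)\<close>, so it cannot leave the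
  component \<open>B\<close> once it meets it; blocks are closed.\<close>

lemma facet_subset_block_iff:
  assumes C: "facet_core k C" and p: "p \<in> C" and B: "B \<in> P"
  shows "mtop M closure_of C \<subseteq> B \<longleftrightarrow> p \<in> B"
proof
  show "p \<in> B" if "mtop M closure_of C \<subseteq> B"
    using that p closure_of_subset[OF facet_core(4)[OF C]] by blast
  assume pB: "p \<in> B"
  note c = component_over[OF is_component_over_idx[OF B]]
  have "C \<subseteq> Y (idx B)"
  proof
    fix q assume q: "q \<in> C"
    have qT: "q \<in> T" using q facet_core(4)[OF C] by blast
    show "q \<in> Y (idx B)"
      unfolding Y_iff[OF qT] facet_core_constant[OF C p q] using in_block(4,5)[OF B pB] by blast
  qed
  then have "C \<subseteq> B" by (rule c(5)[OF facet_core(2)[OF C]]) (use p pB in blast)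
  then show "mtop M closure_of C \<subseteq> B" by (rule closure_of_minimal[OF _ c(4)])
qed

lemma closedin_frontier: "j \<in> J \<Longrightarrow> closedin (mtop M) (S j - U j)"
  by (intro closedin_diff closedin_closure_of openin_U)

text \<open>\<open>wall\<close> is defined through \<open>Int_mf M\<close> and then closed up. Over
  the boundary nothing is lost: from a frontier point one can move off the boundary of
  \<open>M\<close> while staying on all its walls.\<close>

lemma wall_eq_frontier:
  assumes j: "j \<in> J"
  shows "wall M U j = S j - U j"
proof -
  have eq: "mf_boundary M (S j) \<inter> Int_mf M = (S j - U j) \<inter> Int_mf M"
  proof (intro set_eqI iffI)
    fix p assume p: "p \<in> mf_boundary M (S j) \<inter> Int_mf M"
    then have pT: "p \<in> T" and pS: "p \<in> S j" by (auto simp: mf_boundary_def)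
    have "p \<notin> U j"
    proof
      assume pU: "p \<in> U j"
      obtain V \<Phi> L \<kappa> e where ad: "adapted_chart p V \<Phi> L \<kappa> e" by (rule adapted_chart_at[OF pT])
      note a = adapted_chartD[OF ad]
      have "V \<subseteq> S j" using ad pU j unfolding adapted_chart_def by blast
      have id: "smooth_diffeo UNIV UNIV id (id :: real ^ 'n \<Rightarrow> real ^ 'n)"
        by (auto simp: smooth_diffeo_def homeomorphism_def id_def intro!: smooth_on_bounded_linear bounded_linear_ident)
      have "chart_on M (S j) V (id \<circ> \<Phi>) L"
        by (rule chart_on_transform[OF manifold a(1) _ _ id])
          (use a(5,8) \<open>V \<subseteq> S j\<close> in \<open>auto intro: openin_open_Int open_cube openin_open_subtopology[THEN iffD2] openin_subset_topspace_eq simp: openin_subtopology\<close>)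
      then have "p \<in> mf_interior M (S j)"
        using mf_interior_chart[of M "S j" V "id \<circ> \<Phi>" L p] a(2) interior_in_adapted_chart[OF ad a(2)] p by force
      then show False using p by (simp add: mf_boundary_def)
    qed
    then show "p \<in> (S j - U j) \<inter> Int_mf M" using p pS by blast
  next
    fix p assume p: "p \<in> (S j - U j) \<inter> Int_mf M"
    have "p \<notin> mf_interior M (S j)" using mf_interior_open(1)[OF manifold, of p "S j"] U_interior[OF j] p by blast
    then show "p \<in> mf_boundary M (S j) \<inter> Int_mf M" using p S_subset by (auto simp: mf_boundary_def)
  qed
  show ?thesis
    unfolding wall_def eq
  proof
    show "mtop M closure_of ((S j - U j) \<inter> Int_mf M) \<subseteq> S j - U j"
      by (rule closure_of_minimal[OF Int_lower1 closedin_frontier[OF j]])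
    show "S j - U j \<subseteq> mtop M closure_of ((S j - U j) \<inter> Int_mf M)"
    proof
      fix p assume p: "p \<in> S j - U j"
      then have pT: "p \<in> T" using S_subset by blast
      have jp: "j \<in> walls_at p" using p j by (simp add: walls_at_def)
      show "p \<in> mtop M closure_of ((S j - U j) \<inter> Int_mf M)"
        unfolding in_closure_of
      proof (intro conjI allI impI pT)
        fix X assume X: "p \<in> X \<and> openin (mtop M) X"
        obtain q where "q \<in> X" "walls_at q = walls_at p" "q \<in> Int_mf M"
          by (rule generic_point[OF pT _ _ conjunct2[OF X] conjunct1[OF X] subset_refl, of "\<chi>_at p"]) auto
        then show "\<exists>y. y \<in> (S j - U j) \<inter> Int_mf M \<and> y \<in> X" using jp unfolding walls_at_def by blast
      qed
    qed
  qed
qed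

lemma facet_subset_wall_iff:
  assumes C: "facet_core k C" and p: "p \<in> C" and j: "j \<in> J"
  shows "mtop M closure_of C \<subseteq> wall M U j \<longleftrightarrow> j \<in> walls_at p"
  unfolding wall_eq_frontier[OF j]
proof
  show "j \<in> walls_at p" if "mtop M closure_of C \<subseteq> S j - U j"
    using that p j closure_of_subset[OF facet_core(4)[OF C]] by (auto simp: walls_at_def)
  assume "j \<in> walls_at p"
  then have "C \<subseteq> S j - U j" using facet_core_constant(1)[OF C p] by (auto simp: walls_at_def)
  then show "mtop M closure_of C \<subseteq> S j - U j" by (rule closure_of_minimal[OF _ closedin_frontier[OF j]])
qed

text \<open>Near each point of \<open>C\<close> the points off the wall \<open>j\<close> on a given side that stay on the other walls form
  a connected set, so having that set in a common component \<open>C'\<close> propagates along \<open>C\<close>.\<close>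

lemma larger_facet:
  assumes C: "facet_core (Suc k) C" and p: "p \<in> C" and j: "j \<in> walls_at p"
    and B: "B \<in> P" "p \<in> B" and B': "B' \<in> P" "p \<in> B'" and side: "j \<in> idx B \<longleftrightarrow> j \<in> idx B'"
  obtains Z' where "Z' \<in> facets M P k" "mtop M closure_of C \<subseteq> Z'" "Z' \<subseteq> B" "Z' \<subseteq> B'"
proof -
  \<comment> \<open>\<open>R\<close> and \<open>A\<close> are to be the walls and the index set of
    the larger facet: the wall \<open>j\<close> is left towards the side of
    \<open>B\<close>.\<close>
  define R where "R = walls_at p - {j}"
  define A where "A = idx B - R"
  have pT: "p \<in> T" using p facet_core(4)[OF C] by blast
  note iB = in_block(4,5)[OF B] and iB' = in_block(4,5)[OF B']
  have cardR: "card R = k"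
    using facet_core(3)[OF C] p j walls_at_subset(2) unfolding R_def stratum_eq by auto
  have near: "\<exists>x\<in>X. walls_at x = R \<and> \<chi>_at x = A" if r: "r \<in> C" "openin (mtop M) X" "r \<in> X" for r X
  proof -
    have rT: "r \<in> T" using r facet_core(4)[OF C] by blast
    note con = facet_core_constant[OF C p r(1)]
    obtain x where "x \<in> X" "\<chi>_at x = idx B - R" "walls_at x = R"
      by (rule generic_point[OF rT _ _ r(2,3), of "idx B" R]) (use iB con in \<open>auto simp: R_def\<close>)
    then show ?thesis by (auto simp: A_def)
  qed
  define H where "H V = {x \<in> V. walls_at x = R \<and> \<chi>_at x = A}" for V
  have Hconn: "connectedin (mtop M) (H V)" if r: "r \<in> C" and ad: "adapted_chart r V \<Phi> L \<kappa> e" for r V \<Phi> L \<kappa> e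
  proof -
    note con = facet_core_constant[OF C p r]
    \<comment> \<open>The walls in \<open>R\<close> are kept and the coordinate of \<open>j\<close>
      gets a strict sign; convexity gives one local piece only.\<close>
    define X where "X = (\<Inter>i\<in>R. (\<lambda>x :: real ^ 'n. x $ \<kappa> i) -` {0}) \<inter> (\<lambda>x. x $ \<kappa> j) -` (if j \<in> idx B then {0<..} else {..<0})"
    have vim: "convex ((\<lambda>x :: real ^ 'n. x $ k) -` I)" if "convex I" for k I
      by (rule convex_linear_vimage[OF bounded_linear.linear[OF bounded_linear_vec_nth] that])
    have "convex X" unfolding X_def by (intro convex_Int convex_INT vim) auto
    then have "connectedin (mtop M) {q \<in> V. \<Phi> q \<in> X}" by (rule connected_in_adapted_chart[OF ad])
    moreover have "H V = {q \<in> V. \<Phi> q \<in> X}"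
    proof -
      have "walls_at x = R \<and> \<chi>_at x = A \<longleftrightarrow> \<Phi> x \<in> X" if x: "x \<in> V" for x
      proof -
        have AA: "A = \<chi>_at p \<union> (idx B \<inter> {j})"
          unfolding A_def R_def using iB chi_walls_disjoint[of p] j by blast
        have wR: "walls_at p = insert j R" "j \<notin> R" using j by (auto simp: R_def)
        have "walls_at x = R \<longleftrightarrow> (\<forall>i\<in>R. \<Phi> x $ \<kappa> i = 0) \<and> \<Phi> x $ \<kappa> j \<noteq> 0"
          unfolding chi_in_adapted_chart(2)[OF ad x] con wR(1) using wR(2) by auto
        moreover have "\<chi>_at x = A \<longleftrightarrow> (j \<in> idx B \<longleftrightarrow> 0 < \<Phi> x $ \<kappa> j)" if "\<forall>i\<in>R. \<Phi> x $ \<kappa> i = 0"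
        proof -
          have "{i \<in> walls_at p. 0 < \<Phi> x $ \<kappa> i} = {i \<in> {j}. 0 < \<Phi> x $ \<kappa> i}"
            unfolding wR(1) using that by auto
          then show ?thesis
            unfolding chi_in_adapted_chart(1)[OF ad x] con AA using j chi_walls_disjoint[of p] by auto
        qed
        ultimately show ?thesis by (auto simp: X_def)
      qed
      then show ?thesis unfolding H_def by blast
    qed
    ultimately show ?thesis by simp
  qed
  obtain V0 \<Phi>0 L0 \<kappa>0 e0 where ad0: "adapted_chart p V0 \<Phi>0 L0 \<kappa>0 e0" by (rule adapted_chart_at[OF pT])
  note a0 = adapted_chartD[OF ad0]
  obtain q where q: "q \<in> V0" "walls_at q = R" "\<chi>_at q = A" using near[OF p a0(8,2)] by blast
  have qT: "q \<in> T" using q(1) a0(10) by blast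
  have qst: "q \<in> stratum M P k" unfolding stratum_eq using q(2) cardR qT by simp
  define C' where "C' = connected_component_of_set (subtopology (mtop M) (stratum M P k)) q"
  have C': "facet_core k C'"
    unfolding facet_core_def C'_def connected_components_of_def using qst qT by auto
  have qC': "q \<in> C'" unfolding C'_def using qst qT by (simp add: connected_component_of_refl)
  have Hst: "H V \<subseteq> stratum M P k" if "V \<subseteq> T" for V
    unfolding H_def stratum_eq using cardR that by auto
  let ?Z' = "mtop M closure_of C'"
  \<comment> \<open>If \<open>C'\<close> meets the chart, it contains the whole local piece
    \<open>H V\<close>, which accumulates at all points of \<open>C\<close> in the chart.\<close>
  have spread: "V \<inter> C \<subseteq> ?Z'" if r: "r \<in> C" and ad: "adapted_chart r V \<Phi> L \<kappa> e" and ne: "V \<inter> C' \<noteq> {}" for r V \<Phi> L \<kappa> e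
  proof
    note a = adapted_chartD[OF ad]
    obtain x where x: "x \<in> V" "x \<in> C'" using ne by blast
    have "x \<in> H V" using facet_core_constant[OF C' qC' x(2)] q x(1) by (simp add: H_def)
    then have HC': "H V \<subseteq> C'" using x(2) by (intro facet_core(5)[OF C' Hconn[OF r ad] Hst[OF a(10)]]) blast
    fix r' assume r': "r' \<in> V \<inter> C"
    show "r' \<in> ?Z'"
      unfolding in_closure_of
    proof (intro conjI allI impI)
      show "r' \<in> T" using r' a(10) by blast
      fix X assume X: "r' \<in> X \<and> openin (mtop M) X"
      have "\<exists>x\<in>X \<inter> V. walls_at x = R \<and> \<chi>_at x = A"
        by (rule near) (use r' X a(8) in \<open>auto intro: openin_Int\<close>)
      then show "\<exists>y. y \<in> C' \<and> y \<in> X" using HC' unfolding H_def by blast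
    qed
  qed
  have "(r \<in> ?Z') = (p \<in> ?Z')" if "r \<in> C" for r
  proof (rule connectedin_locally_constant[OF facet_core(2)[OF C] _ p that, where f = "\<lambda>r. r \<in> ?Z'"])
    fix r assume r: "r \<in> C"
    obtain V \<Phi> L \<kappa> e where ad: "adapted_chart r V \<Phi> L \<kappa> e"
      by (rule adapted_chart_at[OF subsetD[OF facet_core(4)[OF C] r]])
    note a = adapted_chartD[OF ad]
    have "(x \<in> ?Z') = (r \<in> ?Z')" if x: "x \<in> V \<inter> C" for x
    proof (cases "V \<inter> C' = {}")
      case True
      then have "y \<notin> ?Z'" if "y \<in> V" for y using that a(8) unfolding in_closure_of by blast
      then show ?thesis using x a(2) by blast
    next
      case False
      then show ?thesis using spread[OF r ad] x a(2) r by blast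
    qed
    then show "\<exists>V. openin (mtop M) V \<and> r \<in> V \<and> (\<forall>q\<in>V \<inter> C. (q \<in> ?Z') = (r \<in> ?Z'))" using a(2,8) by blast
  qed
  moreover have "p \<in> ?Z'" using spread[OF p ad0] q(1) qC' a0(2) p by blast
  ultimately have "C \<subseteq> ?Z'" by blast
  then have "mtop M closure_of C \<subseteq> ?Z'" by (rule closure_of_minimal) simp
  moreover have "q \<in> B"
  proof -
    have "q \<in> Y (idx B)" unfolding Y_iff[OF qT] q by (auto simp: A_def)
    then show ?thesis
      using component_over_in_adapted_chart(1)[OF ad0 is_component_over_idx[OF B(1)]] B(2) a0(2) q(1) by blast
  qed
  \<comment> \<open>Since \<open>B\<close> and \<open>B'\<close> lie on the same side of
    \<open>j\<close>, \<open>idx B'\<close> is admissible at \<open>q\<close> too.\<close>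
  moreover have "q \<in> B'"
  proof -
    have "q \<in> Y (idx B')"
      unfolding Y_iff[OF qT] q A_def R_def using iB iB' side j chi_walls_disjoint[of p] by blast
    then show ?thesis
      using component_over_in_adapted_chart(1)[OF ad0 is_component_over_idx[OF B'(1)]] B'(2) a0(2) q(1) by blast
  qed
  ultimately show ?thesis
    using that[of ?Z'] C' facet_subset_block_iff[OF C' qC'] B(1) B'(1) unfolding facets_eq by blast
qed

end

section \<open>Tensor bundles\<close>

lemma sum_fun_apply: "(\<Sum>f\<in>F. (\<lambda>x. g f x)) x = (\<Sum>f\<in>F. g f x :: complex)"
  by (induction F rule: infinite_finite_induct) auto

lemma sum_in_span: "(\<lambda>x. \<Sum>f\<in>F. c f * t f x) \<in> cfun.span (t ` F)"
proof -
  have "(\<lambda>x. \<Sum>f\<in>F. c f * t f x) = (\<Sum>f\<in>F. (\<lambda>x. c f * t f x))"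
    by (rule ext) (simp add: sum_fun_apply)
  moreover have "\<dots> \<in> cfun.span (t ` F)"
    by (intro cfun.span_sum cfun.span_scale cfun.span_base imageI)
  ultimately show ?thesis by metis
qed

lemma in_span_finite_family:
  assumes "finite F" "inj_on t F" "v \<in> cfun.span (t ` F)"
  obtains c where "\<forall>x. v x = (\<Sum>f\<in>F. c f * t f x)"
proof -
  obtain u where "v = (\<Sum>w\<in>t ` F. (\<lambda>x. u w * w x))"
    using assms(3) cfun.span_finite[of "t ` F"] assms(1) by auto
  then have "\<forall>x. v x = (\<Sum>f\<in>F. u (t f) * t f x)"
    by (simp add: sum_fun_apply sum.reindex[OF assms(2)])
  then show ?thesis by (rule that)
qed

text \<open>\<open>cfun.independent\<close> speaks of sets and would not notice repetitions in a
  family; the criterion by indexed coefficients yields injectivity as well.\<close>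

lemma independent_familyI:
  fixes t :: "'f \<Rightarrow> 'b \<Rightarrow> complex"
  assumes fin: "finite F" and zero: "\<And>c f. (\<And>x. (\<Sum>f\<in>F. c f * t f x) = 0) \<Longrightarrow> f \<in> F \<Longrightarrow> c f = 0"
  shows "inj_on t F" "cfun.independent (t ` F)"
proof -
  show inj: "inj_on t F"
  proof (rule inj_onI, rule ccontr)
    fix f g assume fg: "f \<in> F" "g \<in> F" "t f = t g" "f \<noteq> g"
    define c where "c h = (if h = f then 1 else if h = g then - 1 else 0 :: complex)" for h
    have "(\<Sum>h\<in>F. c h * t h x) = (\<Sum>h\<in>{f, g}. c h * t h x)" for x
      by (rule sum.mono_neutral_right) (use fin fg in \<open>auto simp: c_def\<close>)
    then have "(\<Sum>h\<in>F. c h * t h x) = 0" for x using fg by (simp add: c_def)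
    from zero[OF this fg(1)] show False by (simp add: c_def)
  qed
  show "cfun.independent (t ` F)"
  proof (rule cfun.independent_if_scalars_zero)
    show "finite (t ` F)" using fin by simp
    fix u v assume u: "(\<Sum>w\<in>t ` F. (\<lambda>x. u w * w x)) = 0" and v: "v \<in> t ` F"
    have "(\<Sum>f\<in>F. u (t f) * t f x) = 0" for x
      using fun_cong[OF u, of x] by (simp add: sum_fun_apply sum.reindex[OF inj])
    then show "u v = 0" using zero[of "\<lambda>f. u (t f)"] v by blast
  qed
qed

lemma independent_familyD:
  assumes "finite F" "inj_on t F" "cfun.independent (t ` F)" "\<And>x. (\<Sum>f\<in>F. c f * t f x) = 0" "f \<in> F"
  shows "c f = 0"
proof -
  have "(\<Sum>w\<in>t ` F. (\<lambda>x. c (inv_into F t w) * w x)) = 0"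
    by (rule ext) (use assms(2,4) in \<open>simp add: sum_fun_apply sum.reindex\<close>)
  then have "c (inv_into F t (t f)) = 0"
    using cfun.independentD[OF assms(3) _ subset_refl, of "\<lambda>w. c (inv_into F t w)" "t f"] assms(1,5) by simp
  then show ?thesis using assms(2,5) by simp
qed

text \<open>Independence is \<open>tensor_vec_indep\<close>, and spanning is the expansion of a
  product of sums over choice functions. \<open>Pi\<^sub>E\<close> fixes the choice functions off
  \<open>A\<close>, so that distinct indices give distinct tensors.\<close>

lemma tensor_basis:
  fixes b :: "nat \<Rightarrow> 'k \<Rightarrow> 'b \<Rightarrow> complex"
  assumes A: "finite A" and I: "\<And>j. j \<in> A \<Longrightarrow> finite (I j)"
    and inj: "\<And>j. j \<in> A \<Longrightarrow> inj_on (b j) (I j)"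
    and ind: "\<And>j. j \<in> A \<Longrightarrow> cfun.independent (b j ` I j)"
    and span: "\<And>j. j \<in> A \<Longrightarrow> cfun.span (b j ` I j) = E j"
  defines "t \<equiv> \<lambda>f. tensor_vec A (\<lambda>j. b j (f j))"
  shows "inj_on t (Pi\<^sub>E A I)" "cfun.independent (t ` Pi\<^sub>E A I)" "cfun.span (t ` Pi\<^sub>E A I) = tensor_space A E"
proof -
  have fin: "finite (Pi\<^sub>E A I)" using A I by (rule finite_PiE)
  \<comment> \<open>The default \<open>undefined\<close> off \<open>A\<close> makes families that
    agree on \<open>A\<close> equal, as \<open>tensor_vec_indep\<close> requires.\<close>
  define g where "g f = (\<lambda>j. if j \<in> A then b j (f j) else undefined)" for f
  have tg: "t f = tensor_vec A (g f)" for f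
    by (auto simp: t_def tensor_vec_def g_def intro!: ext prod.cong)
  have injg: "inj_on g (Pi\<^sub>E A I)"
  proof (rule inj_onI)
    fix f f' assume f: "f \<in> Pi\<^sub>E A I" "f' \<in> Pi\<^sub>E A I" "g f = g f'"
    show "f = f'"
    proof (rule PiE_ext[OF f(1,2)])
      fix j assume j: "j \<in> A"
      have "b j (f j) = b j (f' j)" using fun_cong[OF f(3), of j] j by (simp add: g_def)
      then show "f j = f' j" using inj[OF j] f(1,2) j by (auto dest: inj_onD)
    qed
  qed
  have zero: "c f = 0" if c: "\<And>x. (\<Sum>f\<in>Pi\<^sub>E A I. c f * t f x) = 0" and f: "f \<in> Pi\<^sub>E A I" for c f
  proof -
    have "c (inv_into (Pi\<^sub>E A I) g (g f)) = 0"
    proof (rule tensor_vec_indep[OF A ind, where T = "g ` Pi\<^sub>E A I" and c = "\<lambda>h. c (inv_into (Pi\<^sub>E A I) g h)"])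
      show "finite (g ` Pi\<^sub>E A I)" using fin by simp
      show "f j \<in> b j ` I j" if "f \<in> g ` Pi\<^sub>E A I" "j \<in> A" for f j using that by (auto simp: g_def)
      show "h = h'" if "h \<in> g ` Pi\<^sub>E A I" "h' \<in> g ` Pi\<^sub>E A I" "\<forall>j\<in>A. h j = h' j" for h h'
        using that by (auto simp: g_def fun_eq_iff)
      show "(\<Sum>h\<in>g ` Pi\<^sub>E A I. c (inv_into (Pi\<^sub>E A I) g h) * tensor_vec A h x) = 0" for x
        using c[of x] by (simp add: sum.reindex[OF injg] injg tg)
    qed (use f in auto)
    then show ?thesis using injg f by simp
  qed
  show "inj_on t (Pi\<^sub>E A I)" "cfun.independent (t ` Pi\<^sub>E A I)"
    using independent_familyI[OF fin, of t] zero by blast+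
  show "cfun.span (t ` Pi\<^sub>E A I) = tensor_space A E"
  proof
    show "cfun.span (t ` Pi\<^sub>E A I) \<subseteq> tensor_space A E"
      unfolding tensor_space_def
    proof (rule cfun.span_mono, clarify)
      fix f assume f: "f \<in> Pi\<^sub>E A I"
      have "b j (f j) \<in> E j" if "j \<in> A" for j
        using f that cfun.span_base[of "b j (f j)" "b j ` I j"] span[OF that] by auto
      then show "\<exists>v. t f = tensor_vec A v \<and> (\<forall>j\<in>A. v j \<in> E j)" unfolding t_def by blast
    qed
    show "tensor_space A E \<subseteq> cfun.span (t ` Pi\<^sub>E A I)"
      unfolding tensor_space_def
    proof (rule cfun.span_minimal)
      show "cfun.subspace (cfun.span (t ` Pi\<^sub>E A I))" by (rule cfun.subspace_span)
      show "{tensor_vec A v |v. \<forall>j\<in>A. v j \<in> E j} \<subseteq> cfun.span (t ` Pi\<^sub>E A I)"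
      proof clarify
        fix v assume v: "\<forall>j\<in>A. v j \<in> E j"
        have "\<exists>c. \<forall>x. v j x = (\<Sum>i\<in>I j. c i * b j i x)" if j: "j \<in> A" for j
          using in_span_finite_family[OF I[OF j] inj[OF j], of "v j"] span[OF j] v j by metis
        then obtain c where c: "\<And>j x. j \<in> A \<Longrightarrow> v j x = (\<Sum>i\<in>I j. c j i * b j i x)" by metis
        have "tensor_vec A v x = (\<Sum>f\<in>Pi\<^sub>E A I. (\<Prod>j\<in>A. c j (f j)) * t f x)" for x
        proof -
          have "tensor_vec A v x = (\<Prod>j\<in>A. \<Sum>i\<in>I j. c j i * b j i (x j))"
            unfolding tensor_vec_def by (rule prod.cong) (use c in auto)
          also have "\<dots> = (\<Sum>f\<in>Pi\<^sub>E A I. \<Prod>j\<in>A. c j (f j) * b j (f j) (x j))"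
            by (rule prod_sum_PiE[OF A I])
          finally show ?thesis by (simp add: prod.distrib t_def tensor_vec_def)
        qed
        then have "tensor_vec A v = (\<lambda>x. \<Sum>f\<in>Pi\<^sub>E A I. (\<Prod>j\<in>A. c j (f j)) * t f x)" by (rule ext)
        then show "tensor_vec A v \<in> cfun.span (t ` Pi\<^sub>E A I)" by (rule ssubst) (rule sum_in_span)
      qed
    qed
  qed
qed

lemma smooth_comb_subset: "smooth_comb M W I e s \<Longrightarrow> W' \<subseteq> W \<Longrightarrow> smooth_comb M W' I e s"
  unfolding smooth_comb_def by (elim exE) (rule exI, auto intro: smooth_fun_subset)

text \<open>The coefficients of a pure tensor are products of coefficients of its factors, hence
  smooth.\<close>

lemma smooth_comb_tensor:
  fixes e :: "nat \<Rightarrow> 'k \<Rightarrow> 'a \<Rightarrow> 'b \<Rightarrow> complex"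
  assumes A: "finite A" and I: "\<And>j. j \<in> A \<Longrightarrow> finite (I j)"
    and s: "\<And>j. j \<in> A \<Longrightarrow> smooth_comb M W (I j) (e j) (s j)"
  shows "smooth_comb M W (Pi\<^sub>E A I) (\<lambda>f p. tensor_vec A (\<lambda>j. e j (f j) p)) (\<lambda>p. tensor_vec A (\<lambda>j. s j p))"
proof -
  have "\<forall>j\<in>A. \<exists>c :: 'k \<Rightarrow> 'a \<Rightarrow> complex. (\<forall>i\<in>I j. smooth_fun M W (c i)) \<and> (\<forall>p\<in>W. s j p = (\<lambda>x. \<Sum>i\<in>I j. c i p * e j i p x))"
    using s unfolding smooth_comb_def by blast
  from bchoice[OF this] obtain c :: "nat \<Rightarrow> 'k \<Rightarrow> 'a \<Rightarrow> complex" where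
    c: "\<And>j i. j \<in> A \<Longrightarrow> i \<in> I j \<Longrightarrow> smooth_fun M W (c j i)"
    "\<And>j p. j \<in> A \<Longrightarrow> p \<in> W \<Longrightarrow> s j p = (\<lambda>x. \<Sum>i\<in>I j. c j i p * e j i p x)" by blast
  show ?thesis
    unfolding smooth_comb_def
  proof (intro exI[of _ "\<lambda>f p. \<Prod>j\<in>A. c j (f j) p"] conjI ballI)
    fix f assume "f \<in> Pi\<^sub>E A I"
    then show "smooth_fun M W (\<lambda>p. \<Prod>j\<in>A. c j (f j) p)"
      by (intro smooth_fun_prod c) auto
  next
    fix p assume p: "p \<in> W"
    show "tensor_vec A (\<lambda>j. s j p) =
      (\<lambda>x. \<Sum>f\<in>Pi\<^sub>E A I. (\<Prod>j\<in>A. c j (f j) p) * tensor_vec A (\<lambda>j. e j (f j) p) x)"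
    proof
      fix x
      have "tensor_vec A (\<lambda>j. s j p) x = (\<Prod>j\<in>A. \<Sum>i\<in>I j. c j i p * e j i p (x j))"
        unfolding tensor_vec_def by (rule prod.cong) (use c(2) p in auto)
      also have "\<dots> = (\<Sum>f\<in>Pi\<^sub>E A I. \<Prod>j\<in>A. c j (f j) p * e j (f j) p (x j))"
        by (rule prod_sum_PiE[OF A I])
      finally show "tensor_vec A (\<lambda>j. s j p) x =
        (\<Sum>f\<in>Pi\<^sub>E A I. (\<Prod>j\<in>A. c j (f j) p) * tensor_vec A (\<lambda>j. e j (f j) p) x)"
        by (simp add: prod.distrib tensor_vec_def)
    qed
  qed
qed

lemma vector_bundleD:
  assumes "vector_bundle M E"
  shows "openin (mtop M) (base E)" "\<Union>(fst ` frames E) = base E"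
    "(V, I, e) \<in> frames E \<Longrightarrow> openin (mtop M) V" "(V, I, e) \<in> frames E \<Longrightarrow> finite I"
    "(V, I, e) \<in> frames E \<Longrightarrow> p \<in> V \<Longrightarrow> inj_on (\<lambda>i. e i p) I"
    "(V, I, e) \<in> frames E \<Longrightarrow> p \<in> V \<Longrightarrow> cfun.independent ((\<lambda>i. e i p) ` I)"
    "(V, I, e) \<in> frames E \<Longrightarrow> p \<in> V \<Longrightarrow> cfun.span ((\<lambda>i. e i p) ` I) = fibre E p"
    "(V, I, e) \<in> frames E \<Longrightarrow> (V', I', e') \<in> frames E \<Longrightarrow> i \<in> I' \<Longrightarrow> smooth_comb M (V \<inter> V') I e (e' i)"
proof -
  note E = assms[unfolded vector_bundle_def]
  show "openin (mtop M) (base E)" "\<Union>(fst ` frames E) = base E" using E by auto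
  note F = E[THEN conjunct2, THEN conjunct2, THEN bspec, of "(V, I, e)", simplified]
  show "openin (mtop M) V" "finite I" if "(V, I, e) \<in> frames E" using F[OF that] by auto
  show "inj_on (\<lambda>i. e i p) I" "cfun.independent ((\<lambda>i. e i p) ` I)" "cfun.span ((\<lambda>i. e i p) ` I) = fibre E p"
    if "(V, I, e) \<in> frames E" "p \<in> V" using F[OF that(1)] that(2) by auto
  show "smooth_comb M (V \<inter> V') I e (e' i)"
    if "(V, I, e) \<in> frames E" "(V', I', e') \<in> frames E" "i \<in> I'" using F[OF that(1)] that(2,3) by blast
qed

lemma frame_at:
  assumes "vector_bundle M E" "p \<in> base E"
  obtains V I e where "(V, I, e) \<in> frames E" "p \<in> V"
proof -
  have "p \<in> \<Union>(fst ` frames E)" using vector_bundleD(2)[OF assms(1)] assms(2) by simp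
  then obtain F where "F \<in> frames E" "p \<in> fst F" by blast
  then show ?thesis by (cases F) (auto intro: that)
qed

lemma tensor_frameI:
  assumes "\<And>j. j \<in> A \<Longrightarrow> (V j, I j, e j) \<in> frames (H j)"
  shows "(\<Inter>j\<in>A. V j, Pi\<^sub>E A I, \<lambda>f p. tensor_vec A (\<lambda>j. e j (f j) p)) \<in> frames (tensor_bundle A H)"
  unfolding tensor_bundle_def vbundle.select_convs mem_Collect_eq
  by (rule exI[of _ V], rule exI[of _ I], rule exI[of _ e]) (use assms in auto)

lemma tensor_frameE:
  assumes "(V0, I0, e0) \<in> frames (tensor_bundle A H)"
  obtains V I e where "\<forall>j\<in>A. (V j, I j, e j) \<in> frames (H j)"
    "V0 = (\<Inter>j\<in>A. V j)" "I0 = Pi\<^sub>E A I" "e0 = (\<lambda>f p. tensor_vec A (\<lambda>j. e j (f j) p))"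
proof -
  obtain V I e where "(V0, I0, e0) = (\<Inter>j\<in>A. V j, Pi\<^sub>E A I, \<lambda>f p. tensor_vec A (\<lambda>j. e j (f j) p))"
      "\<forall>j\<in>A. (V j, I j, e j) \<in> frames (H j)"
    using assms unfolding tensor_bundle_def vbundle.select_convs mem_Collect_eq by (elim exE conjE)
  then show ?thesis by (intro that[of V I e]) auto
qed

text \<open>Frames are tensor products of frames, compared by \<open>smooth_comb_tensor\<close>.
  \<open>A\<close> is nonempty since an intersection over the empty set would be
  \<open>UNIV\<close>, which need not be open in \<open>mtop M\<close>.\<close>

lemma vector_bundle_tensor:
  fixes H :: "nat \<Rightarrow> ('a, 'b, 'k) vbundle" and M :: "('a, 'n::finite) mcorner"
  assumes A: "finite A" "A \<noteq> {}" and H: "\<And>j. j \<in> A \<Longrightarrow> vector_bundle M (H j)"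
  shows "vector_bundle M (tensor_bundle A H)"
  unfolding vector_bundle_def
proof (intro conjI)
  show "openin (mtop M) (base (tensor_bundle A H))"
    unfolding tensor_bundle_def by simp (intro openin_INT2 A vector_bundleD(1) H)
  show "\<Union>(fst ` frames (tensor_bundle A H)) = base (tensor_bundle A H)"
  proof
    show "\<Union>(fst ` frames (tensor_bundle A H)) \<subseteq> base (tensor_bundle A H)"
    proof
      fix p assume "p \<in> \<Union>(fst ` frames (tensor_bundle A H))"
      then obtain V0 I0 e0 where F: "(V0, I0, e0) \<in> frames (tensor_bundle A H)" "p \<in> V0" by fastforce
      obtain V I e where V: "\<forall>j\<in>A. (V j, I j, e j) \<in> frames (H j)" and V0: "V0 = (\<Inter>j\<in>A. V j)"
        and "I0 = Pi\<^sub>E A I" and "e0 = (\<lambda>f p. tensor_vec A (\<lambda>j. e j (f j) p))"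
        by (rule tensor_frameE[OF F(1)])
      have "V j \<subseteq> base (H j)" if "j \<in> A" for j
        using vector_bundleD(2)[OF H[OF that]] V that by force
      then show "p \<in> base (tensor_bundle A H)" using F(2) V0 unfolding tensor_bundle_def by auto
    qed
    show "base (tensor_bundle A H) \<subseteq> \<Union>(fst ` frames (tensor_bundle A H))"
    proof
      fix p assume p: "p \<in> base (tensor_bundle A H)"
      have "\<forall>j\<in>A. \<exists>F. F \<in> frames (H j) \<and> p \<in> fst F"
      proof
        fix j assume j: "j \<in> A"
        have "p \<in> base (H j)" using p j by (simp add: tensor_bundle_def)
        then show "\<exists>F. F \<in> frames (H j) \<and> p \<in> fst F" using vector_bundleD(2)[OF H[OF j]] by blast
      qed
      from bchoice[OF this] obtain F where F: "\<forall>j\<in>A. F j \<in> frames (H j) \<and> p \<in> fst (F j)" by blast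
      then have mem: "((\<Inter>j\<in>A. fst (F j)), Pi\<^sub>E A (\<lambda>j. fst (snd (F j))), \<lambda>f p. tensor_vec A (\<lambda>j. snd (snd (F j)) (f j) p))
          \<in> frames (tensor_bundle A H)"
        by (intro tensor_frameI) simp
      show "p \<in> \<Union>(fst ` frames (tensor_bundle A H))"
        by (rule UnionI[OF imageI[OF mem]]) (use F in simp)
    qed
  qed
  show "\<forall>(V, I, e) \<in> frames (tensor_bundle A H). openin (mtop M) V \<and> finite I \<and>
        (\<forall>p\<in>V. inj_on (\<lambda>i. e i p) I \<and> cfun.independent ((\<lambda>i. e i p) ` I) \<and>
               cfun.span ((\<lambda>i. e i p) ` I) = fibre (tensor_bundle A H) p) \<and>
        (\<forall>(V', I', e') \<in> frames (tensor_bundle A H). \<forall>i\<in>I'. smooth_comb M (V \<inter> V') I e (e' i))"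
  proof (clarify, intro conjI)
    fix V0 I0 e0 assume F0: "(V0, I0, e0) \<in> frames (tensor_bundle A H)"
    obtain V I e where e: "\<forall>j\<in>A. (V j, I j, e j) \<in> frames (H j)"
      and V0: "V0 = (\<Inter>j\<in>A. V j)" and I0: "I0 = Pi\<^sub>E A I" and e0: "e0 = (\<lambda>f p. tensor_vec A (\<lambda>j. e j (f j) p))"
      by (rule tensor_frameE[OF F0])
    note e = e[rule_format]
    have fin: "finite (I j)" if "j \<in> A" for j using vector_bundleD(4)[OF H e] that by blast
    show "openin (mtop M) V0" unfolding V0 by (intro openin_INT2 A) (rule vector_bundleD(3)[OF H e])
    show "finite I0" unfolding I0 by (rule finite_PiE[OF A(1) fin])
    show "\<forall>p\<in>V0. inj_on (\<lambda>i. e0 i p) I0 \<and> cfun.independent ((\<lambda>i. e0 i p) ` I0) \<and>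
               cfun.span ((\<lambda>i. e0 i p) ` I0) = fibre (tensor_bundle A H) p"
    proof
      fix p assume "p \<in> V0"
      then have p: "p \<in> V j" if "j \<in> A" for j using that V0 by blast
      have fib: "fibre (tensor_bundle A H) p = tensor_space A (\<lambda>j. fibre (H j) p)" by (simp add: tensor_bundle_def)
      show "inj_on (\<lambda>i. e0 i p) I0 \<and> cfun.independent ((\<lambda>i. e0 i p) ` I0) \<and>
               cfun.span ((\<lambda>i. e0 i p) ` I0) = fibre (tensor_bundle A H) p"
        unfolding e0 I0 fib
        by (intro conjI tensor_basis[OF A(1) fin, where b = "\<lambda>j i. e j i p" and E = "\<lambda>j. fibre (H j) p"]
            vector_bundleD(5)[OF H e p] vector_bundleD(6)[OF H e p] vector_bundleD(7)[OF H e p])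
    qed
    show "\<forall>(V', I', e') \<in> frames (tensor_bundle A H). \<forall>i\<in>I'. smooth_comb M (V0 \<inter> V') I0 e0 (e' i)"
    proof clarify
      fix V1 I1 e1 f assume F1: "(V1, I1, e1) \<in> frames (tensor_bundle A H)" and f: "f \<in> I1"
      obtain V' I' e' where e': "\<forall>j\<in>A. (V' j, I' j, e' j) \<in> frames (H j)"
        and V1: "V1 = (\<Inter>j\<in>A. V' j)" and I1: "I1 = Pi\<^sub>E A I'" and e1: "e1 = (\<lambda>f p. tensor_vec A (\<lambda>j. e' j (f j) p))"
        by (rule tensor_frameE[OF F1])
      note e' = e'[rule_format]
      show "smooth_comb M (V0 \<inter> V1) I0 e0 (e1 f)"
        unfolding I0 e0 e1
      proof (rule smooth_comb_tensor[OF A(1) fin])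
        fix j assume j: "j \<in> A"
        show "smooth_comb M (V0 \<inter> V1) (I j) (e j) (e' j (f j))"
          by (rule smooth_comb_subset[OF vector_bundleD(8)[OF H[OF j] e[OF j] e'[OF j]]])
            (use f j in \<open>auto simp: I1 V0 V1\<close>)
      qed
    qed
  qed
qed

lemma dim_fibre:
  assumes "vector_bundle M E" "(V, I, e) \<in> frames E" "p \<in> V"
  shows "cfun.dim (fibre E p) = card I"
proof -
  note e = vector_bundleD(4-7)[OF assms(1,2)]
  have "cfun.dim (cfun.span ((\<lambda>i. e i p) ` I)) = card ((\<lambda>i. e i p) ` I)"
    by (rule cfun.dim_span_eq_card_independent[OF e(3)[OF assms(3)]])
  then show ?thesis using e(4)[OF assms(3)] card_image[OF e(2)[OF assms(3)]] by simp
qed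

text \<open>The dimension of the fibre is constant on frame domains, hence on a connected set, so
  the description in \<open>bundle_rank\<close> has a unique solution.\<close>

lemma bundle_rank_eq:
  assumes E: "vector_bundle M E" and B: "connectedin (mtop M) B" "B \<subseteq> base E" "p \<in> B"
  shows "bundle_rank E B = cfun.dim (fibre E p)"
proof -
  have const: "cfun.dim (fibre E q) = cfun.dim (fibre E p)" if q: "q \<in> B" for q
  proof (rule connectedin_locally_constant[OF B(1) _ B(3) q, where f = "\<lambda>q. cfun.dim (fibre E q)"])
    fix r assume "r \<in> B"
    then have r: "r \<in> base E" using B(2) by blast
    obtain V I e where e: "(V, I, e) \<in> frames E" "r \<in> V" by (rule frame_at[OF E r])
    then show "\<exists>V. openin (mtop M) V \<and> r \<in> V \<and> (\<forall>q\<in>V \<inter> B. cfun.dim (fibre E q) = cfun.dim (fibre E r))"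
      using dim_fibre[OF E e(1)] vector_bundleD(3)[OF E e(1)] by (intro exI[of _ V]) auto
  qed
  show ?thesis
    unfolding bundle_rank_def
  proof (rule the_equality)
    show "\<forall>q\<in>B. cfun.dim (fibre E q) = cfun.dim (fibre E p)" using const by blast
    show "r = cfun.dim (fibre E p)" if "\<forall>q\<in>B. cfun.dim (fibre E q) = r" for r using bspec[OF that B(3)] by simp
  qed
qed

lemma dim_fibre_tensor:
  fixes H :: "nat \<Rightarrow> ('a, 'b, 'k) vbundle" and M :: "('a, 'n::finite) mcorner"
  assumes A: "finite A" "A \<noteq> {}" and H: "\<And>j. j \<in> A \<Longrightarrow> vector_bundle M (H j)" and p: "p \<in> base (tensor_bundle A H)"
  shows "cfun.dim (fibre (tensor_bundle A H) p) = (\<Prod>j\<in>A. cfun.dim (fibre (H j) p))"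
proof -
  note vb = vector_bundle_tensor[OF A H]
  obtain V0 I0 e0 where f: "(V0, I0, e0) \<in> frames (tensor_bundle A H)" "p \<in> V0" by (rule frame_at[OF vb p])
  obtain V I e where e: "\<forall>j\<in>A. (V j, I j, e j) \<in> frames (H j)"
    and V0: "V0 = (\<Inter>j\<in>A. V j)" and I0: "I0 = Pi\<^sub>E A I" and "e0 = (\<lambda>f p. tensor_vec A (\<lambda>j. e j (f j) p))"
    by (rule tensor_frameE[OF f(1)])
  have "cfun.dim (fibre (H j) p) = card (I j)" if "j \<in> A" for j
    by (rule dim_fibre[OF H[OF that] e[rule_format, OF that]]) (use f(2) V0 that in blast)
  then show ?thesis using dim_fibre[OF vb f] card_PiE[OF A(1)] unfolding I0 by simp
qed

text \<open>Allows a section that is nonzero on a closed set to be used on a neighbourhood, as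
  embeddings live on open sets. Fibres carry no topology, so a nonvanishing coefficient in a frame
  is followed instead.\<close>

lemma openin_nonzero_section:
  fixes E :: "('a, 'b, 'k) vbundle" and M :: "('a, 'n::finite) mcorner"
  assumes M: "manifold_with_corners M" and E: "vector_bundle M E" and s: "smooth_section M E W s"
  shows "openin (mtop M) {p \<in> W. s p \<noteq> 0}"
proof (subst openin_subopen, clarify)
  fix p assume p: "p \<in> W" "s p \<noteq> 0"
  have W: "openin (mtop M) W" "W \<subseteq> base E" using s unfolding smooth_section_def by auto
  obtain V I e where e: "(V, I, e) \<in> frames E" "p \<in> V" by (rule frame_at[OF E subsetD[OF W(2) p(1)]])
  note eb = vector_bundleD(3-6)[OF E e(1)]
  have "smooth_comb M (V \<inter> W) I e s" using s e(1) unfolding smooth_section_def by fast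
  then obtain c :: "'k \<Rightarrow> 'a \<Rightarrow> complex" where c: "\<And>i. i \<in> I \<Longrightarrow> smooth_fun M (V \<inter> W) (c i)"
    "\<And>p. p \<in> V \<inter> W \<Longrightarrow> s p = (\<lambda>x. \<Sum>i\<in>I. c i p * e i p x)" unfolding smooth_comb_def by blast
  have "\<exists>i\<in>I. c i p \<noteq> 0"
  proof (rule ccontr)
    assume "\<not> ?thesis"
    then have "s p = 0" using c(2)[of p] p(1) e(2) by (simp add: fun_eq_iff)
    then show False using p(2) by simp
  qed
  then obtain i where i: "i \<in> I" "c i p \<noteq> 0" by blast
  have VW: "openin (mtop M) (V \<inter> W)" using eb(1) W(1) by (rule openin_Int)
  have top: "topspace (subtopology (mtop M) (V \<inter> W)) = V \<inter> W" using openin_subset[OF VW] by auto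
  have "continuous_map (subtopology (mtop M) (V \<inter> W)) euclidean (c i)"
    by (rule smooth_fun_continuous_map[OF M c(1)[OF i(1)] openin_subset[OF VW]])
  then have "openin (subtopology (mtop M) (V \<inter> W)) {q \<in> topspace (subtopology (mtop M) (V \<inter> W)). c i q \<in> - {0}}"
    by (rule openin_continuous_map_preimage) auto
  then have o: "openin (mtop M) {q \<in> V \<inter> W. c i q \<in> - {0}}"
    unfolding top using VW openin_trans_full by blast
  have "s q \<noteq> 0" if q: "q \<in> V \<inter> W" "c i q \<noteq> 0" for q
  proof
    assume "s q = 0"
    then have z: "(\<Sum>i\<in>I. c i q * e i q x) = 0" for x using c(2)[OF q(1)] by (simp add: fun_eq_iff)
    have "q \<in> V" using q(1) by blast
    from independent_familyD[OF eb(2) eb(3)[OF this] eb(4)[OF this] z i(1)] show False using q(2) by simp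
  qed
  then have "{q \<in> V \<inter> W. c i q \<in> - {0}} \<subseteq> {p \<in> W. s p \<noteq> 0}" by auto
  then show "\<exists>Ta. openin (mtop M) Ta \<and> p \<in> Ta \<and> Ta \<subseteq> {p \<in> W. s p \<noteq> 0}"
    using o i(2) p(1) e(2) by (intro exI[of _ "{q \<in> V \<inter> W. c i q \<in> - {0}}"]) auto
qed

section \<open>Insertion maps\<close>

lemma insert_vec_add: "insert_vec j w (x + y) = insert_vec j w x + insert_vec j w y"
  and insert_vec_scale: "insert_vec j w (\<lambda>b. c * x b) = (\<lambda>b. c * insert_vec j w x b)"
  by (auto simp: insert_vec_def fun_eq_iff algebra_simps)

text \<open>True for pure tensors and stable under linear combinations; it frees the slot
  \<open>j\<close> for the injectivity of insertion.\<close>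

lemma tensor_space_depends:
  assumes "T \<in> tensor_space A E" "\<forall>i\<in>A. x i = y i"
  shows "T x = T y"
proof -
  have "tensor_space A E \<subseteq> {T. T x = T y}"
    unfolding tensor_space_def
  proof (rule cfun.span_minimal)
    show "{tensor_vec A v |v. \<forall>j\<in>A. v j \<in> E j} \<subseteq> {T. T x = T y}"
      using assms(2) by (auto simp: tensor_vec_def intro!: prod.cong)
    show "cfun.subspace {T. T x = T y}" by (auto simp: cfun.subspace_def)
  qed
  then show ?thesis using assms(1) by blast
qed

lemma insert_vec_in_tensor_space:
  assumes "finite A" "j \<notin> A" "w \<in> E j" "T \<in> tensor_space A E"
  shows "insert_vec j w T \<in> tensor_space (insert j A) E"
proof -
  have "tensor_space A E \<subseteq> {T. insert_vec j w T \<in> tensor_space (insert j A) E}"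
    unfolding tensor_space_def[of A]
  proof (rule cfun.span_minimal)
    have sub: "cfun.subspace (tensor_space (insert j A) E)" unfolding tensor_space_def by (rule cfun.subspace_span)
    show "cfun.subspace {T. insert_vec j w T \<in> tensor_space (insert j A) E}"
      unfolding cfun.subspace_def
    proof (intro conjI)
      have "insert_vec j w 0 = 0" by (auto simp: insert_vec_def fun_eq_iff)
      then show "0 \<in> {T. insert_vec j w T \<in> tensor_space (insert j A) E}" using cfun.subspace_0[OF sub] by simp
    qed (auto simp: insert_vec_add insert_vec_scale intro: cfun.subspace_add[OF sub] cfun.subspace_scale[OF sub])
    show "{tensor_vec A v |v. \<forall>j\<in>A. v j \<in> E j} \<subseteq> {T. insert_vec j w T \<in> tensor_space (insert j A) E}"
    proof clarify
      fix v assume v: "\<forall>j\<in>A. v j \<in> E j"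
      have "tensor_vec (insert j A) (v(j := w)) \<in> tensor_space (insert j A) E"
        unfolding tensor_space_def by (rule cfun.span_base) (use v assms(2,3) in auto)
      then show "insert_vec j w (tensor_vec A v) \<in> tensor_space (insert j A) E"
        by (simp add: insert_vec_tensor_vec[OF assms(1,2)])
    qed
  qed
  then show ?thesis using assms(4) by blast
qed

text \<open>Setting the slot \<open>j\<close> to a point where \<open>w\<close> is nonzero allows
  division by that value, and tensors over \<open>A\<close> do not depend on this slot.\<close>

lemma inj_on_insert_vec:
  assumes "j \<notin> A" "w \<noteq> 0"
  shows "inj_on (insert_vec j w) (tensor_space A E)"
proof (rule inj_onI)
  fix T T' assume T: "T \<in> tensor_space A E" "T' \<in> tensor_space A E" "insert_vec j w T = insert_vec j w T'"
  obtain b where b: "w b \<noteq> 0" using assms(2) by (auto simp: fun_eq_iff)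
  show "T = T'"
  proof
    fix x
    have "w b * T (x(j := b)) = w b * T' (x(j := b))"
      using fun_cong[OF T(3), of "x(j := b)"] by (simp add: insert_vec_def)
    then have "T (x(j := b)) = T' (x(j := b))" using b by simp
    moreover have "T (x(j := b)) = T x" "T' (x(j := b)) = T' x"
      by (rule tensor_space_depends[OF T(1)] tensor_space_depends[OF T(2)]; use assms(1) in auto)+
    ultimately show "T x = T' x" by simp
  qed
qed

lemma section_in_fibre:
  fixes E :: "('a, 'b, 'k) vbundle" and M :: "('a, 'n::finite) mcorner"
  assumes E: "vector_bundle M E" and s: "smooth_section M E W s" and p: "p \<in> W"
  shows "s p \<in> fibre E p"
proof -
  have W: "W \<subseteq> base E" using s unfolding smooth_section_def by auto
  obtain V I e where e: "(V, I, e) \<in> frames E" "p \<in> V" by (rule frame_at[OF E subsetD[OF W p]])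
  have "smooth_comb M (V \<inter> W) I e s" using s e(1) unfolding smooth_section_def by fast
  then obtain c :: "'k \<Rightarrow> 'a \<Rightarrow> complex" where
    "\<And>p. p \<in> V \<inter> W \<Longrightarrow> s p = (\<lambda>x. \<Sum>i\<in>I. c i p * e i p x)" unfolding smooth_comb_def by blast
  then have "s p = (\<lambda>x. \<Sum>i\<in>I. c i p * e i p x)" using p e(2) by blast
  then have "s p \<in> cfun.span ((\<lambda>i. e i p) ` I)" using sum_in_span[of "\<lambda>i. c i p" "\<lambda>i. e i p" I] by simp
  then show ?thesis using vector_bundleD(7)[OF E e] by simp
qed

lemma bundle_embedding_insert:
  fixes H :: "nat \<Rightarrow> ('a, 'b, 'k) vbundle" and M :: "('a, 'n::finite) mcorner"
  assumes A: "finite A" "j \<notin> A" and H: "\<And>i. i \<in> insert j A \<Longrightarrow> vector_bundle M (H i)"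
    and s: "smooth_section M (H j) W0 s" and W: "openin (mtop M) W" "W \<subseteq> base (tensor_bundle (insert j A) H)" "W \<subseteq> W0"
    and nz: "\<And>p. p \<in> W \<Longrightarrow> s p \<noteq> 0"
  shows "bundle_embedding M (tensor_bundle A H) (tensor_bundle (insert j A) H) W (\<lambda>p. insert_vec j (s p))"
  unfolding bundle_embedding_def
proof (intro conjI W(1))
  have fib: "fibre (tensor_bundle A' H) p = tensor_space A' (\<lambda>j. fibre (H j) p)" for A' p by (simp add: tensor_bundle_def)
  show "W \<subseteq> base (tensor_bundle A H) \<inter> base (tensor_bundle (insert j A) H)"
    using W(2) by (auto simp: tensor_bundle_def)
  show "\<forall>p\<in>W. insert_vec j (s p) ` fibre (tensor_bundle A H) p \<subseteq> fibre (tensor_bundle (insert j A) H) p \<and>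
    inj_on (insert_vec j (s p)) (fibre (tensor_bundle A H) p) \<and>
    (\<forall>x\<in>fibre (tensor_bundle A H) p. \<forall>y\<in>fibre (tensor_bundle A H) p.
       insert_vec j (s p) (x + y) = insert_vec j (s p) x + insert_vec j (s p) y) \<and>
    (\<forall>x\<in>fibre (tensor_bundle A H) p. \<forall>c. insert_vec j (s p) (\<lambda>b. c * x b) = (\<lambda>b. c * insert_vec j (s p) x b))"
  proof (intro ballI conjI allI insert_vec_add insert_vec_scale)
    fix p assume p: "p \<in> W"
    have sp: "s p \<in> fibre (H j) p" by (rule section_in_fibre[OF H s]) (use p W(3) in auto)
    show "insert_vec j (s p) ` fibre (tensor_bundle A H) p \<subseteq> fibre (tensor_bundle (insert j A) H) p"
      unfolding fib using insert_vec_in_tensor_space[OF A, of "s p" "\<lambda>j. fibre (H j) p"] sp by blast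
    show "inj_on (insert_vec j (s p)) (fibre (tensor_bundle A H) p)"
      unfolding fib by (rule inj_on_insert_vec[OF A(2) nz[OF p]])
  qed
  show "\<forall>(V, I, e)\<in>frames (tensor_bundle A H). \<forall>i\<in>I.
      smooth_section M (tensor_bundle (insert j A) H) (V \<inter> W) (\<lambda>p. insert_vec j (s p) (e i p))"
  proof clarify
    fix V0 I0 e0 f assume F0: "(V0, I0, e0) \<in> frames (tensor_bundle A H)" and f: "f \<in> I0"
    obtain V I e where e: "\<forall>j\<in>A. (V j, I j, e j) \<in> frames (H j)"
      and V0: "V0 = (\<Inter>j\<in>A. V j)" and I0: "I0 = Pi\<^sub>E A I" and e0: "e0 = (\<lambda>f p. tensor_vec A (\<lambda>j. e j (f j) p))"
      by (rule tensor_frameE[OF F0])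
    note e = e[rule_format]
    \<comment> \<open>Inserting \<open>s\<close> into a frame tensor gives a pure tensor whose
      factor at \<open>j\<close> is \<open>s\<close>, so smoothness is checked factor by
      factor.\<close>
    define s' where "s' i = (if i = j then s else e i (f i))" for i
    have eq: "insert_vec j (s p) (e0 f p) = tensor_vec (insert j A) (\<lambda>i. s' i p)" for p
    proof -
      have "(\<lambda>i. e i (f i) p)(j := s p) = (\<lambda>i. s' i p)" by (auto simp: s'_def)
      then show ?thesis unfolding e0 by (simp add: insert_vec_tensor_vec[OF A])
    qed
    show "smooth_section M (tensor_bundle (insert j A) H) (V0 \<inter> W) (\<lambda>p. insert_vec j (s p) (e0 f p))"
      unfolding smooth_section_def eq
    proof (intro conjI)
      show "openin (mtop M) (V0 \<inter> W)"
      \<comment> \<open>For empty \<open>A\<close> the domain \<open>V0\<close> is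
        \<open>UNIV\<close>, which need not be open; only its intersection with \<open>W\<close>
        is.\<close>
      proof (cases "A = {}")
        case True
        then show ?thesis using W(1) by (simp add: V0)
      next
        case False
        have "openin (mtop M) V0"
          unfolding V0 by (rule openin_INT2[OF A(1) False]) (rule vector_bundleD(3)[OF H e], auto)
        then show ?thesis using W(1) by (rule openin_Int)
      qed
      show "V0 \<inter> W \<subseteq> base (tensor_bundle (insert j A) H)" using W(2) by blast
      show "\<forall>(V, I, e)\<in>frames (tensor_bundle (insert j A) H).
        smooth_comb M (V \<inter> (V0 \<inter> W)) I e (\<lambda>p. tensor_vec (insert j A) (\<lambda>i. s' i p))"
      proof clarify
        fix V1 I1 e1 assume F1: "(V1, I1, e1) \<in> frames (tensor_bundle (insert j A) H)"
        obtain V' I' e' where e': "\<forall>i\<in>insert j A. (V' i, I' i, e' i) \<in> frames (H i)"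
          and V1: "V1 = (\<Inter>i\<in>insert j A. V' i)" and I1: "I1 = Pi\<^sub>E (insert j A) I'"
          and e1: "e1 = (\<lambda>f p. tensor_vec (insert j A) (\<lambda>j. e' j (f j) p))"
          by (rule tensor_frameE[OF F1])
        note e' = e'[rule_format]
        show "smooth_comb M (V1 \<inter> (V0 \<inter> W)) I1 e1 (\<lambda>p. tensor_vec (insert j A) (\<lambda>i. s' i p))"
          unfolding I1 e1
        proof (rule smooth_comb_tensor[where I = I' and e = e' and s = s'])
          fix i assume i: "i \<in> insert j A"
          show "finite (I' i)" by (rule vector_bundleD(4)[OF H[OF i] e'[OF i]])
          show "smooth_comb M (V1 \<inter> (V0 \<inter> W)) (I' i) (e' i) (s' i)"
          proof (cases "i = j")
            case True
            have "smooth_comb M (V' j \<inter> W0) (I' j) (e' j) s"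
              using s e'[of j] unfolding smooth_section_def by fast
            then have "smooth_comb M (V1 \<inter> (V0 \<inter> W)) (I' j) (e' j) s"
              by (rule smooth_comb_subset) (use W(3) V1 in auto)
            then show ?thesis using True by (simp add: s'_def)
          next
            case False
            then have iA: "i \<in> A" using i by simp
            have "smooth_comb M (V' i \<inter> V i) (I' i) (e' i) (e i (f i))"
              by (rule vector_bundleD(8)[OF H[OF i] e'[OF i] e[OF iA]]) (use f iA I0 in auto)
            then have "smooth_comb M (V1 \<inter> (V0 \<inter> W)) (I' i) (e' i) (e i (f i))"
              by (rule smooth_comb_subset) (use iA V0 V1 in auto)
            then show ?thesis using False by (simp add: s'_def)
          qed
        qed (use A in auto)
      qed
    qed
  qed
qed

text \<open>An injective linear map between spaces of equal finite dimension is onto. The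
  surrounding function space may be infinite dimensional, so this is done by hand: the image of a
  basis is independent, and one more independent vector would exceed the size of a basis of the
  target.\<close>

lemma bij_betw_insert_vec:
  fixes H :: "nat \<Rightarrow> ('a, 'b, 'k) vbundle" and M :: "('a, 'n::finite) mcorner"
  assumes A: "finite A" "A \<noteq> {}" "j \<notin> A" and H: "\<And>i. i \<in> insert j A \<Longrightarrow> vector_bundle M (H i)"
    and p: "p \<in> base (tensor_bundle (insert j A) H)" and w: "w \<in> fibre (H j) p" "w \<noteq> 0"
    and dim: "cfun.dim (fibre (tensor_bundle A H) p) = cfun.dim (fibre (tensor_bundle (insert j A) H) p)"
  shows "bij_betw (insert_vec j w) (fibre (tensor_bundle A H) p) (fibre (tensor_bundle (insert j A) H) p)"
proof -
  let ?E = "fibre (tensor_bundle A H) p" and ?E' = "fibre (tensor_bundle (insert j A) H) p"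
  have fib: "fibre (tensor_bundle A' H) p = tensor_space A' (\<lambda>j. fibre (H j) p)" for A' by (simp add: tensor_bundle_def)
  have vb: "vector_bundle M (tensor_bundle A H)" "vector_bundle M (tensor_bundle (insert j A) H)"
    by (rule vector_bundle_tensor; use A H in auto)+
  have pA: "p \<in> base (tensor_bundle A H)" using p by (auto simp: tensor_bundle_def)
  obtain V I e where e: "(V, I, e) \<in> frames (tensor_bundle A H)" "p \<in> V" by (rule frame_at[OF vb(1) pA])
  obtain V' I' e' where e': "(V', I', e') \<in> frames (tensor_bundle (insert j A) H)" "p \<in> V'" by (rule frame_at[OF vb(2) p])
  note ed = vector_bundleD(4)[OF vb(1) e(1)] vector_bundleD(5-7)[OF vb(1) e]
  note ed' = vector_bundleD(4)[OF vb(2) e'(1)] vector_bundleD(5-7)[OF vb(2) e']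
  have into: "insert_vec j w ` ?E \<subseteq> ?E'"
    unfolding fib using insert_vec_in_tensor_space[OF A(1,3), of w "\<lambda>j. fibre (H j) p"] w(1) by blast
  have inj: "inj_on (insert_vec j w) ?E" unfolding fib by (rule inj_on_insert_vec[OF A(3) w(2)])
  define t where "t i = insert_vec j w (e i p)" for i
  have eE: "e i p \<in> ?E" if "i \<in> I" for i
    unfolding ed(4)[symmetric] by (rule cfun.span_base) (use that in blast)
  have zero: "c i = 0" if c: "\<And>x. (\<Sum>i\<in>I. c i * t i x) = 0" and i: "i \<in> I" for c i
  proof -
    have "insert_vec j w (\<lambda>x. \<Sum>i\<in>I. c i * e i p x) = insert_vec j w 0"
      using c by (auto simp: t_def insert_vec_def fun_eq_iff sum_distrib_left algebra_simps)
    moreover have "(\<lambda>x. \<Sum>i\<in>I. c i * e i p x) \<in> ?E" using sum_in_span[of c "\<lambda>i. e i p" I] ed(4) by simp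
    moreover have "0 \<in> ?E" using cfun.span_zero[of "(\<lambda>i. e i p) ` I"] ed(4) by simp
    ultimately have "(\<lambda>x. \<Sum>i\<in>I. c i * e i p x) = 0" using inj by (meson inj_onD)
    then have "(\<Sum>i\<in>I. c i * e i p x) = 0" for x by (simp add: fun_eq_iff)
    then show ?thesis using independent_familyD[OF ed(1-3)] i by blast
  qed
  have t: "inj_on t I" "cfun.independent (t ` I)"
    using independent_familyI[OF ed(1), of t] zero by blast+
  have card: "card (t ` I) = card ((\<lambda>i. e' i p) ` I')"
    using dim dim_fibre[OF vb(1) e] dim_fibre[OF vb(2) e'] card_image[OF t(1)] card_image[OF ed'(2)] by simp
  have tE': "t ` I \<subseteq> ?E'" using into eE by (auto simp: t_def)
  have "?E' \<subseteq> insert_vec j w ` ?E"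
  proof
    fix v assume v: "v \<in> ?E'"
    have "v \<in> cfun.span (t ` I)"
    proof (rule ccontr)
      assume nv: "v \<notin> cfun.span (t ` I)"
      then have "cfun.independent (insert v (t ` I))" by (rule cfun.independent_insertI[OF _ t(2)])
      then have "card (insert v (t ` I)) \<le> card ((\<lambda>i. e' i p) ` I')"
        using cfun.independent_span_bound[of "(\<lambda>i. e' i p) ` I'" "insert v (t ` I)"] ed'(1,4) v tE' by simp
      moreover have "v \<notin> t ` I" using nv cfun.span_base[of v "t ` I"] by blast
      ultimately show False using card ed(1) by simp
    qed
    then obtain c where "\<forall>x. v x = (\<Sum>i\<in>I. c i * t i x)" by (rule in_span_finite_family[OF ed(1) t(1)])
    then have "v = insert_vec j w (\<lambda>x. \<Sum>i\<in>I. c i * e i p x)"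
      by (auto simp: t_def insert_vec_def fun_eq_iff sum_distrib_left algebra_simps)
    moreover have "(\<lambda>x. \<Sum>i\<in>I. c i * e i p x) \<in> ?E" using sum_in_span[of c "\<lambda>i. e i p" I] ed(4) by simp
    ultimately show "v \<in> insert_vec j w ` ?E" by blast
  qed
  then show ?thesis unfolding bij_betw_def using inj into by blast
qed

section \<open>The local tensorial system\<close>

context regular_cover
begin

lemma facetE:
  assumes "Z \<in> facets M P k"
  obtains C p where "facet_core k C" "Z = mtop M closure_of C" "p \<in> C" "p \<in> Z" "p \<in> T" "card (walls_at p) = k"
proof -
  obtain C where C: "facet_core k C" "Z = mtop M closure_of C" using assms unfolding facets_eq by blast
  then obtain p where "p \<in> C" using facet_core(1) by blast
  moreover have "p \<in> Z" using C closure_of_subset[OF facet_core(4)[OF C(1)]] \<open>p \<in> C\<close> by blast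
  moreover have "p \<in> T" "card (walls_at p) = k" using facet_core(3)[OF C(1)] \<open>p \<in> C\<close> unfolding stratum_eq by auto
  ultimately show ?thesis using that C by blast
qed

lemma face_labelI:
  assumes "B \<in> P" "B' \<in> P" "j \<in> J" "j \<notin> idx B" "j \<in> idx B'"
  shows "face_label M U j B B'"
  unfolding face_label_def
proof
  show "mf_interior M B' \<subseteq> U j"
  proof
    fix q assume "q \<in> mf_interior M B'"
    then have "\<chi>_at q = idx B'" by (rule mf_interior_block(2)[OF assms(2)])
    then show "q \<in> U j" using assms(5) by (auto simp: chi_def)
  qed
  show "B \<subseteq> T - U j"
  proof
    fix q assume q: "q \<in> B"
    then show "q \<in> T - U j" using in_block(3,4)[OF assms(1) q] assms(3,4) by (auto simp: chi_def)
  qed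
qed

lemma face_labelD:
  assumes "B \<in> P" "j \<in> J" "face_label M U j B B'"
  shows "j \<notin> idx B"
proof
  assume j: "j \<in> idx B"
  obtain p where p: "p \<in> B" using component_over(1)[OF is_component_over_idx[OF assms(1)]] by blast
  obtain q where "q \<in> T" "q \<in> B" "\<chi>_at q = idx B" "walls_at q = {}"
    by (rule generic_point_in_block[OF assms(1) p openin_topspace in_block(3)[OF assms(1) p]])
  then have "q \<in> U j" using j by (auto simp: chi_def)
  then show False using assms(3) \<open>q \<in> B\<close> unfolding face_label_def by blast
qed

lemma blocks_eq_if_idx_eq:
  assumes "B \<in> P" "B' \<in> P" "p \<in> B" "p \<in> B'" "idx B = idx B'"
  shows "B = B'"
  using in_block(1)[OF assms(1,3)] in_block(1)[OF assms(2,4)] assms(5) by metis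

text \<open>Only one wall passes through a codimension-1 point, so the index sets of blocks there
  are \<open>\<chi>_at p\<close> with or without that wall; two different blocks must realize
  both.\<close>

lemma adjacent_face:
  assumes Z: "Z \<in> facets M P 1" and B: "B \<in> P" "B' \<in> P" "B \<noteq> B'" "Z \<subseteq> B \<inter> B'"
  shows "\<exists>!j. j \<in> J \<and> Z \<subseteq> wall M U j"
    "j \<in> J \<Longrightarrow> Z \<subseteq> wall M U j \<Longrightarrow> face_label M U j B B' \<and> j \<notin> idx B \<and> idx B' = insert j (idx B) \<or>
       face_label M U j B' B \<and> j \<notin> idx B' \<and> idx B = insert j (idx B')"
proof -
  obtain C p where C: "facet_core 1 C" "Z = mtop M closure_of C" "p \<in> C" "p \<in> Z" "p \<in> T" "card (walls_at p) = 1"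
    by (rule facetE[OF Z])
  obtain j0 where j0: "walls_at p = {j0}" using C(6) by (rule card_1_singletonE)
  have wall: "Z \<subseteq> wall M U j \<longleftrightarrow> j = j0" if "j \<in> J" for j
    using facet_subset_wall_iff[OF C(1,3) that] j0 C(2) by simp
  have j0J: "j0 \<in> J" using j0 walls_at_subset(1)[of p] by blast
  show "\<exists>!j. j \<in> J \<and> Z \<subseteq> wall M U j" using wall j0J by blast
  assume j: "j \<in> J" "Z \<subseteq> wall M U j"
  then have jj: "j = j0" using wall by blast
  have p: "p \<in> B" "p \<in> B'" using B(4) C(4) by blast+
  have ne: "idx B \<noteq> idx B'" using blocks_eq_if_idx_eq[OF B(1,2) p] B(3) by blast
  have jchi: "j \<notin> \<chi>_at p" using chi_walls_disjoint[of p] j0 jj by blast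
  consider "j \<notin> idx B" "idx B' = insert j (idx B)" | "j \<notin> idx B'" "idx B = insert j (idx B')"
    using in_block(4,5)[OF B(1) p(1)] in_block(4,5)[OF B(2) p(2)] ne jchi unfolding j0 jj by blast
  then show "face_label M U j B B' \<and> j \<notin> idx B \<and> idx B' = insert j (idx B) \<or>
       face_label M U j B' B \<and> j \<notin> idx B' \<and> idx B = insert j (idx B')"
    using face_labelI B(1,2) j(1) by cases auto
qed

lemma tensorial_arrow_1:
  assumes Z: "Z \<in> facets M P 1" and B: "B \<in> P" "B' \<in> P" "Z \<subseteq> B \<inter> B'"
    and j: "j \<notin> idx B" "idx B' = insert j (idx B)"
  shows "(B, B', restrict (\<lambda>p. insert_vec j (s j p)) Z) \<in> tensorial_clutching M J U s Z" "j \<in> J" "Z \<subseteq> wall M U j"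
proof -
  obtain C p where C: "facet_core 1 C" "Z = mtop M closure_of C" "p \<in> C" "p \<in> Z" "p \<in> T" "card (walls_at p) = 1"
    by (rule facetE[OF Z])
  show jJ: "j \<in> J" using idx_nonempty(2)[OF B(2)] j(2) by blast
  have "j \<in> walls_at p"
    using in_block(4,5)[OF B(1), of p] in_block(4,5)[OF B(2), of p] B(3) C(4) j by blast
  then show wall: "Z \<subseteq> wall M U j" using facet_subset_wall_iff[OF C(1,3) jJ] C(2) by simp
  have "B \<noteq> B'" using j by blast
  moreover have "face_label M U j B B'" by (rule face_labelI[OF B(1,2) jJ]) (use j in auto)
  ultimately show "(B, B', restrict (\<lambda>p. insert_vec j (s j p)) Z) \<in> tensorial_clutching M J U s Z"
    unfolding tensorial_clutching_def using B jJ wall by blast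
qed

abbreviation gluing :: "(nat \<Rightarrow> 'a \<Rightarrow> 'b \<Rightarrow> complex) \<Rightarrow> nat \<Rightarrow> 'a set \<Rightarrow> ('a, nat \<Rightarrow> 'b) arrow set" where
  "gluing s \<equiv> restricted_gluing M P (tensorial_clutching M J U s)"

lemma gluing_Suc: "0 < k \<Longrightarrow> gluing s (Suc k) Z = preliminary_quiver M P (gluing s k) (Suc k) Z"
  by simp

text \<open>Induction on the codimension: with at least two walls at \<open>p\<close> there is a
  wall \<open>i\<close> different from \<open>j\<close>, and \<open>B\<close> and \<open>B'\<close>
  lie on the same side of it. Leaving it gives a larger facet in both blocks, whose arrow is
  restricted.\<close>

lemma gluing_arrow:
  assumes "Z \<in> facets M P (Suc k)" "B \<in> P" "B' \<in> P" "Z \<subseteq> B \<inter> B'" "j \<notin> idx B" "idx B' = insert j (idx B)"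
  shows "\<exists>h. (B, B', h) \<in> gluing s (Suc k) Z"
  using assms
proof (induction k arbitrary: Z)
  case 0
  then show ?case using tensorial_arrow_1(1)[of Z B B' j s] by auto
next
  case (Suc k)
  obtain C p where C: "facet_core (Suc (Suc k)) C" "Z = mtop M closure_of C" "p \<in> C" "p \<in> Z" "p \<in> T"
    "card (walls_at p) = Suc (Suc k)"
    by (rule facetE[OF Suc.prems(1)])
  have "\<not> walls_at p \<subseteq> {j}"
  proof
    assume "walls_at p \<subseteq> {j}"
    then have "card (walls_at p) \<le> card {j}" by (intro card_mono) auto
    then show False using C(6) by simp
  qed
  then obtain i where i: "i \<in> walls_at p" "i \<noteq> j" by blast
  have p: "p \<in> B" "p \<in> B'" using Suc.prems(4) C(4) by blast+
  have side: "i \<in> idx B \<longleftrightarrow> i \<in> idx B'" using Suc.prems(6) i(2) by blast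
  obtain Z' where Z': "Z' \<in> facets M P (Suc k)" "mtop M closure_of C \<subseteq> Z'" "Z' \<subseteq> B" "Z' \<subseteq> B'"
    by (rule larger_facet[OF C(1,3) i(1) Suc.prems(2) p(1) Suc.prems(3) p(2) side])
  then obtain h where h: "(B, B', h) \<in> gluing s (Suc k) Z'"
    using Suc.IH[of Z'] Suc.prems by blast
  have "Z' \<in> facets M P (Suc (Suc k) - 1)" "Z \<subseteq> Z'" using Z'(1,2) C(2) by auto
  then have "(B, B', restrict h Z) \<in> preliminary_quiver M P (gluing s (Suc k)) (Suc (Suc k)) Z"
    unfolding preliminary_quiver_def using h by blast
  then show ?case using gluing_Suc[of "Suc k" s Z] by auto
qed

lemma gluing_saturated:
  assumes Z: "Z \<in> facets M P (Suc k)"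
  shows "saturated (blocks_around P Z) (gluing s (Suc k) Z)"
proof -
  obtain C p where C: "facet_core (Suc k) C" "Z = mtop M closure_of C" "p \<in> C" "p \<in> Z" "p \<in> T" "card (walls_at p) = Suc k"
    by (rule facetE[OF Z])
  have around: "B \<in> blocks_around P Z \<longleftrightarrow> B \<in> P \<and> p \<in> B" for B
    unfolding blocks_around_def C(2) using facet_subset_block_iff[OF C(1,3)] by blast
  let ?top = "\<chi>_at p \<union> walls_at p"
  define E where "E = {(x, y). \<exists>h. (x, y, h) \<in> gluing s (Suc k) Z}"
  have topY: "p \<in> Y ?top" unfolding Y_iff[OF C(5)] by blast
  have "(B, block ?top p) \<in> E\<^sup>*" if "B \<in> P" "p \<in> B" for B
    using that
  \<comment> \<open>The induction counts the indices still missing from the largest possible set;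
    one arrow adds one of them.\<close>
  proof (induction "card (?top - idx B)" arbitrary: B)
    case 0
    have "finite ?top" using finite_subset[OF chi_subset finite_J] walls_at_subset(2) by blast
    then have "?top \<subseteq> idx B" using 0(1) by simp
    then have "idx B = ?top" using in_block(5)[OF 0(2,3)] by blast
    then have "B = block ?top p" using in_block(1)[OF 0(2,3)] by metis
    then show ?case by simp
  next
    case (Suc m)
    then have "?top - idx B \<noteq> {}" by (metis card.empty nat.distinct(1))
    then obtain j where j: "j \<in> ?top - idx B" by blast
    note iB = in_block(4,5)[OF Suc(3,4)]
    let ?A = "insert j (idx B)"
    have Y: "p \<in> Y ?A" unfolding Y_iff[OF C(5)] using iB j by blast
    note B' = component_over_block(2)[OF Y] block_in_P[OF Y]
    have fin: "finite (?top - idx B)" using finite_subset[OF chi_subset finite_J] walls_at_subset(2)[of p] by simp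
    have "?top - idx (block ?A p) = (?top - idx B) - {j}" unfolding B'(3) by blast
    then have "m = card (?top - idx (block ?A p))" using Suc(2) j fin by simp
    then have rest: "(block ?A p, block ?top p) \<in> E\<^sup>*" by (rule Suc(1)[OF _ B'(2,1)])
    have "Z \<subseteq> B \<inter> block ?A p" using around[of B] around[of "block ?A p"] Suc(3,4) B' unfolding blocks_around_def by blast
    then have "\<exists>h. (B, block ?A p, h) \<in> gluing s (Suc k) Z"
      by (rule gluing_arrow[OF Z Suc(3) B'(2)]) (use j B'(3) in auto)
    then have "(B, block ?A p) \<in> E" unfolding E_def by blast
    then show ?case using rest by (rule converse_rtrancl_into_rtrancl)
  qed
  then show ?thesis
    unfolding saturated_def E_def[symmetric]
    using around block_in_P(1)[OF topY] component_over_block(2)[OF topY] by blast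
qed

end

section \<open>Blocks and clutching maps of the tensorial system\<close>

locale tensorial_system = regular_cover M J U
  for M :: "('a, 'n::finite) mcorner" and J :: "nat set" and U :: "nat \<Rightarrow> 'a set" +
  fixes H :: "nat \<Rightarrow> ('a, 'b, 'k) vbundle" and s :: "nat \<Rightarrow> 'a \<Rightarrow> 'b \<Rightarrow> complex"
  assumes H_bundle: "j \<in> J \<Longrightarrow> vector_bundle M (H j)"
    and S_base: "j \<in> J \<Longrightarrow> S j \<subseteq> base (H j)"
    and s_section: "j \<in> J \<Longrightarrow> smooth_section_on M (H j) (S j) (s j)"
    and nonvanishing: "j \<in> J \<Longrightarrow> p \<in> S j \<inter> (\<Union>i \<in> J - {j}. S i) \<Longrightarrow> s j p \<noteq> 0"
begin

abbreviation F :: "'a set \<Rightarrow> ('a, nat \<Rightarrow> 'b, nat \<Rightarrow> 'k) vbundle" where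
  "F \<equiv> tensorial_block M J U H"

lemma F_eq: "F B = tensor_bundle (idx B) H"
  by (simp add: tensorial_block_def)

lemma block_subset_S: "B \<in> P \<Longrightarrow> i \<in> idx B \<Longrightarrow> B \<subseteq> S i"
proof
  fix p assume B: "B \<in> P" and i: "i \<in> idx B" and p: "p \<in> B"
  have "i \<in> J" using idx_nonempty(2)[OF B] i by blast
  moreover have "i \<in> \<chi>_at p \<union> walls_at p" using in_block(5)[OF B p] i by blast
  ultimately show "p \<in> S i" using U_subset_S[of i] by (auto simp: chi_def walls_at_def)
qed

lemma bundle_F: "B \<in> P \<Longrightarrow> vector_bundle M (F B)"
  unfolding F_eq
  by (rule vector_bundle_tensor) (use idx_nonempty[of B] H_bundle in blast)+

lemma block_subset_base:
  assumes "B \<in> P" shows "B \<subseteq> base (F B)"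
proof -
  have "B \<subseteq> base (H i)" if "i \<in> idx B" for i
    using block_subset_S[OF assms that] S_base idx_nonempty(2)[OF assms] that by blast
  then show ?thesis by (auto simp: F_eq tensor_bundle_def)
qed

lemma rank_F: "B \<in> P \<Longrightarrow> p \<in> B \<Longrightarrow> bundle_rank (F B) B = (\<Prod>i\<in>idx B. cfun.dim (fibre (H i) p))"
proof -
  assume B: "B \<in> P" and p: "p \<in> B"
  have "bundle_rank (F B) B = cfun.dim (fibre (F B) p)"
    by (rule bundle_rank_eq[OF bundle_F[OF B] component_over(3)[OF is_component_over_idx[OF B]] block_subset_base[OF B] p])
  also have "\<dots> = (\<Prod>i\<in>idx B. cfun.dim (fibre (H i) p))"
    unfolding F_eq
    by (rule dim_fibre_tensor) (use idx_nonempty[OF B] H_bundle block_subset_base[OF B] p F_eq[of B] in auto)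
  finally show ?thesis .
qed

lemma clutching_map_insert:
  assumes Z: "Z \<noteq> {}" "Z \<subseteq> B \<inter> B'" and B: "B \<in> P" "B' \<in> P" and j: "j \<notin> idx B" "idx B' = insert j (idx B)"
  shows "clutching_map M P F Z (B, B', restrict (\<lambda>p. insert_vec j (s j p)) Z)"
proof -
  note iB = idx_nonempty[OF B(1)] and iB' = idx_nonempty[OF B(2)]
  have jJ: "j \<in> J" using iB'(2) j(2) by blast
  have vb: "vector_bundle M (H i)" if "i \<in> insert j (idx B)" for i using H_bundle that iB(2) jJ by blast
  obtain W0 s' where s': "S j \<subseteq> W0" "smooth_section M (H j) W0 s'" "\<And>p. p \<in> S j \<Longrightarrow> s' p = s j p"
    using s_section[OF jJ] unfolding smooth_section_on_def by blast
  have ZS: "p \<in> S j" "s j p \<noteq> 0" "s' p = s j p" if p: "p \<in> Z" for p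
  proof -
    show pS: "p \<in> S j" using block_subset_S[OF B(2), of j] j(2) Z(2) p by blast
    \<comment> \<open>\<open>idx B\<close> is nonempty and does not contain \<open>j\<close>, so
      \<open>Z\<close> lies in the closure of another member; there \<open>s j\<close> is known not
      to vanish.\<close>
    obtain i where i: "i \<in> idx B" using iB(1) by blast
    then have "p \<in> S i" using block_subset_S[OF B(1) i] Z(2) p by blast
    then show "s j p \<noteq> 0" using nonvanishing[OF jJ, of p] pS i j(1) iB(2) by blast
    show "s' p = s j p" by (rule s'(3)[OF pS])
  qed
  \<comment> \<open>A neighbourhood of \<open>Z\<close> on which the extension \<open>s'\<close>
    still does not vanish; it witnesses smoothness around \<open>Z\<close>.\<close>
  define W where "W = {p \<in> W0. s' p \<noteq> 0} \<inter> base (F B')"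
  have oW: "openin (mtop M) W"
    unfolding W_def
    by (intro openin_Int openin_nonzero_section[OF manifold H_bundle[OF jJ] s'(2)] vector_bundleD(1)[OF bundle_F[OF B(2)]])
  have ZW: "Z \<subseteq> W"
  proof
    fix p assume p: "p \<in> Z"
    then show "p \<in> W" using ZS[OF p] s'(1) block_subset_base[OF B(2)] Z(2) by (auto simp: W_def)
  qed
  have emb: "bundle_embedding M (F B) (F B') W (\<lambda>p. insert_vec j (s' p))"
    unfolding F_eq j(2)
  proof (rule bundle_embedding_insert[where A = "idx B" and j = j and H = H and M = M and W = W and W0 = W0 and s = s'])
    show "W \<subseteq> base (tensor_bundle (insert j (idx B)) H)" "W \<subseteq> W0" by (auto simp: W_def F_eq j(2))
    show "s' p \<noteq> 0" if "p \<in> W" for p using that by (simp add: W_def)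
  qed (use iB(3) j(1) vb s'(2) oW in auto)
  \<comment> \<open>The factor is positive because the fibre of \<open>H j\<close> contains the
    nonzero vector \<open>s j p\<close>, so the rank cannot drop along an arrow.\<close>
  have rank: "bundle_rank (F B') B' = bundle_rank (F B) B * cfun.dim (fibre (H j) p)" if p: "p \<in> Z" for p
    using rank_F[OF B(1), of p] rank_F[OF B(2), of p] Z(2) p j iB(3) by (simp add: subset_iff mult.commute)
  have dim_pos: "0 < cfun.dim (fibre (H j) p)" if p: "p \<in> Z" for p
  proof -
    have w: "s j p \<in> fibre (H j) p"
      using section_in_fibre[OF H_bundle[OF jJ] s'(2), of p] ZS[OF p] s'(1) by auto
    have "p \<in> base (H j)" using S_base[OF jJ] ZS(1)[OF p] by blast
    then obtain V I e where e: "(V, I, e) \<in> frames (H j)" "p \<in> V" by (rule frame_at[OF H_bundle[OF jJ]])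
    have "I \<noteq> {}"
    proof
      assume "I = {}"
      then have "fibre (H j) p = {0}" using vector_bundleD(7)[OF H_bundle[OF jJ] e] by simp
      then show False using w ZS(2)[OF p] by simp
    qed
    then show ?thesis using dim_fibre[OF H_bundle[OF jJ] e] vector_bundleD(4)[OF H_bundle[OF jJ] e(1)] by (simp add: card_gt_0_iff)
  qed
  have "bundle_rank (F B) B < bundle_rank (F B') B' \<or> bundle_rank (F B) B = bundle_rank (F B') B' \<and>
    (\<forall>p\<in>Z. bij_betw (restrict (\<lambda>p. insert_vec j (s j p)) Z p) (fibre (F B) p) (fibre (F B') p))"
  proof (cases "bundle_rank (F B) B = bundle_rank (F B') B'")
    case True
    have "bij_betw (insert_vec j (s j p)) (fibre (F B) p) (fibre (F B') p)" if p: "p \<in> Z" for p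
      unfolding F_eq j(2)
    proof (rule bij_betw_insert_vec[OF iB(3,1) j(1) vb])
      have pB: "p \<in> B" "p \<in> B'" using Z(2) p by blast+
      then show "p \<in> base (tensor_bundle (insert j (idx B)) H)" using block_subset_base[OF B(2)] by (auto simp: F_eq j(2))
      show "s j p \<in> fibre (H j) p" "s j p \<noteq> 0"
        using section_in_fibre[OF H_bundle[OF jJ] s'(2), of p] ZS[OF p] s'(1) by auto
      show "cfun.dim (fibre (tensor_bundle (idx B) H) p) = cfun.dim (fibre (tensor_bundle (insert j (idx B)) H) p)"
        using True bundle_rank_eq[OF bundle_F[OF B(1)] component_over(3)[OF is_component_over_idx[OF B(1)]] block_subset_base[OF B(1)] pB(1)]
          bundle_rank_eq[OF bundle_F[OF B(2)] component_over(3)[OF is_component_over_idx[OF B(2)]] block_subset_base[OF B(2)] pB(2)]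
        by (simp add: F_eq j(2))
    qed
    then show ?thesis using True by simp
  next
    case False
    obtain p where p: "p \<in> Z" using Z(1) by blast
    have "bundle_rank (F B) B \<le> bundle_rank (F B') B'"
      unfolding rank[OF p] using dim_pos[OF p] by simp
    then show ?thesis using False by simp
  qed
  moreover have "B \<in> blocks_around P Z" "B' \<in> blocks_around P Z" "B \<noteq> B'"
    using B Z(2) j by (auto simp: blocks_around_def)
  moreover have "\<exists>W h'. Z \<subseteq> W \<and> bundle_embedding M (F B) (F B') W h' \<and>
      (\<forall>p\<in>Z. \<forall>x\<in>fibre (F B) p. h' p x = restrict (\<lambda>p. insert_vec j (s j p)) Z p x)"
    by (rule exI[of _ W], rule exI[of _ "\<lambda>p. insert_vec j (s' p)"]) (use ZW emb ZS(3) in auto)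
  ultimately show ?thesis unfolding clutching_map_def by simp
qed

text \<open>The blocks containing the face have index set \<open>\<chi>_at p\<close> or its
  extension by the single wall, and each index set determines its block; \<open>face_label\<close>
  fixes the direction, so exactly one arrow remains.\<close>

lemma face_arrow:
  assumes Z: "Z \<in> facets M P 1"
  shows "\<exists>a. tensorial_clutching M J U s Z = {a} \<and> clutching_map M P F Z a"
proof -
  obtain C p where C: "facet_core 1 C" "Z = mtop M closure_of C" "p \<in> C" "p \<in> Z" "p \<in> T" "card (walls_at p) = 1"
    by (rule facetE[OF Z])
  obtain j where j: "walls_at p = {j}" using C(6) by (rule card_1_singletonE)
  have jchi: "j \<notin> \<chi>_at p" using chi_walls_disjoint[of p] j by blast
  have Y0: "p \<in> Y (\<chi>_at p)" and Y1: "p \<in> Y (insert j (\<chi>_at p))" unfolding Y_iff[OF C(5)] j by blast+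
  let ?B0 = "block (\<chi>_at p) p" and ?B1 = "block (insert j (\<chi>_at p)) p"
  note B0 = block_in_P[OF Y0] component_over_block(2)[OF Y0]
  note B1 = block_in_P[OF Y1] component_over_block(2)[OF Y1]
  have sub: "Z \<subseteq> ?B0 \<inter> ?B1"
    unfolding C(2) using facet_subset_block_iff[OF C(1,3) B0(1)] facet_subset_block_iff[OF C(1,3) B1(1)] B0(3) B1(3) by blast
  have j01: "j \<notin> idx ?B0" "idx ?B1 = insert j (idx ?B0)" using B0(2) B1(2) jchi by auto
  let ?a = "(?B0, ?B1, restrict (\<lambda>p. insert_vec j (s j p)) Z)"
  have "tensorial_clutching M J U s Z = {?a}"
  proof
    show "{?a} \<subseteq> tensorial_clutching M J U s Z"
      using tensorial_arrow_1(1)[OF Z B0(1) B1(1) sub j01] by blast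
    show "tensorial_clutching M J U s Z \<subseteq> {?a}"
    proof
      fix a assume "a \<in> tensorial_clutching M J U s Z"
      then obtain B B' i where a: "a = (B, B', restrict (\<lambda>p. insert_vec i (s i p)) Z)" and B: "B \<in> P" "B' \<in> P" "B \<noteq> B'"
        "Z \<subseteq> B \<inter> B'" and i: "i \<in> J" "Z \<subseteq> wall M U i" "face_label M U i B B'"
        unfolding tensorial_clutching_def by blast
      have "i \<in> walls_at p" using facet_subset_wall_iff[OF C(1,3) i(1)] i(2) C(2) by simp
      then have ij: "i = j" using j by blast
      have p: "p \<in> B" "p \<in> B'" using B(4) C(4) by blast+
      have jB: "j \<notin> idx B" using face_labelD[OF B(1) i(1,3)] ij by blast
      have iB: "idx B = \<chi>_at p" using in_block(4)[OF B(1) p(1)] in_block(5)[OF B(1) p(1), unfolded j] jB by blast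
      then have "B = ?B0" using in_block(1)[OF B(1) p(1)] by metis
      moreover have "idx B' \<noteq> \<chi>_at p" using blocks_eq_if_idx_eq[OF B(1,2) p] B(3) iB by metis
      then have "idx B' = insert j (\<chi>_at p)" using in_block(4)[OF B(2) p(2)] in_block(5)[OF B(2) p(2), unfolded j] by blast
      then have "B' = ?B1" using in_block(1)[OF B(2) p(2)] by metis
      ultimately show "a \<in> {?a}" using a ij by simp
    qed
  qed
  moreover have "clutching_map M P F Z ?a"
    by (rule clutching_map_insert[OF _ sub B0(1) B1(1) j01]) (use C(4) in auto)
  ultimately show ?thesis by blast
qed

theorem tensorial_settlement: "settlement M P F (gluing s)"
  unfolding settlement_def
proof (intro conjI ballI allI impI)
  show "regular_partition M P" by (rule regular_partition_P)
  show "vector_bundle M (F B)" "B \<subseteq> base (F B)" if "B \<in> P" for B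
    using bundle_F block_subset_base that by blast+
  show "\<exists>a. gluing s 1 Z = {a} \<and> clutching_map M P F Z a" if "Z \<in> facets M P 1" for Z
    using face_arrow[OF that] by simp
  fix k Z assume k: "2 \<le> k" and Z: "Z \<in> facets M P k"
  then obtain m where m: "k = Suc (Suc m)" by (metis Suc_le_D numeral_2_eq_2 Suc_le_mono)
  \<comment> \<open>From codimension two on this is the definition of
    \<open>restricted_gluing\<close>, so saturation is all that remains.\<close>
  have Q: "gluing s k Z = preliminary_quiver M P (gluing s (k - 1)) k Z" using gluing_Suc[of "Suc m" s Z] by (simp add: m)
  have "saturated (blocks_around P Z) (gluing s k Z)" using gluing_saturated[of Z "Suc m" s] Z m by simp
  then show "let Q' = preliminary_quiver M P (gluing s (k - 1)) k Z; Q = gluing s k Z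
        in (if saturated (blocks_around P Z) Q' then Q = Q'
            else Q' \<subseteq> Q \<and> (\<forall>a \<in> Q - Q'. clutching_map M P F Z a) \<and> saturated (blocks_around P Z) Q) \<and>
           (\<forall>as u v. simple_path Q u as v \<and> set as \<inter> (Q - Q') \<noteq> {} \<longrightarrow>
              (if u = v then \<forall>p\<in>Z. \<forall>x \<in> fibre (F u) p. path_map as p x = x
               else \<forall>as'. simple_path Q u as' v \<and> as' \<noteq> as \<longrightarrow>
                      (\<forall>p\<in>Z. \<forall>x \<in> fibre (F u) p. path_map as p x = path_map as' p x)))"
    unfolding Q[symmetric] Let_def by simp
qed

end

text \<open>The first two conjuncts show that the data are well defined: they justify the
  \<open>THE\<close> in \<open>block_index\<close> and the relabelling that directs each clutching
  map.\<close>

theorem mainTheorem1: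
  fixes M :: "('a, 'n::finite) mcorner"
    and N :: nat
    and U :: "nat \<Rightarrow> 'a set"
    and H :: "nat \<Rightarrow> ('a, 'b, 'k) vbundle"
    and s :: "nat \<Rightarrow> 'a \<Rightarrow> 'b \<Rightarrow> complex"
  assumes "manifold_with_corners M"
    and "regular_covering M {1..N} U"
    and "\<And>j. j \<in> {1..N} \<Longrightarrow> vector_bundle M (H j)"
    and "\<And>j. j \<in> {1..N} \<Longrightarrow> mtop M closure_of U j \<subseteq> base (H j)"
    and "\<And>j. j \<in> {1..N} \<Longrightarrow> smooth_section_on M (H j) (mtop M closure_of U j) (s j)"
    and "\<And>j p. j \<in> {1..N} \<Longrightarrow>
           p \<in> mtop M closure_of U j \<inter> (\<Union>j' \<in> {1..N} - {j}. mtop M closure_of U j') \<Longrightarrow> s j p \<noteq> 0"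
  defines "P \<equiv> covering_partition M {1..N} U"
    and "Ji \<equiv> block_index M {1..N} U"
    and "F \<equiv> tensorial_block M {1..N} U H"
    and "h \<equiv> tensorial_clutching M {1..N} U s"
  shows "(\<forall>B\<in>P. \<exists>!A. is_component_over M {1..N} U A B) \<and>
         (\<forall>Z \<in> facets M P 1. \<forall>B\<in>P. \<forall>B'\<in>P. B \<noteq> B' \<and> Z \<subseteq> B \<inter> B' \<longrightarrow>
           (\<exists>!j. j \<in> {1..N} \<and> Z \<subseteq> wall M U j) \<and>
           (\<forall>j\<in>{1..N}. Z \<subseteq> wall M U j \<longrightarrow>
              face_label M U j B B' \<and> j \<notin> Ji B \<and> Ji B' = insert j (Ji B) \<or>
              face_label M U j B' B \<and> j \<notin> Ji B' \<and> Ji B = insert j (Ji B'))) \<and>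
         settlement M P F (restricted_gluing M P h)"
proof -
  interpret tensorial_system M "{1..N}" U H s
    using assms(1-6) by unfold_locales auto
  show ?thesis
    unfolding P_def Ji_def F_def h_def
  proof (intro conjI ballI impI tensorial_settlement)
    show "\<exists>!A. is_component_over M {1..N} U A B" if "B \<in> covering_partition M {1..N} U" for B
      using ex1_component_over[OF that] .
  next
    fix Z B B'
    assume Z: "Z \<in> facets M (covering_partition M {1..N} U) 1" and B: "B \<in> covering_partition M {1..N} U"
      "B' \<in> covering_partition M {1..N} U" and ne: "B \<noteq> B' \<and> Z \<subseteq> B \<inter> B'"
    note adj = adjacent_face[OF Z B conjunct1[OF ne] conjunct2[OF ne]]
    show "\<exists>!j. j \<in> {1..N} \<and> Z \<subseteq> wall M U j" by (rule adj(1))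
    show "face_label M U j B B' \<and> j \<notin> block_index M {1..N} U B \<and>
        block_index M {1..N} U B' = insert j (block_index M {1..N} U B) \<or>
      face_label M U j B' B \<and> j \<notin> block_index M {1..N} U B' \<and>
        block_index M {1..N} U B = insert j (block_index M {1..N} U B')"
      if "j \<in> {1..N}" "Z \<subseteq> wall M U j" for j
      by (rule adj(2)[OF that])
  qed
qed

end
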